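(* Let $d\ge1$, let $q\ge1$ be an integer, let $\mathtt{m}>0$, and consider the equation $$\partial_{tt}\psi-\Delta\psi+\mathtt{m}\psi+\psi^{q+1}=0,\qquad x\in\mathbb{T}^d=(\mathbb{R}/2\pi\mathbb{Z})^d. \tag{KG}$$ Fix $0<\delta\ll1$ (sufficiently small), $s_0>d/2$, and $s_1\ge s_0$. There exist constants $\mathtt{M}>0$ and $\mathtt{c}_{\mathtt{m}}>0$ (the latter depending on $\mathtt{m}$) such that for any $s\ge s_1+1$ and any $(\psi_0,\phi_0)\in H^{s+\frac12}(\mathbb{T}^d)\times H^{s-\frac12}(\mathbb{T}^d)$ such that $$\|\psi_0\|_{H^{s_1+1/2}}+\|\phi_0\|_{H^{s_1-1/2}}+(2\mathtt{M})^{s_1}\big(\|\psi_0\|_{H^{1/2}}+\|\phi_0\|_{H^{-1/2}}\big)\le\delta,$$ the following holds. There exist a time $T=T(\delta,\mathtt{M},s_1)>0$ and a unique solution $\psi(t)$ of (KG) with initial condition $\psi(0)=\psi_0$, $\psi_t(0)=\phi_0$ such that $$\psi\in C^0\big([0,T];H^{s+1/2}(\mathbb{T}^d;\mathbb{C})\big)\cap C^1\big([0,T];H^{s-1/2}(\mathbb{T}^d;\mathbb{C})\big),\qquad T\ge T_{good}:=\frac1{\delta^q}\,\frac{2^{q(s_1-s_0)}}{\mathtt{c}_{\mathtt{m}}\mathtt{M}^{qs_0}}.$$ Moreover, for any $t\in[0,T]$, $$\|\psi(t)\|_{H^{s+\frac12}}+\|\partial_t\psi(t)\|_{H^{s-\frac12}}\lesssim_s\big(\|\psi_0\|_{H^{s+\frac12}}+\|\phi_0\|_{H^{s-\frac12}}\big)\Big[1+\Big(\mathtt{M}^{q(s-s_1)}\frac{t}{T_{good}}\Big)^{s-s_1}\Big],$$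 and, as a consequence, for any $\widehat T\le T_{good}$, $$\sup_{t\in[0,\widehat T]}\big(\|\psi(t)\|_{H^{s+\frac12}}+\|\partial_t\psi(t)\|_{H^{s-\frac12}}\big)\lesssim_s\big(\|\psi_0\|_{H^{s+\frac12}}+\|\phi_0\|_{H^{s-\frac12}}\big)\big(1+\mathtt{M}^{q(s-s_1)^2}\big).$$
   Context: For $\sigma\in\mathbb{R}$, $H^\sigma(\mathbb{T}^d)=H^\sigma(\mathbb{T}^d;\mathbb{C})$ is the Sobolev space of $u(x)=\sum_{j\in\mathbb{Z}^d}u_je^{\mathrm{i}j\cdot x}$ with norm $\|u\|_{H^\sigma}^2=\sum_j\langle j\rangle^{2\sigma}|u_j|^2$, where $\langle j\rangle=\max\{1,|j|\}$ and $|j|$ is the Euclidean norm. $A\lesssim_s B$ means $A\le CB$ with $C>0$ depending only on $s$ and on parameters fixed once and for all. *)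

theory Defs
  imports "HOL-Analysis.Analysis"
begin

text \<open>
  A (periodic) distribution \<open>u = \<Sum>\<^sub>j u\<^sub>j e\<^sup>i\<^sup>j\<^sup>\<cdot>\<^sup>x\<close> on \<open>\<T>\<^sup>d\<close>, \<open>d = CARD('n)\<close>, is represented by its family of
  Fourier coefficients, so that \<open>H\<^sup>\<sigma>\<close> makes sense for every real \<open>\<sigma>\<close>, negative ones included.
\<close>

type_synonym 'n fourier = "(int, 'n) vec \<Rightarrow> complex"

definition freq :: "int ^ 'n::finite \<Rightarrow> real ^ 'n" where
  "freq j = (\<chi> i. real_of_int (j $ i))"

definition japanese :: "int ^ 'n::finite \<Rightarrow> real" where
  "japanese j = max 1 (norm (freq j))"

definition sobolev :: "real \<Rightarrow> ('n::finite) fourier set" where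
  "sobolev \<sigma> = {u. (\<lambda>j. japanese j powr (2 * \<sigma>) * (cmod (u j))\<^sup>2) summable_on UNIV}"

text \<open>Only meaningful on \<^const>\<open>sobolev\<close>: a divergent sum is \<open>0\<close> by convention.\<close>

definition sobolev_norm :: "real \<Rightarrow> ('n::finite) fourier \<Rightarrow> real" where
  "sobolev_norm \<sigma> u = sqrt (\<Sum>\<^sub>\<infinity>j. japanese j powr (2 * \<sigma>) * (cmod (u j))\<^sup>2)"

text \<open>
  The sum defining \<open>torus_fun u\<close> converges absolutely if \<open>u\<close> is in \<open>H\<^sup>\<sigma>\<close> with \<open>\<sigma> > d/2\<close>. The power
  \<open>u\<^sup>p\<close> is the pointwise power of this function, read back as a Fourier series.
\<close>

definition torus_fun :: "('n::finite) fourier \<Rightarrow> real ^ 'n \<Rightarrow> complex" where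
  "torus_fun u x = (\<Sum>\<^sub>\<infinity>j. u j * cis (freq j \<bullet> x))"

definition fourier_coeff :: "(real ^ 'n::finite \<Rightarrow> complex) \<Rightarrow> 'n fourier" where
  "fourier_coeff f j =
     (LINT x:cbox 0 (\<chi> i. 2 * pi)|lborel. f x * cis (- (freq j \<bullet> x))) / (2 * pi) ^ CARD('n)"

definition torus_power :: "('n::finite) fourier \<Rightarrow> nat \<Rightarrow> 'n fourier" where
  "torus_power u p = fourier_coeff (\<lambda>x. torus_fun u x ^ p)"

definition laplacian :: "('n::finite) fourier \<Rightarrow> 'n fourier" where
  "laplacian u j = - (of_real ((norm (freq j))\<^sup>2) * u j)"

definition sobolev_continuous_on :: "real \<Rightarrow> real set \<Rightarrow> (real \<Rightarrow> ('n::finite) fourier) \<Rightarrow> bool" where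
  "sobolev_continuous_on \<sigma> I \<psi> \<longleftrightarrow>
     (\<forall>t\<in>I. \<psi> t \<in> sobolev \<sigma>) \<and>
     (\<forall>t\<in>I. ((\<lambda>\<tau>. sobolev_norm \<sigma> (\<lambda>j. \<psi> \<tau> j - \<psi> t j)) \<longlongrightarrow> 0) (at t within I))"

text \<open>\<open>\<psi>'\<close> is the derivative of the curve \<open>\<psi>\<close> on \<open>I\<close>, in the norm of \<open>H\<^sup>\<sigma>\<close> (one-sided at end points).\<close>

definition has_sobolev_derivative_on ::
  "real \<Rightarrow> real set \<Rightarrow> (real \<Rightarrow> ('n::finite) fourier) \<Rightarrow> (real \<Rightarrow> 'n fourier) \<Rightarrow> bool" where
  "has_sobolev_derivative_on \<sigma> I \<psi> \<psi>' \<longleftrightarrow>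
     (\<forall>t\<in>I. \<psi> t \<in> sobolev \<sigma> \<and> \<psi>' t \<in> sobolev \<sigma>) \<and>
     (\<forall>t\<in>I. ((\<lambda>\<tau>. sobolev_norm \<sigma> (\<lambda>j. (\<psi> \<tau> j - \<psi> t j) /\<^sub>R (\<tau> - t) - \<psi>' t j)) \<longlongrightarrow> 0) (at t within I))"

text \<open>
  \<open>\<psi>\<close> is in \<open>C\<^sup>0([0,T]; H\<^sup>s\<^sup>+\<^sup>1\<^sup>/\<^sup>2) \<inter> C\<^sup>1([0,T]; H\<^sup>s\<^sup>-\<^sup>1\<^sup>/\<^sup>2)\<close> with time derivative \<open>\<psi>\<^sub>t\<close>, and solves
  \<open>\<partial>\<^sub>t\<^sub>t\<psi> - \<Delta>\<psi> + m \<psi> + \<psi>\<^sup>q\<^sup>+\<^sup>1 = 0\<close>. The two derivatives lost by \<open>\<Delta>\<close> make \<open>H\<^sup>s\<^sup>-\<^sup>3\<^sup>/\<^sup>2\<close> the space in which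
  the equation holds.
\<close>

definition KG_solution ::
  "nat \<Rightarrow> real \<Rightarrow> real \<Rightarrow> real \<Rightarrow> ('n::finite) fourier \<Rightarrow> 'n fourier \<Rightarrow>
   (real \<Rightarrow> 'n fourier) \<Rightarrow> (real \<Rightarrow> 'n fourier) \<Rightarrow> bool" where
  "KG_solution q m s T \<psi>\<^sub>0 \<phi>\<^sub>0 \<psi> \<psi>\<^sub>t \<longleftrightarrow>
     sobolev_continuous_on (s + 1/2) {0..T} \<psi> \<and>
     has_sobolev_derivative_on (s - 1/2) {0..T} \<psi> \<psi>\<^sub>t \<and>
     sobolev_continuous_on (s - 1/2) {0..T} \<psi>\<^sub>t \<and>
     has_sobolev_derivative_on (s - 3/2) {0..T} \<psi>\<^sub>t
       (\<lambda>t j. laplacian (\<psi> t) j - of_real m * \<psi> t j - torus_power (\<psi> t) (q + 1) j) \<and>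
     \<psi> 0 = \<psi>\<^sub>0 \<and> \<psi>\<^sub>t 0 = \<phi>\<^sub>0"

definition pair_norm :: "real \<Rightarrow> ('n::finite) fourier \<Rightarrow> 'n fourier \<Rightarrow> real" where
  "pair_norm s u v = sobolev_norm (s + 1/2) u + sobolev_norm (s - 1/2) v"

definition T_good :: "nat \<Rightarrow> real \<Rightarrow> real \<Rightarrow> real \<Rightarrow> real \<Rightarrow> real \<Rightarrow> real" where
  "T_good q s0 s1 \<delta> M c = 1 / \<delta> ^ q * (2 powr (real q * (s1 - s0)) / (c * M powr (real q * s0)))"

end

theory Submission
  imports Defs
begin

text \<open>
  The equation gains one derivative: in Duhamel's formula the source \<open>\<psi>\<^sup>q\<^sup>+\<^sup>1\<close> is only needed in
  \<open>H\<^sup>s\<^sup>-\<^sup>1\<^sup>/\<^sup>2\<close>, and there it obeys a tame estimate in which \<open>q\<close> factors are measured by the \<open>\<ell>\<^sup>1\<close> norm of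
  their Fourier coefficients. We take \<open>M = 1\<close> and \<open>T = T\<^sub>g\<^sub>o\<^sub>o\<^sub>d\<close>. Interpolating between the two small norms bounds
  the data at regularity \<open>s\<^sub>0\<close>, and hence their \<open>\<ell>\<^sup>1\<close> norm, by a multiple of
  \<open>\<epsilon> = 2 powr (s\<^sub>0 - s\<^sub>1) * \<delta>\<close>. Since \<open>T\<^sub>g\<^sub>o\<^sub>o\<^sub>d = 1 / (c \<epsilon>\<^sup>q)\<close>, the Picard iteration converges on all of
  \<open>[0, T\<^sub>g\<^sub>o\<^sub>o\<^sub>d]\<close>. Convergence is read off from a monotone iteration of time-independent majorants for the
  Fourier coefficients, so that limits and derivatives in Sobolev norms become dominated convergence. In the high
  norm Gronwall's exponent is the tame constant times \<open>(\<epsilon>\<^sup>q T\<^sub>g\<^sub>o\<^sub>o\<^sub>d)\<^sup>2\<close>, which depends on \<open>s\<close> only; the solution therefore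
  stays below a constant \<open>C s\<close> times its initial size, which is stronger than the claimed growth bound.
\<close>

section \<open>Convolution of summable families\<close>

text \<open>The lifespan may not depend on \<open>s\<close>, yet the data are small only at
  regularity \<open>s1\<close> and at the lowest level. Existence is therefore decided entirely in
  the absolute-sum norm of the Fourier coefficients, where convolution is submultiplicative with
  constant 1 and \<open>s\<close> does not occur; the high norm enters no smallness condition and is
  propagated by an estimate that is linear in it. The obstacle is the notion of solution: it asks
  for limits in Sobolev norms, whereas Duhamel's formula is solved one frequency at a time. An
  energy bound at each time does not permit a limit under the sum over frequencies, but a single
  weighted square-summable family that dominates at all times does. The velocity is dominated by the
  same family multiplied by \<open>japanese j\<close>, because the frequency of each oscillator is
  comparable to \<open>japanese j\<close>; the same comparability puts the factor
  \<open>1 / japanese j\<close> on the source.\<close>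

abbreviation abs_summable :: "('g \<Rightarrow> 'a::real_normed_vector) \<Rightarrow> bool" where
  "abs_summable u \<equiv> (\<lambda>j. norm (u j)) summable_on UNIV"

definition wiener_norm :: "('g \<Rightarrow> 'a::real_normed_vector) \<Rightarrow> real" where
  "wiener_norm u = (\<Sum>\<^sub>\<infinity>j. norm (u j))"

text \<open>The scalar field is left open because the same operation acts on complex Fourier
  coefficients and on their real majorants.\<close>

definition conv :: "('g::ab_group_add \<Rightarrow> 'a::{real_normed_field, banach}) \<Rightarrow> ('g \<Rightarrow> 'a) \<Rightarrow> 'g \<Rightarrow> 'a" where
  "conv u v j = (\<Sum>\<^sub>\<infinity>k. u k * v (j - k))"

text \<open>The exponent is shifted: \<open>conv_power u q\<close> has \<open>q + 1\<close> factors, so that no unit is needed.\<close>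

primrec conv_power :: "('g::ab_group_add \<Rightarrow> 'a::{real_normed_field, banach}) \<Rightarrow> nat \<Rightarrow> 'g \<Rightarrow> 'a" where
  "conv_power u 0 = u"
| "conv_power u (Suc q) = conv u (conv_power u q)"

lemma nonneg_summable_onI:
  fixes f :: "'g \<Rightarrow> real"
  assumes "\<And>x. x \<in> A \<Longrightarrow> 0 \<le> f x" "\<And>F. finite F \<Longrightarrow> F \<subseteq> A \<Longrightarrow> sum f F \<le> B"
  shows "f summable_on A" "infsum f A \<le> B"
proof -
  show "f summable_on A"
    by (rule nonneg_bdd_above_summable_on) (use assms in \<open>auto intro!: bdd_aboveI[of _ B]\<close>)
  then show "infsum f A \<le> B"
    using assms infsum_le_finite_sums by blast
qed

lemma wiener_norm_nonneg: "0 \<le> wiener_norm u"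
  unfolding wiener_norm_def by (simp add: infsum_nonneg)

lemma norm_le_wiener_norm: "abs_summable u \<Longrightarrow> norm (u j) \<le> wiener_norm u"
  unfolding wiener_norm_def using finite_sum_le_infsum[of "\<lambda>j. norm (u j)" UNIV "{j}"] by simp

lemma abs_summable_dominated:
  assumes "g summable_on A" "\<And>j. j \<in> A \<Longrightarrow> norm (f j) \<le> (g j :: real)"
  shows "(\<lambda>j. norm (f j)) summable_on A"
  by (rule Infinite_Sum.abs_summable_on_comparison_test') (use assms in auto)

lemma wiener_norm_mono:
  assumes "g summable_on UNIV" "\<And>j. norm (f j) \<le> (g j :: real)"
  shows "wiener_norm f \<le> infsum g UNIV"
  unfolding wiener_norm_def
  by (rule infsum_mono) (use assms abs_summable_dominated[of g UNIV f] in auto)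

lemma
  fixes f :: "'g \<Rightarrow> real"
  shows abs_summable_realI: "f summable_on UNIV \<Longrightarrow> abs_summable f"
    and abs_summable_realD: "abs_summable f \<Longrightarrow> f summable_on UNIV"
  using summable_on_iff_abs_summable_on_real[of f UNIV] by simp_all

lemma abs_summable_diff:
  assumes "abs_summable u" "abs_summable v"
  shows "abs_summable (\<lambda>j. u j - v j)"
  by (rule abs_summable_dominated[OF summable_on_add[OF assms]]) (rule norm_triangle_ineq4)

lemma wiener_norm_triangle:
  assumes "abs_summable u" "abs_summable v"
  shows "wiener_norm u \<le> wiener_norm v + wiener_norm (\<lambda>j. u j - v j)"
proof -
  have "wiener_norm u \<le> (\<Sum>\<^sub>\<infinity>j. norm (v j) + norm (u j - v j))"
    by (rule wiener_norm_mono[OF summable_on_add])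
      (use assms abs_summable_diff[OF assms] norm_triangle_sub in auto)
  also have "\<dots> = wiener_norm v + wiener_norm (\<lambda>j. u j - v j)"
    unfolding wiener_norm_def by (rule infsum_add) (use assms abs_summable_diff[OF assms] in auto)
  finally show ?thesis .
qed

lemma
  fixes u v :: "'g \<Rightarrow> 'a::{real_normed_field, banach}"
  assumes "abs_summable u" "abs_summable v"
  shows abs_summable_times: "abs_summable (\<lambda>(k, l). u k * v l)"
    and infsum_times: "(\<Sum>\<^sub>\<infinity>(k, l). u k * v l) = infsum u UNIV * infsum v UNIV"
proof -
  have "(\<lambda>p. norm ((\<lambda>(k, l). u k * v l) p)) summable_on UNIV \<times> UNIV"
    unfolding Infinite_Sum.abs_summable_on_Sigma_iff
    using assms summable_on_cmult_left[OF assms(1)]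
    by (auto simp: norm_mult infsum_cmult_right' abs_mult infsum_nonneg intro!: summable_on_cmult_right)
  then show *: "abs_summable (\<lambda>(k, l). u k * v l)" by simp
  have "(\<Sum>\<^sub>\<infinity>(k, l). u k * v l) = (\<Sum>\<^sub>\<infinity>k. \<Sum>\<^sub>\<infinity>l. u k * v l)"
    using infsum_Sigma'_banach[of "\<lambda>k l. u k * v l" UNIV "\<lambda>_. UNIV"] abs_summable_summable[OF *] by simp
  also have "\<dots> = infsum u UNIV * infsum v UNIV"
    by (simp add: infsum_cmult_right' infsum_cmult_left')
  finally show "(\<Sum>\<^sub>\<infinity>(k, l). u k * v l) = infsum u UNIV * infsum v UNIV" .
qed

text \<open>This change of variables turns the double sum of a convolution into the double sum of a
  product, to which Fubini applies.\<close>

lemma bij_shear: "bij (\<lambda>(j, k). (k, j - k :: 'g::ab_group_add))"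
  by (rule bij_betw_byWitness[where f' = "\<lambda>(k, l). (k + l, k)"]) auto

lemma
  fixes u v :: "'g::ab_group_add \<Rightarrow> 'a::{real_normed_field, banach}"
  assumes u: "abs_summable u" and v: "abs_summable v"
  shows abs_summable_conv_terms: "abs_summable (\<lambda>k. u k * v (j - k))"
    and abs_summable_conv: "abs_summable (conv u v)"
    and infsum_conv: "infsum (conv u v) UNIV = infsum u UNIV * infsum v UNIV"
proof -
  have *: "(\<lambda>p. norm ((\<lambda>(j, k). u k * v (j - k)) p)) summable_on UNIV \<times> UNIV"
    using abs_summable_times[OF u v] summable_on_reindex_bij_betw[OF bij_shear, of "\<lambda>(k, l). norm (u k * v l)"]
    by (simp add: case_prod_unfold)
  then show 1: "abs_summable (\<lambda>k. u k * v (j - k))" for j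
    unfolding Infinite_Sum.abs_summable_on_Sigma_iff by simp
  have "abs_summable (\<lambda>j. \<Sum>\<^sub>\<infinity>k. norm (u k * v (j - k)))"
    using * unfolding Infinite_Sum.abs_summable_on_Sigma_iff by simp
  then have "(\<lambda>j. \<Sum>\<^sub>\<infinity>k. norm (u k * v (j - k))) summable_on UNIV"
    by (simp add: infsum_nonneg)
  then show "abs_summable (conv u v)"
    by (rule abs_summable_dominated) (auto simp: conv_def norm_infsum_bound 1)
  have "infsum (conv u v) UNIV = (\<Sum>\<^sub>\<infinity>(j, k). u k * v (j - k))"
    unfolding conv_def using infsum_Sigma'_banach[of "\<lambda>j k. u k * v (j - k)" UNIV "\<lambda>_. UNIV"]
      abs_summable_summable[OF *] by simp
  also have "\<dots> = (\<Sum>\<^sub>\<infinity>(k, l). u k * v l)"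
    using infsum_reindex_bij_betw[OF bij_shear, of "\<lambda>(k, l). u k * v l"] by (simp add: case_prod_unfold)
  finally show "infsum (conv u v) UNIV = infsum u UNIV * infsum v UNIV"
    using infsum_times[OF u v] by simp
qed

text \<open>Taking absolute values inside the sum makes convolution monotone in majorants; the
  coefficientwise bounds on the iteration rest on this comparison.\<close>

lemma norm_conv_le:
  assumes "a summable_on UNIV" "b summable_on UNIV"
    and "\<And>k. norm (u k) \<le> (a k :: real)" "\<And>k. norm (v k) \<le> b k"
  shows "norm (conv u v j) \<le> conv a b j"
proof -
  have a: "abs_summable a" and b: "abs_summable b"
    using assms abs_summable_realI by auto
  have u: "abs_summable u" and v: "abs_summable v"
    using assms abs_summable_dominated by blast+
  have "norm (conv u v j) \<le> (\<Sum>\<^sub>\<infinity>k. norm (u k * v (j - k)))"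
    unfolding conv_def by (rule norm_infsum_bound) (rule abs_summable_conv_terms[OF u v])
  also have "\<dots> \<le> conv a b j"
    unfolding conv_def
  proof (rule infsum_mono)
    show "(\<lambda>k. norm (u k * v (j - k))) summable_on UNIV" by (rule abs_summable_conv_terms[OF u v])
    show "(\<lambda>k. a k * b (j - k)) summable_on UNIV"
      by (rule abs_summable_realD[OF abs_summable_conv_terms[OF a b]])
    show "norm (u k * v (j - k)) \<le> a k * b (j - k)" for k
      unfolding norm_mult by (intro mult_mono) (use assms(3,4) norm_ge_zero order_trans in blast)+
  qed
  finally show ?thesis .
qed

lemma wiener_norm_conv:
  assumes u: "abs_summable u" and v: "abs_summable v"
  shows "wiener_norm (conv u v) \<le> wiener_norm u * wiener_norm v"
proof -
  have *: "abs_summable (\<lambda>j. norm (u j))" "abs_summable (\<lambda>j. norm (v j))"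
    using assms by simp_all
  have "wiener_norm (conv u v) \<le> infsum (conv (\<lambda>j. norm (u j)) (\<lambda>j. norm (v j))) UNIV"
    by (rule wiener_norm_mono)
      (rule abs_summable_realD[OF abs_summable_conv[OF *]], rule norm_conv_le[OF u v], auto)
  also have "\<dots> = wiener_norm u * wiener_norm v"
    using infsum_conv[OF *] by (simp add: wiener_norm_def)
  finally show ?thesis .
qed

text \<open>The product rule for differences. Its asymmetric form suits inductions over
  \<open>conv_power\<close>, where the first factor is the base and the second the lower
  power.\<close>

lemma conv_diff:
  assumes "abs_summable u" "abs_summable v" "abs_summable u'" "abs_summable v'"
  shows "conv u v j - conv u' v' j = conv u (\<lambda>k. v k - v' k) j + conv (\<lambda>k. u k - u' k) v' j"
proof -
  note s = abs_summable_summable[OF abs_summable_conv_terms] assms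
  note d = abs_summable_diff[OF assms(2,4)] abs_summable_diff[OF assms(1,3)]
  have "conv u v j = conv u (\<lambda>k. v k - v' k) j + conv u v' j"
    unfolding conv_def by (subst infsum_add[symmetric, OF s(1)[OF s(2) d(1)] s(1)[OF s(2,5)]]) (simp add: algebra_simps)
  moreover have "conv u v' j = conv (\<lambda>k. u k - u' k) v' j + conv u' v' j"
    unfolding conv_def by (subst infsum_add[symmetric, OF s(1)[OF d(2) s(5)] s(1)[OF s(4,5)]]) (simp add: algebra_simps)
  ultimately show ?thesis by simp
qed

lemma abs_summable_conv_power: "abs_summable u \<Longrightarrow> abs_summable (conv_power u q)"
  by (induction q) (simp_all add: abs_summable_conv)

lemma wiener_norm_conv_power:
  assumes "abs_summable u"
  shows "wiener_norm (conv_power u q) \<le> wiener_norm u ^ Suc q"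
proof (induction q)
  case (Suc q)
  have "wiener_norm (conv_power u (Suc q)) \<le> wiener_norm u * wiener_norm (conv_power u q)"
    by (simp add: wiener_norm_conv abs_summable_conv_power assms)
  also have "\<dots> \<le> wiener_norm u * wiener_norm u ^ Suc q"
    by (intro mult_left_mono Suc wiener_norm_nonneg)
  finally show ?case by simp
qed simp

lemma norm_conv_power_le:
  assumes "a summable_on UNIV" "\<And>k. norm (u k) \<le> (a k :: real)"
  shows "norm (conv_power u q j) \<le> conv_power a q j"
proof (induction q arbitrary: j)
  case (Suc q)
  have "conv_power a q summable_on UNIV"
    by (rule abs_summable_realD[OF abs_summable_conv_power[OF abs_summable_realI[OF assms(1)]]])
  then show ?case using assms Suc by (auto intro!: norm_conv_le)
qed (use assms in simp)

lemma summable_conv_power_real: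
  fixes a :: "'g::ab_group_add \<Rightarrow> real"
  shows "a summable_on UNIV \<Longrightarrow> conv_power a p summable_on UNIV"
  by (rule abs_summable_realD[OF abs_summable_conv_power[OF abs_summable_realI]])

lemma conv_power_nonneg:
  fixes a :: "'g::ab_group_add \<Rightarrow> real"
  assumes "a summable_on UNIV" "\<And>k. 0 \<le> a k"
  shows "0 \<le> conv_power a p j"
  using norm_conv_power_le[OF assms(1), of a p j] assms(2) by simp

text \<open>Expanding both differences by \<open>conv_diff\<close> gives sums of the same shape, and
  term by term the majorant side dominates; the hypotheses force \<open>0 \<le> a \<le> b\<close>
  and make \<open>b\<close> a majorant of \<open>v\<close>. Differences of Picard iterates can thus
  telescope against differences of majorants.\<close>

lemma norm_conv_power_diff_le:
  assumes b: "b summable_on UNIV"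
    and le: "\<And>k. norm (u k) \<le> (a k :: real)" "\<And>k. norm (v k - u k) \<le> b k - a k"
  shows "norm (conv_power v q j - conv_power u q j) \<le> conv_power b q j - conv_power a q j"
proof (induction q arbitrary: j)
  case (Suc q)
  have ab: "0 \<le> a k" "a k \<le> b k" for k
    using le[of k] norm_ge_zero[of "u k"] norm_ge_zero[of "v k - u k"] by linarith+
  have v: "norm (v k) \<le> b k" for k
    using le[of k] norm_triangle_sub[of "v k" "u k"] by simp
  have a: "a summable_on UNIV"
    by (rule abs_summable_realD[OF abs_summable_dominated[OF b]]) (use ab in auto)
  have ua: "abs_summable u" and va: "abs_summable v" and aa: "abs_summable a"
    and ba: "abs_summable b"
    by (rule abs_summable_dominated[OF a le(1)], rule abs_summable_dominated[OF b v])
      (rule abs_summable_realI[OF a], rule abs_summable_realI[OF b])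
  note s = abs_summable_conv_power
  have "norm (conv v (conv_power v q) j - conv u (conv_power u q) j)
      \<le> norm (conv v (\<lambda>k. conv_power v q k - conv_power u q k) j) + norm (conv (\<lambda>k. v k - u k) (conv_power u q) j)"
    unfolding conv_diff[OF va s[OF va] ua s[OF ua]] by (rule norm_triangle_ineq)
  also have "\<dots> \<le> conv b (\<lambda>k. conv_power b q k - conv_power a q k) j + conv (\<lambda>k. b k - a k) (conv_power a q) j"
  proof (intro add_mono norm_conv_le norm_conv_power_le Suc le b v a)
    show "(\<lambda>k. b k - a k) summable_on UNIV"
      by (rule abs_summable_realD[OF abs_summable_diff[OF ba aa]])
    show "conv_power a q summable_on UNIV" "(\<lambda>k. conv_power b q k - conv_power a q k) summable_on UNIV"
      by (rule abs_summable_realD[OF s[OF aa]], rule abs_summable_realD[OF abs_summable_diff[OF s[OF ba] s[OF aa]]])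
  qed
  also have "\<dots> = conv b (conv_power b q) j - conv a (conv_power a q) j"
    by (rule conv_diff[OF ba s[OF ba] aa s[OF aa], symmetric])
  finally show ?case by simp
qed (use le in simp)

text \<open>The constant is the derivative of \<open>x ^ Suc q\<close> at \<open>R\<close>: the
  \<open>Suc q\<close> factors are exchanged one after the other. This Lipschitz bound serves
  solutions that are not built by the iteration, for their continuity in time and for
  uniqueness.\<close>

lemma wiener_norm_conv_power_diff:
  assumes u: "abs_summable u" and v: "abs_summable v"
    and R: "wiener_norm u \<le> R" "wiener_norm v \<le> R"
  shows "wiener_norm (\<lambda>j. conv_power v q j - conv_power u q j)
    \<le> real (Suc q) * R ^ q * wiener_norm (\<lambda>j. v j - u j)"
proof (induction q)
  case (Suc q)
  have R0: "0 \<le> R" using R wiener_norm_nonneg order_trans by blast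
  let ?d = "\<lambda>q j. conv_power v q j - conv_power u q j"
  note s = u v abs_summable_conv_power abs_summable_diff abs_summable_conv
  have "wiener_norm (?d (Suc q)) \<le> (\<Sum>\<^sub>\<infinity>j. norm (conv v (?d q) j) + norm (conv (\<lambda>j. v j - u j) (conv_power u q) j))"
  proof (rule wiener_norm_mono[OF summable_on_add])
    show "norm (?d (Suc q) j) \<le> norm (conv v (?d q) j) + norm (conv (\<lambda>j. v j - u j) (conv_power u q) j)" for j
      using conv_diff[OF v s(3)[OF v] u s(3)[OF u], where j = j] norm_triangle_ineq by simp
  qed (intro s)+
  also have "\<dots> = wiener_norm (conv v (?d q)) + wiener_norm (conv (\<lambda>j. v j - u j) (conv_power u q))"
    unfolding wiener_norm_def by (rule infsum_add) (auto intro!: s)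
  also have "\<dots> \<le> wiener_norm v * wiener_norm (?d q) + wiener_norm (\<lambda>j. v j - u j) * wiener_norm (conv_power u q)"
    by (intro add_mono wiener_norm_conv s)
  also have "\<dots> \<le> R * (real (Suc q) * R ^ q * wiener_norm (\<lambda>j. v j - u j)) + wiener_norm (\<lambda>j. v j - u j) * R ^ Suc q"
    by (intro add_mono mult_mono Suc R R0 wiener_norm_nonneg order_refl
        order_trans[OF wiener_norm_conv_power[OF u] power_mono])
  also have "\<dots> = real (Suc (Suc q)) * R ^ Suc q * wiener_norm (\<lambda>j. v j - u j)"
    by (simp add: algebra_simps)
  finally show ?case by simp
qed simp

section \<open>Dominated convergence for infinite sums\<close>

text \<open>A finite set \<open>J\<close> carries all but \<open>e / 4\<close> of the mass of
  \<open>b\<close>; off \<open>J\<close> both sums stay below that, and on \<open>J\<close>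
  convergence is termwise. The general filter covers limits in time as well as limits along the
  iteration.\<close>

lemma tannery:
  fixes f :: "'t \<Rightarrow> 'g \<Rightarrow> 'a::banach"
  assumes b: "b summable_on UNIV" and bound: "eventually (\<lambda>t. \<forall>j. norm (f t j) \<le> (b j :: real)) F"
    and lim: "\<And>j. ((\<lambda>t. f t j) \<longlongrightarrow> g j) F" and F: "F \<noteq> bot"
  shows "((\<lambda>t. infsum (f t) UNIV) \<longlongrightarrow> infsum g UNIV) F"
proof (rule tendstoI)
  fix e :: real assume e: "e > 0"
  have gb: "norm (g j) \<le> b j" for j
    by (rule tendsto_upperbound[OF tendsto_norm[OF lim]])
      (use bound F in \<open>auto elim: eventually_mono\<close>)
  have b0: "0 \<le> b j" for j using gb[of j] norm_ge_zero order_trans by blast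
  \<comment> \<open>\<open>e / 8\<close> turns the non-strict approximation into a strict bound by
    \<open>e / 4\<close>.\<close>
  obtain J where J: "finite J" "dist (sum b J) (infsum b UNIV) < e / 4"
    using infsum_finite_approximation[OF b, of "e / 8"] e by (force)
  have tail: "(\<lambda>j. b j) summable_on - J" using b summable_on_subset_banach by blast
  have tail_le: "infsum b (- J) < e / 4"
  proof -
    have "infsum b UNIV = infsum b (J \<union> - J)" by simp
    also have "\<dots> = sum b J + infsum b (- J)"
      by (subst infsum_Un_disjoint) (use J tail in auto)
    finally show ?thesis using J by (simp add: dist_real_def)
  qed
  have split: "norm (infsum h UNIV - sum h J) \<le> infsum b (- J)" if "\<And>j. norm (h j) \<le> b j" for h :: "'g \<Rightarrow> 'a"
  proof -
    have h: "abs_summable h" using abs_summable_dominated b that by blast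
    then have h': "(\<lambda>j. norm (h j)) summable_on - J" using summable_on_subset_banach by blast
    have "infsum h UNIV = infsum h (J \<union> - J)" by simp
    also have "\<dots> = sum h J + infsum h (- J)"
      by (subst infsum_Un_disjoint) (use J abs_summable_summable[OF h'] in auto)
    finally have "norm (infsum h UNIV - sum h J) = norm (infsum h (- J))" by simp
    also have "\<dots> \<le> infsum (\<lambda>j. norm (h j)) (- J)" by (rule norm_infsum_bound[OF h'])
    also have "\<dots> \<le> infsum b (- J)" by (rule infsum_mono[OF h' tail that])
    finally show ?thesis .
  qed
  have "((\<lambda>t. sum (f t) J) \<longlongrightarrow> sum g J) F" by (intro tendsto_sum lim)
  then have "eventually (\<lambda>t. dist (sum (f t) J) (sum g J) < e / 4) F"
    using e by (intro tendstoD) auto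
  with bound show "eventually (\<lambda>t. dist (infsum (f t) UNIV) (infsum g UNIV) < e) F"
  proof eventually_elim
    case (elim t)
    have 1: "dist (infsum (f t) UNIV) (sum (f t) J) < e / 4"
      using split[of "f t"] elim tail_le by (simp add: dist_norm)
    have 2: "dist (infsum g UNIV) (sum g J) < e / 4"
      using split[of g] gb tail_le by (simp add: dist_norm)
    have "dist (infsum (f t) UNIV) (infsum g UNIV) \<le> dist (infsum (f t) UNIV) (sum (f t) J)
        + dist (sum (f t) J) (sum g J) + dist (infsum g UNIV) (sum g J)"
      using dist_triangle[of "infsum (f t) UNIV" "infsum g UNIV" "sum (f t) J"]
        dist_triangle2[of "sum (f t) J" "infsum g UNIV" "sum g J"] by linarith
    with 1 2 elim(2) e show ?case by linarith
  qed
qed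

lemma tendsto_conv:
  assumes a: "a summable_on UNIV" and b: "b summable_on UNIV" and F: "F \<noteq> bot"
    and "eventually (\<lambda>t. \<forall>j. norm (f t j) \<le> (a j :: real)) F" "eventually (\<lambda>t. \<forall>j. norm (g t j) \<le> (b j :: real)) F"
    and lim: "\<And>j. ((\<lambda>t. f t j) \<longlongrightarrow> f' j) F" "\<And>j. ((\<lambda>t. g t j) \<longlongrightarrow> g' j) F"
  shows "((\<lambda>t. conv (f t) (g t) j) \<longlongrightarrow> conv f' g' j) F"
  unfolding conv_def
proof (rule tannery[OF _ _ _ F])
  have "abs_summable a" "abs_summable b"
    using a b abs_summable_realI by auto
  from abs_summable_realD[OF abs_summable_conv_terms[OF this]] show "(\<lambda>k. a k * b (j - k)) summable_on UNIV" .
  show "\<forall>\<^sub>F t in F. \<forall>k. norm (f t k * g t (j - k)) \<le> a k * b (j - k)"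
    using assms(4,5)
  proof eventually_elim
    case (elim t)
    then show ?case unfolding norm_mult by (meson mult_mono norm_ge_zero order_trans)
  qed
qed (intro tendsto_mult lim)

lemma tendsto_conv_power:
  assumes a: "a summable_on UNIV" and F: "F \<noteq> bot"
    and bound: "eventually (\<lambda>t. \<forall>j. norm (f t j) \<le> (a j :: real)) F"
    and lim: "\<And>j. ((\<lambda>t. f t j) \<longlongrightarrow> f' j) F"
  shows "((\<lambda>t. conv_power (f t) q j) \<longlongrightarrow> conv_power f' q j) F"
proof (induction q arbitrary: j)
  case (Suc q)
  have "conv_power a q summable_on UNIV"
    by (rule abs_summable_realD[OF abs_summable_conv_power[OF abs_summable_realI[OF a]]])
  moreover have "\<forall>\<^sub>F t in F. \<forall>j. norm (conv_power (f t) q j) \<le> conv_power a q j"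
    using bound by eventually_elim (auto intro: norm_conv_power_le[OF a])
  ultimately show ?case using tendsto_conv[OF a _ F bound _ lim Suc] by simp
qed (simp add: lim)

section \<open>Fourier series on the torus\<close>

lemma lattice_exp_integral_1d:
  "(\<integral>x. indicator {0..2 * pi} x *\<^sub>R cis (real_of_int n * x) \<partial>lborel) = (if n = 0 then complex_of_real (2 * pi) else 0)"
proof (cases "n = 0")
  case True
  then show ?thesis
    using integral_FTC_Icc[of 0 "2 * pi" "\<lambda>x. complex_of_real x" "\<lambda>x. 1"]
    by (simp add: has_vector_derivative_of_real scaleR_conv_of_real)
next
  case False
  have "(\<integral>x. indicator {0..2 * pi} x *\<^sub>R cis (real_of_int n * x) \<partial>lborel)
      = cis (real_of_int n * (2 * pi)) / (\<i> * of_int n) - cis (real_of_int n * 0) / (\<i> * of_int n)"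
  proof (rule integral_FTC_Icc)
    fix x :: real
    show "((\<lambda>x. cis (real_of_int n * x) / (\<i> * of_int n)) has_vector_derivative cis (real_of_int n * x)) (at x within {0..2 * pi})"
      unfolding has_vector_derivative_def using False
      by (auto intro!: derivative_eq_intros simp: scaleR_conv_of_real mult.left_commute[of \<i> "of_real _"])
  qed (auto intro!: continuous_intros)
  moreover have "cis (real_of_int n * (2 * pi)) = 1"
    using cis_multiple_2pi[of "real_of_int n"] by (simp add: mult.commute mult.assoc)
  ultimately show ?thesis using False by simp
qed

lemma cis_sum: "finite A \<Longrightarrow> cis (sum f A) = (\<Prod>x\<in>A. cis (f x))"
  by (induction A rule: finite_induct) (simp_all flip: cis_mult)

lemma freq_inner_axis: "freq j \<bullet> axis i 1 = real_of_int (j $ i)"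
  by (simp add: freq_def inner_axis)

lemma freq_diff: "freq (j - k) = freq j - freq k"
  and freq_eq_0_iff: "freq j = 0 \<longleftrightarrow> j = 0"
  by (simp_all add: freq_def vec_eq_iff)

text \<open>The indicator of the cube and the character both factor over the coordinates, so the
  integral is a product of one-dimensional ones, at least one of which vanishes unless
  \<open>k = 0\<close>.\<close>

lemma lattice_exp_integral:
  fixes k :: "int ^ 'n::finite"
  shows "(LINT x:cbox 0 (\<chi> i. 2 * pi)|lborel. cis (freq k \<bullet> x)) = (if k = 0 then (2 * pi) ^ CARD('n) else 0)"
proof -
  interpret product_sigma_finite "\<lambda>_. lborel :: real measure" ..
  let ?g = "\<lambda>(b :: real ^ 'n) t. indicator {0..2 * pi} t *\<^sub>R cis (freq k \<bullet> b * t)"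
  have g: "integrable lborel (?g b)" for b
    by (rule borel_integrable_compact) (auto intro!: continuous_intros)
  have box: "indicator (cbox 0 (\<chi> i. 2 * pi)) x *\<^sub>R cis (freq k \<bullet> x) = (\<Prod>b\<in>Basis. ?g b (x \<bullet> b))" for x :: "real ^ 'n"
  proof -
    have mem: "x \<in> cbox 0 (\<chi> i. 2 * pi) \<longleftrightarrow> (\<forall>b\<in>Basis. x \<bullet> b \<in> {0..2 * pi})"
      by (auto simp: mem_box Basis_vec_def inner_axis)
    have "(\<Prod>b\<in>Basis. ?g b (x \<bullet> b)) = (\<Prod>b\<in>Basis. indicator {0..2 * pi} (x \<bullet> b)) *\<^sub>R (\<Prod>b\<in>Basis. cis (freq k \<bullet> b * (x \<bullet> b)))"
      by (simp add: scaleR_conv_of_real prod.distrib)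
    also have "(\<Prod>b\<in>Basis. cis (freq k \<bullet> b * (x \<bullet> b))) = cis (freq k \<bullet> x)"
      unfolding euclidean_inner[of "freq k" x] by (simp add: cis_sum)
    also have "(\<Prod>b\<in>Basis. indicator {0..2 * pi} (x \<bullet> b)) = (indicator (cbox 0 (\<chi> i. 2 * pi)) x :: real)"
    proof (cases "x \<in> cbox 0 (\<chi> i. 2 * pi)")
      case False
      then obtain b where "b \<in> Basis" "x \<bullet> b \<notin> {0..2 * pi}" using mem by blast
      with False show ?thesis by (simp add: indicator_def prod_zero_iff) fastforce
    qed (use mem in simp)
    finally show ?thesis by simp
  qed
  have "(LINT x:cbox 0 (\<chi> i. 2 * pi)|lborel. cis (freq k \<bullet> x))
      = (\<integral>x. (\<Prod>b\<in>Basis. ?g b (x \<bullet> b)) \<partial>lborel)"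
    unfolding set_lebesgue_integral_def box ..
  \<comment> \<open>By \<open>lborel_eq\<close> Lebesgue measure is the image of the product measure
    under the map from coordinates to vectors; transporting the integral needs measurability of the
    integrand.\<close>
  also have "\<dots> = (\<integral>f. (\<Prod>b\<in>Basis. ?g b ((\<Sum>c\<in>Basis. f c *\<^sub>R c) \<bullet> b)) \<partial>(\<Pi>\<^sub>M b\<in>Basis. lborel))"
  proof -
    have "(\<lambda>x. ?g b (x \<bullet> b)) \<in> borel_measurable borel" for b
    proof (rule borel_measurable_scaleR)
      show "(\<lambda>x. indicator {0..2 * pi} (x \<bullet> b) :: real) \<in> borel_measurable borel" by measurable
      show "(\<lambda>x. cis (freq k \<bullet> b * (x \<bullet> b))) \<in> borel_measurable borel"
        by (intro borel_measurable_continuous_onI continuous_intros)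
    qed
    then show ?thesis
      unfolding lborel_eq[where 'a = "real ^ 'n"] by (subst integral_distr) (auto intro!: borel_measurable_prod)
  qed
  also have "\<dots> = (\<integral>f. (\<Prod>b\<in>Basis. ?g b (f b)) \<partial>(\<Pi>\<^sub>M b\<in>Basis. lborel))"
    by (intro Bochner_Integration.integral_cong prod.cong) (simp_all add: inner_sum_left inner_Basis if_distrib cong: if_cong)
  also have "\<dots> = (\<Prod>b\<in>Basis. \<integral>t. ?g b t \<partial>lborel)"
    by (rule product_integral_prod) (use g in auto)
  also have "\<dots> = (\<Prod>b\<in>(Basis :: (real ^ 'n) set). if freq k \<bullet> b = 0 then complex_of_real (2 * pi) else 0)"
  proof (rule prod.cong)
    fix b :: "real ^ 'n" assume "b \<in> Basis"
    then obtain i where b: "b = axis i 1" by (auto simp: Basis_vec_def)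
    show "(\<integral>t. ?g b t \<partial>lborel) = (if freq k \<bullet> b = 0 then complex_of_real (2 * pi) else 0)"
      using lattice_exp_integral_1d[of "k $ i"] by (simp add: b freq_inner_axis)
  qed simp
  also have "\<dots> = (if k = 0 then (2 * pi) ^ CARD('n) else 0)"
  proof (cases "k = 0")
    case False
    then obtain b where "b \<in> Basis" "freq k \<bullet> b \<noteq> 0"
      using freq_eq_0_iff euclidean_all_zero_iff by blast
    with False show ?thesis by auto
  qed (simp add: freq_def zero_vec_def[symmetric] inner_vec_def prod_constant)
  finally show ?thesis .
qed

text \<open>Needed to read \<open>torus_power\<close>, defined through an integral of a pointwise
  power, as an operation on coefficients. Absolute summability permits termwise integration, and
  orthogonality keeps one term.\<close>

lemma fourier_coeff_torus_fun:
  fixes u :: "'n::finite fourier"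
  assumes u: "abs_summable u"
  shows "fourier_coeff (torus_fun u) = u"
proof
  fix j :: "int ^ 'n"
  let ?Q = "cbox 0 (\<chi> i. 2 * pi) :: (real ^ 'n) set"
  \<comment> \<open>Termwise integration is carried out for an ordinary series, so the countably
    infinite lattice is enumerated.\<close>
  define e :: "nat \<Rightarrow> int ^ 'n" where "e = from_nat_into UNIV"
  have e: "bij e"
    unfolding e_def by (rule bij_betw_from_nat_into) (auto simp: infinite_UNIV_vec infinite_UNIV_int)
  define f where "f n x = indicator ?Q x *\<^sub>R (u (e n) * cis (freq (e n - j) \<bullet> x))" for n x
  have infsum_e: "(\<Sum>n. h (e n)) = infsum h UNIV" if "abs_summable h" for h :: "int ^ 'n \<Rightarrow> complex"
  proof -
    have "(h \<circ> e) summable_on UNIV"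
      using summable_on_reindex_bij_betw[OF e, of h] abs_summable_summable[OF that] by (simp add: o_def)
    from has_sum_imp_sums[OF has_sum_infsum[OF this]] show ?thesis
      using infsum_reindex_bij_betw[OF e, of h] by (simp add: o_def sums_iff)
  qed
  have sum_e: "summable (\<lambda>n. norm (h (e n)))" if "abs_summable h" for h :: "int ^ 'n \<Rightarrow> complex"
    using summable_on_reindex_bij_betw[OF e, of "\<lambda>j. norm (h j)"] that
    by (auto intro: summable_on_imp_summable)
  have int: "integrable lborel (f n)" for n
    unfolding f_def by (rule borel_integrable_compact) (auto intro!: continuous_intros)
  have int_f: "integral\<^sup>L lborel (f n) = (if e n = j then u (e n) * (2 * pi) ^ CARD('n) else 0)" for n
    using lattice_exp_integral[of "e n - j"] unfolding f_def set_lebesgue_integral_def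
    by (simp flip: mult_scaleR_right)
  have "(LINT x:?Q|lborel. torus_fun u x * cis (- (freq j \<bullet> x))) = (\<integral>x. (\<Sum>n. f n x) \<partial>lborel)"
    unfolding set_lebesgue_integral_def
  proof (rule Bochner_Integration.integral_cong[OF refl])
    fix x :: "real ^ 'n"
    have s: "abs_summable (\<lambda>k. indicator ?Q x *\<^sub>R (u k * cis (freq (k - j) \<bullet> x)))"
      by (rule abs_summable_dominated[OF u]) (simp add: norm_mult indicator_def)
    have "(\<Sum>n. f n x) = (\<Sum>\<^sub>\<infinity>k. indicator ?Q x *\<^sub>R (u k * cis (freq (k - j) \<bullet> x)))"
      unfolding f_def using infsum_e[OF s] .
    also have "\<dots> = indicator ?Q x *\<^sub>R (\<Sum>\<^sub>\<infinity>k. u k * cis (freq k \<bullet> x) * cis (- (freq j \<bullet> x)))"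
      by (simp add: infsum_scaleR_right freq_diff inner_diff_left mult.assoc cis_mult)
    finally show "indicator ?Q x *\<^sub>R (torus_fun u x * cis (- (freq j \<bullet> x))) = (\<Sum>n. f n x)"
      unfolding torus_fun_def by (simp add: infsum_cmult_left')
  qed
  also have "\<dots> = (\<Sum>n. integral\<^sup>L lborel (f n))"
  proof (rule integral_suminf[OF int])
    show "AE x in lborel. summable (\<lambda>n. norm (f n x))"
      using sum_e[OF u] by (auto intro!: AE_I2 summable_comparison_test'[of "\<lambda>n. norm (u (e n))"] simp: f_def norm_mult indicator_def)
    have "(\<integral>x. norm (f n x) \<partial>lborel) = norm (u (e n)) * measure lborel ?Q" for n
      by (simp add: f_def norm_mult)
    then show "summable (\<lambda>n. \<integral>x. norm (f n x) \<partial>lborel)"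
      using sum_e[OF u] by (simp add: summable_mult2)
  qed
  also have "\<dots> = (\<Sum>\<^sub>\<infinity>k. if k = j then u k * (2 * pi) ^ CARD('n) else 0)"
  proof -
    have "abs_summable (\<lambda>k. if k = j then u k * (2 * pi) ^ CARD('n) else 0)"
      by (rule finite_nonzero_values_imp_summable_on) (auto intro: finite_subset[of _ "{j}"])
    from infsum_e[OF this] show ?thesis unfolding int_f by simp
  qed
  also have "\<dots> = u j * (2 * pi) ^ CARD('n)"
    by (subst infsum_cong_neutral[where T = "{j}" and g = "\<lambda>k. u k * (2 * pi) ^ CARD('n)"]) auto
  finally show "fourier_coeff (torus_fun u) j = u j"
    unfolding fourier_coeff_def by simp
qed

text \<open>The weight \<open>cis (freq j \<bullet> x)\<close> is a character in \<open>j\<close>,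
  so multiplying coefficients by it commutes with convolution; the total sum of a convolution is
  then the product of the two values.\<close>

lemma torus_fun_conv:
  fixes u v :: "'n::finite fourier"
  assumes "abs_summable u" "abs_summable v"
  shows "torus_fun (conv u v) x = torus_fun u x * torus_fun v x"
proof -
  let ?e = "\<lambda>w j. w j * cis (freq j \<bullet> x)"
  have "abs_summable (?e u)" "abs_summable (?e v)"
    using assms by (simp_all add: norm_mult)
  from infsum_conv[OF this] have "infsum (conv (?e u) (?e v)) UNIV = torus_fun u x * torus_fun v x"
    by (simp add: torus_fun_def)
  moreover have "conv (?e u) (?e v) j = ?e (conv u v) j" for j
  proof -
    have "conv (?e u) (?e v) j = (\<Sum>\<^sub>\<infinity>k. u k * v (j - k) * cis (freq j \<bullet> x))"
      unfolding conv_def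
      by (rule infsum_cong) (simp add: freq_diff inner_diff_left cis_mult mult.assoc mult.left_commute[of "cis _" "v _"])
    then show ?thesis by (simp add: conv_def infsum_cmult_left')
  qed
  then have "conv (?e u) (?e v) = ?e (conv u v)" by blast
  ultimately show ?thesis by (simp add: torus_fun_def)
qed

text \<open>From here on the nonlinearity can be treated as a convolution power; the shifted
  exponent of \<open>conv_power\<close> matches the \<open>q + 1\<close> of the equation.\<close>

lemma torus_power_eq_conv_power:
  fixes u :: "'n::finite fourier"
  assumes "abs_summable u"
  shows "torus_power u (q + 1) = conv_power u q"
proof -
  have "torus_fun (conv_power u q) x = torus_fun u x ^ (q + 1)" for x
    by (induction q) (simp_all add: torus_fun_conv assms abs_summable_conv_power)
  then have "torus_power u (q + 1) = fourier_coeff (torus_fun (conv_power u q))"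
    unfolding torus_power_def by presburger
  then show ?thesis
    by (simp add: fourier_coeff_torus_fun abs_summable_conv_power assms)
qed

section \<open>Summability of weights on the lattice\<close>

lemma japanese_ge_1: "1 \<le> japanese j" and japanese_pos: "0 < japanese j"
  and japanese_nonneg: "0 \<le> japanese j"
  by (simp_all add: japanese_def)

lemma summable_on_int_powr:
  assumes "a > 1"
  shows "(\<lambda>n::int. max 1 \<bar>real_of_int n\<bar> powr (- a)) summable_on UNIV"
proof -
  have nat: "(\<lambda>n. max 1 (real n) powr (- a)) summable_on UNIV"
  proof -
    have "summable (\<lambda>n. real n powr (- a))"
      using assms by (simp add: summable_real_powr_iff)
    then have "summable (\<lambda>n. max 1 (real n) powr (- a))"
      by (subst summable_cong[where g = "\<lambda>n. real n powr (- a)"])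
        (auto intro!: eventually_at_top_linorderI[of 1] simp: max_def)
    then show ?thesis by (intro summable_nonneg_imp_summable_on) auto
  qed
  have "(\<lambda>n::int. max 1 \<bar>real_of_int n\<bar> powr (- a)) summable_on range int"
    using nat by (subst summable_on_reindex) (auto simp: o_def)
  moreover have "(\<lambda>n::int. max 1 \<bar>real_of_int n\<bar> powr (- a)) summable_on range (\<lambda>n. - int n)"
    using nat by (subst summable_on_reindex) (auto simp: o_def inj_def)
  moreover have "UNIV = range int \<union> range (\<lambda>n. - int n)"
  proof -
    have "n \<in> range int \<union> range (\<lambda>n. - int n)" for n
      by (cases n rule: int_cases2) auto
    then show ?thesis by blast
  qed
  ultimately show ?thesis using summable_on_union by fastforce
qed

text \<open>Since \<open>japanese j\<close> is at least \<open>1\<close> and at least the modulus of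
  each coordinate, the weight is at most a product of one-dimensional weights, whose exponent,
  \<open>a\<close> divided by the dimension, exceeds \<open>1\<close>.\<close>

lemma summable_on_japanese:
  assumes "a > real CARD('n::finite)"
  shows "(\<lambda>j :: int ^ 'n. japanese j powr (- a)) summable_on UNIV"
proof (rule nonneg_summable_onI)
  define g where "g n = max 1 \<bar>real_of_int n\<bar> powr (- (a / CARD('n)))" for n
  have g: "g summable_on UNIV"
    unfolding g_def by (rule summable_on_int_powr) (use assms in \<open>simp add: field_simps\<close>)
  have g0: "0 \<le> g n" for n by (simp add: g_def)
  have le: "japanese j powr (- a) \<le> (\<Prod>i\<in>UNIV. g (j $ i))" for j :: "int ^ 'n"
  proof -
    have "(\<Prod>i\<in>(UNIV :: 'n set). japanese j powr (- (a / CARD('n)))) \<le> (\<Prod>i\<in>UNIV. g (j $ i))"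
    proof (rule prod_mono, safe)
      fix i
      have "\<bar>real_of_int (j $ i)\<bar> \<le> norm (freq j)"
        using component_le_norm_cart[of "freq j" i] by (simp add: freq_def)
      then show "japanese j powr (- (a / CARD('n))) \<le> g (j $ i)"
        unfolding g_def japanese_def using assms by (intro powr_mono2') auto
    qed simp
    also have "(\<Prod>i\<in>(UNIV :: 'n set). japanese j powr (- (a / CARD('n)))) = japanese j powr (- a)"
      using japanese_pos[of j] by (simp flip: powr_realpow add: powr_powr)
    finally show ?thesis .
  qed
  fix F :: "(int ^ 'n) set" assume F: "finite F"
  have "(\<Sum>j\<in>F. japanese j powr (- a)) \<le> (\<Sum>j\<in>F. \<Prod>i\<in>UNIV. g (j $ i))"
    by (intro sum_mono le)
  also have "\<dots> = (\<Sum>h\<in>vec_nth ` F. \<Prod>i\<in>UNIV. g (h i))"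
    by (subst sum.reindex) (simp_all add: inj_on_def vec_nth_inject)
  \<comment> \<open>A finite set of frequencies lies in the product of its coordinate projections,
    and over that product the sum of products is a product of sums.\<close>
  also have "\<dots> \<le> (\<Sum>h\<in>(PiE UNIV (\<lambda>i. (\<lambda>j. j $ i) ` F)). \<Prod>i\<in>UNIV. g (h i))"
    using F by (intro sum_mono2 finite_PiE prod_nonneg) (auto simp: g0)
  also have "\<dots> = (\<Prod>i\<in>UNIV. \<Sum>n\<in>(\<lambda>j. j $ i) ` F. g n)"
    using F by (subst prod_sum_PiE) auto
  also have "\<dots> \<le> (\<Prod>i\<in>(UNIV :: 'n set). infsum g UNIV)"
    using F g g0 by (intro prod_mono conjI sum_nonneg finite_sum_le_infsum) auto
  finally show "(\<Sum>j\<in>F. japanese j powr (- a)) \<le> (\<Prod>i\<in>(UNIV :: 'n set). infsum g UNIV)" .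
qed simp

section \<open>Weighted square-summable families and the tame estimate\<close>

text \<open>For complex coefficients this is \<open>sobolev\<close>; real coefficients serve as majorants.\<close>

definition weighted_l2 :: "real \<Rightarrow> (int ^ 'n::finite \<Rightarrow> 'a::real_normed_vector) \<Rightarrow> bool" where
  "weighted_l2 \<sigma> u \<longleftrightarrow> (\<lambda>j. japanese j powr (2 * \<sigma>) * (norm (u j))\<^sup>2) summable_on UNIV"

text \<open>The norm is kept squared so that finite partial sums, time integrals and the Gronwall
  step act on it without square roots.\<close>

definition energy :: "real \<Rightarrow> (int ^ 'n::finite \<Rightarrow> 'a::real_normed_vector) \<Rightarrow> real" where
  "energy \<sigma> u = (\<Sum>\<^sub>\<infinity>j. japanese j powr (2 * \<sigma>) * (norm (u j))\<^sup>2)"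

lemma sobolev_iff: "u \<in> sobolev \<sigma> \<longleftrightarrow> weighted_l2 \<sigma> u"
  by (simp add: sobolev_def weighted_l2_def)

lemma japanese_powr_squared: "(japanese j powr \<sigma>)\<^sup>2 = japanese j powr (2 * \<sigma>)"
  using powr_add[of "japanese j" \<sigma> \<sigma>] by (simp add: power2_eq_square)

lemma energy_nonneg: "0 \<le> energy \<sigma> u"
  unfolding energy_def by (intro infsum_nonneg) simp

lemma sobolev_norm_eq: "sobolev_norm \<sigma> u = sqrt (energy \<sigma> u)"
  by (simp add: sobolev_norm_def energy_def)

lemma sobolev_norm_nonneg: "0 \<le> sobolev_norm \<sigma> u"
  by (simp add: sobolev_norm_eq energy_nonneg)

lemma sobolev_norm_squared: "(sobolev_norm \<sigma> u)\<^sup>2 = energy \<sigma> u"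
  by (simp add: sobolev_norm_eq energy_nonneg)

lemma weighted_l2I:
  assumes "\<And>F. finite F \<Longrightarrow> (\<Sum>j\<in>F. japanese j powr (2 * \<sigma>) * (norm (u j))\<^sup>2) \<le> B"
  shows "weighted_l2 \<sigma> u" "energy \<sigma> u \<le> B"
  unfolding weighted_l2_def energy_def
  by (rule nonneg_summable_onI, use assms in auto)+

lemma sum_le_energy:
  assumes "weighted_l2 \<sigma> u" "finite F"
  shows "(\<Sum>j\<in>F. japanese j powr (2 * \<sigma>) * (norm (u j))\<^sup>2) \<le> energy \<sigma> u"
  using assms unfolding weighted_l2_def energy_def by (intro finite_sum_le_infsum) auto

lemma
  assumes v: "weighted_l2 \<sigma>' v"
    and le: "\<And>j. japanese j powr (2 * \<sigma>) * (norm (u j))\<^sup>2 \<le> japanese j powr (2 * \<sigma>') * (norm (v j))\<^sup>2"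
  shows weighted_l2_comparison: "weighted_l2 \<sigma> u" and energy_comparison: "energy \<sigma> u \<le> energy \<sigma>' v"
proof -
  have "(\<Sum>j\<in>F. japanese j powr (2 * \<sigma>) * (norm (u j))\<^sup>2) \<le> energy \<sigma>' v" if "finite F" for F
    by (rule order_trans[OF sum_mono[OF le] sum_le_energy[OF v that]])
  from weighted_l2I[OF this] show "weighted_l2 \<sigma> u" "energy \<sigma> u \<le> energy \<sigma>' v" by blast+
qed

lemma
  assumes "weighted_l2 \<sigma> v" "\<And>j. norm (u j) \<le> norm (v j)"
  shows weighted_l2_mono: "weighted_l2 \<sigma> u" and energy_mono: "energy \<sigma> u \<le> energy \<sigma> v"
  using weighted_l2_comparison[OF assms(1), of \<sigma> u] energy_comparison[OF assms(1), of \<sigma> u] assms(2)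
  by (simp_all add: mult_left_mono power_mono)

lemma
  assumes "weighted_l2 \<sigma>' u" "\<sigma> \<le> \<sigma>'"
  shows weighted_l2_antimono: "weighted_l2 \<sigma> u" and energy_antimono: "energy \<sigma> u \<le> energy \<sigma>' u"
  using weighted_l2_comparison[OF assms(1), of \<sigma> u] energy_comparison[OF assms(1), of \<sigma> u] assms(2)
  by (simp_all add: mult_right_mono powr_mono japanese_ge_1)

lemma norm_add_squared_le: "(norm (x + y))\<^sup>2 \<le> 2 * (norm x)\<^sup>2 + 2 * (norm y)\<^sup>2"
proof -
  have "(norm (x + y))\<^sup>2 \<le> (norm x + norm y)\<^sup>2" by (intro power_mono norm_triangle_ineq norm_ge_zero)
  also have "\<dots> \<le> 2 * (norm x)\<^sup>2 + 2 * (norm y)\<^sup>2"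
    using sum_squares_bound[of "norm x" "norm y"] by (simp add: power2_sum)
  finally show ?thesis .
qed

lemma
  assumes u: "weighted_l2 \<sigma> u" and v: "weighted_l2 \<sigma> v"
  shows weighted_l2_add: "weighted_l2 \<sigma> (\<lambda>j. u j + v j)"
    and energy_add: "energy \<sigma> (\<lambda>j. u j + v j) \<le> 2 * energy \<sigma> u + 2 * energy \<sigma> v"
proof -
  have "(\<Sum>j\<in>F. japanese j powr (2 * \<sigma>) * (norm (u j + v j))\<^sup>2) \<le> 2 * energy \<sigma> u + 2 * energy \<sigma> v" if "finite F" for F
  proof -
    have "(\<Sum>j\<in>F. japanese j powr (2 * \<sigma>) * (norm (u j + v j))\<^sup>2)
      \<le> (\<Sum>j\<in>F. japanese j powr (2 * \<sigma>) * (2 * (norm (u j))\<^sup>2 + 2 * (norm (v j))\<^sup>2))"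
      by (intro sum_mono mult_left_mono norm_add_squared_le) auto
    also have "\<dots> = 2 * (\<Sum>j\<in>F. japanese j powr (2 * \<sigma>) * (norm (u j))\<^sup>2) + 2 * (\<Sum>j\<in>F. japanese j powr (2 * \<sigma>) * (norm (v j))\<^sup>2)"
      by (simp add: algebra_simps sum.distrib sum_distrib_left)
    also have "\<dots> \<le> 2 * energy \<sigma> u + 2 * energy \<sigma> v"
      using sum_le_energy[OF u that] sum_le_energy[OF v that] by simp
    finally show ?thesis .
  qed
  from weighted_l2I[OF this] show "weighted_l2 \<sigma> (\<lambda>j. u j + v j)"
    "energy \<sigma> (\<lambda>j. u j + v j) \<le> 2 * energy \<sigma> u + 2 * energy \<sigma> v" by blast+
qed

lemma weighted_l2_scaleR: "weighted_l2 \<sigma> u \<Longrightarrow> weighted_l2 \<sigma> (\<lambda>j. c *\<^sub>R u j)"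
  unfolding weighted_l2_def
  by (drule summable_on_cmult_right[of _ _ "c\<^sup>2"]) (simp add: power_mult_distrib mult_ac)

lemma weighted_l2_diff:
  assumes "weighted_l2 \<sigma> u" "weighted_l2 \<sigma> v"
  shows "weighted_l2 \<sigma> (\<lambda>j. u j - v j)"
  using weighted_l2_add[OF assms(1) weighted_l2_scaleR[OF assms(2), of "-1"]] by simp

section \<open>Cauchy-Schwarz, Sobolev embedding, Young's inequality and tame products\<close>

lemma
  fixes x y :: "'g \<Rightarrow> real"
  assumes x: "(\<lambda>j. (x j)\<^sup>2) summable_on UNIV" and y: "(\<lambda>j. (y j)\<^sup>2) summable_on UNIV"
  shows abs_summable_mult: "abs_summable (\<lambda>j. x j * y j)"
    and wiener_norm_mult: "(wiener_norm (\<lambda>j. x j * y j))\<^sup>2 \<le> (\<Sum>\<^sub>\<infinity>j. (x j)\<^sup>2) * (\<Sum>\<^sub>\<infinity>j. (y j)\<^sup>2)"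
proof -
  have *: "(\<Sum>j\<in>F. norm (x j * y j)) \<le> sqrt ((\<Sum>\<^sub>\<infinity>j. (x j)\<^sup>2) * (\<Sum>\<^sub>\<infinity>j. (y j)\<^sup>2))" if "finite F" for F
  proof (rule real_le_rsqrt)
    have "(\<Sum>j\<in>F. norm (x j * y j))\<^sup>2 \<le> (\<Sum>j\<in>F. (x j)\<^sup>2) * (\<Sum>j\<in>F. (y j)\<^sup>2)"
      using Cauchy_Schwarz_ineq_sum[of "\<lambda>j. \<bar>x j\<bar>" "\<lambda>j. \<bar>y j\<bar>" F] by (simp add: abs_mult)
    also have "\<dots> \<le> (\<Sum>\<^sub>\<infinity>j. (x j)\<^sup>2) * (\<Sum>\<^sub>\<infinity>j. (y j)\<^sup>2)"
      using that by (intro mult_mono finite_sum_le_infsum x y infsum_nonneg sum_nonneg) auto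
    finally show "(\<Sum>j\<in>F. norm (x j * y j))\<^sup>2 \<le> (\<Sum>\<^sub>\<infinity>j. (x j)\<^sup>2) * (\<Sum>\<^sub>\<infinity>j. (y j)\<^sup>2)" .
  qed
  show "abs_summable (\<lambda>j. x j * y j)"
    by (rule nonneg_summable_onI) (use * in auto)
  have "wiener_norm (\<lambda>j. x j * y j) \<le> sqrt ((\<Sum>\<^sub>\<infinity>j. (x j)\<^sup>2) * (\<Sum>\<^sub>\<infinity>j. (y j)\<^sup>2))"
    unfolding wiener_norm_def by (rule nonneg_summable_onI) (use * in auto)
  then have "(wiener_norm (\<lambda>j. x j * y j))\<^sup>2 \<le> (sqrt ((\<Sum>\<^sub>\<infinity>j. (x j)\<^sup>2) * (\<Sum>\<^sub>\<infinity>j. (y j)\<^sup>2)))\<^sup>2"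
    by (intro power_mono wiener_norm_nonneg)
  then show "(wiener_norm (\<lambda>j. x j * y j))\<^sup>2 \<le> (\<Sum>\<^sub>\<infinity>j. (x j)\<^sup>2) * (\<Sum>\<^sub>\<infinity>j. (y j)\<^sup>2)"
    by (simp add: infsum_nonneg)
qed

text \<open>Cauchy-Schwarz against \<open>japanese j powr (- \<sigma>)\<close>, which is square
  summable because \<open>2 * \<sigma>\<close> exceeds the dimension. At
  \<open>\<sigma> = s0\<close> the constant enters the constant \<open>c\<close> of the
  lifespan.\<close>

lemma
  fixes u :: "int ^ 'n::finite \<Rightarrow> 'a::real_normed_vector"
  assumes u: "weighted_l2 \<sigma> u" and \<sigma>: "\<sigma> > real CARD('n) / 2"
  shows abs_summable_weighted_l2: "abs_summable u"
    and wiener_norm_le_energy: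
      "wiener_norm u \<le> sqrt (\<Sum>\<^sub>\<infinity>j :: int ^ 'n. japanese j powr (- (2 * \<sigma>))) * sqrt (energy \<sigma> u)"
proof -
  have sq: "(japanese j powr (- \<sigma>))\<^sup>2 = japanese j powr (- (2 * \<sigma>))"
    "(japanese j powr \<sigma> * norm (u j))\<^sup>2 = japanese j powr (2 * \<sigma>) * (norm (u j))\<^sup>2" for j :: "int ^ 'n"
    by (simp_all add: power_mult_distrib japanese_powr_squared)
  have eq: "norm (japanese j powr (- \<sigma>) * (japanese j powr \<sigma> * norm (u j))) = norm (u j)" for j
    using japanese_pos[of j] by (simp add: abs_mult powr_minus)
  have "(\<lambda>j :: int ^ 'n. japanese j powr (- (2 * \<sigma>))) summable_on UNIV"
    by (rule summable_on_japanese) (use \<sigma> in simp)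
  then have x: "(\<lambda>j :: int ^ 'n. (japanese j powr (- \<sigma>))\<^sup>2) summable_on UNIV" by (simp add: sq)
  have y: "(\<lambda>j. (japanese j powr \<sigma> * norm (u j))\<^sup>2) summable_on UNIV"
    using u by (simp only: sq weighted_l2_def)
  show "abs_summable u"
    using abs_summable_mult[OF x y] by (simp only: eq)
  have "(wiener_norm u)\<^sup>2 \<le> (\<Sum>\<^sub>\<infinity>j :: int ^ 'n. japanese j powr (- (2 * \<sigma>))) * energy \<sigma> u"
    using wiener_norm_mult[OF x y] by (simp only: sq energy_def wiener_norm_def eq)
  then have "sqrt ((wiener_norm u)\<^sup>2) \<le> sqrt ((\<Sum>\<^sub>\<infinity>j :: int ^ 'n. japanese j powr (- (2 * \<sigma>))) * energy \<sigma> u)"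
    by (rule real_sqrt_le_mono)
  then show "wiener_norm u \<le> sqrt (\<Sum>\<^sub>\<infinity>j :: int ^ 'n. japanese j powr (- (2 * \<sigma>))) * sqrt (energy \<sigma> u)"
    by (simp add: wiener_norm_nonneg real_sqrt_mult)
qed

lemma bij_reflect: "bij (\<lambda>k. j - k :: 'g::ab_group_add)"
  by (rule bij_betw_byWitness[where f' = "\<lambda>k. j - k"]) auto

lemma conv_commute: "conv u v = conv v u"
proof
  fix j
  from infsum_reindex_bij_betw[OF bij_reflect[of j], of "\<lambda>k. u k * v (j - k)"]
  show "conv u v j = conv v u j" by (simp add: conv_def mult.commute)
qed

text \<open>With \<open>f * v\<close> written as \<open>sqrt v * (f * sqrt v)\<close>,
  Cauchy-Schwarz bounds the square of \<open>conv f v\<close> by the mass of \<open>v\<close> times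
  \<open>conv (\<lambda>k. (f k)\<^sup>2) v\<close>, whose total is a product by
  \<open>infsum_conv\<close>. As \<open>f\<close> is only square summable, convergence of the terms
  has to be shown as well.\<close>

lemma
  fixes f v :: "'g::ab_group_add \<Rightarrow> real"
  assumes f: "(\<lambda>k. (f k)\<^sup>2) summable_on UNIV" and v: "v summable_on UNIV" "\<And>k. 0 \<le> v k"
  shows young_terms: "(\<lambda>k. f k * v (j - k)) summable_on UNIV"
    and young_summable: "(\<lambda>j. (conv f v j)\<^sup>2) summable_on UNIV"
    and young_bound: "(\<Sum>\<^sub>\<infinity>j. (conv f v j)\<^sup>2) \<le> (infsum v UNIV)\<^sup>2 * (\<Sum>\<^sub>\<infinity>k. (f k)\<^sup>2)"
proof -
  note f' = abs_summable_realI[OF f] and v' = abs_summable_realI[OF v(1)]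
  have x: "(\<lambda>k. (sqrt (v (j - k)))\<^sup>2) summable_on UNIV" and x': "(\<Sum>\<^sub>\<infinity>k. (sqrt (v (j - k)))\<^sup>2) = infsum v UNIV" for j
    using summable_on_reindex_bij_betw[OF bij_reflect, of v j] infsum_reindex_bij_betw[OF bij_reflect, of v j] v by simp_all
  have y: "(\<lambda>k. (f k * sqrt (v (j - k)))\<^sup>2) summable_on UNIV" for j
    using abs_summable_realD[OF abs_summable_conv_terms[OF f' v'], of j] v by (simp add: power_mult_distrib)
  have eq: "sqrt (v (j - k)) * (f k * sqrt (v (j - k))) = f k * v (j - k)" for j k
    using v by (simp add: mult.left_commute)
  have 1: "abs_summable (\<lambda>k. f k * v (j - k))" for j
    using abs_summable_mult[OF x y, of j j] by (simp only: eq)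
  then show "(\<lambda>k. f k * v (j - k)) summable_on UNIV" for j by (rule abs_summable_realD)
  have le: "(conv f v j)\<^sup>2 \<le> infsum v UNIV * conv (\<lambda>k. (f k)\<^sup>2) v j" for j
  proof -
    have "\<bar>conv f v j\<bar> \<le> wiener_norm (\<lambda>k. f k * v (j - k))"
      unfolding conv_def wiener_norm_def using norm_infsum_bound[OF 1] by simp
    then have "(conv f v j)\<^sup>2 \<le> (wiener_norm (\<lambda>k. f k * v (j - k)))\<^sup>2"
      by (metis abs_le_square_iff abs_of_nonneg wiener_norm_nonneg)
    also have "\<dots> \<le> infsum v UNIV * (\<Sum>\<^sub>\<infinity>k. (f k * sqrt (v (j - k)))\<^sup>2)"
      using wiener_norm_mult[OF x y, of j j] by (simp only: eq x')
    also have "(\<Sum>\<^sub>\<infinity>k. (f k * sqrt (v (j - k)))\<^sup>2) = conv (\<lambda>k. (f k)\<^sup>2) v j"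
      using v by (simp add: conv_def power_mult_distrib)
    finally show ?thesis .
  qed
  have s: "(\<lambda>j. infsum v UNIV * conv (\<lambda>k. (f k)\<^sup>2) v j) summable_on UNIV"
    by (intro summable_on_cmult_right abs_summable_realD[OF abs_summable_conv[OF f' v']])
  show *: "(\<lambda>j. (conv f v j)\<^sup>2) summable_on UNIV"
    by (rule abs_summable_realD[OF abs_summable_dominated[OF s]]) (use le in simp)
  have "(\<Sum>\<^sub>\<infinity>j. (conv f v j)\<^sup>2) \<le> (\<Sum>\<^sub>\<infinity>j. infsum v UNIV * conv (\<lambda>k. (f k)\<^sup>2) v j)"
    by (rule infsum_mono[OF * s le])
  also have "\<dots> = infsum v UNIV * (\<Sum>\<^sub>\<infinity>j. conv (\<lambda>k. (f k)\<^sup>2) v j)" by (rule infsum_cmult_right')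
  also have "\<dots> = (infsum v UNIV)\<^sup>2 * (\<Sum>\<^sub>\<infinity>k. (f k)\<^sup>2)"
    using infsum_conv[OF f' v'] by (simp add: power2_eq_square)
  finally show "(\<Sum>\<^sub>\<infinity>j. (conv f v j)\<^sup>2) \<le> (infsum v UNIV)\<^sup>2 * (\<Sum>\<^sub>\<infinity>k. (f k)\<^sup>2)" .
qed

text \<open>At least one of the weights of \<open>k\<close> and \<open>j - k\<close> is half that of
  \<open>j\<close> or more; the maximum is replaced by a sum to make the bound linear in the two
  weights.\<close>

lemma japanese_powr_add_le:
  assumes "0 \<le> \<sigma>"
  shows "japanese j powr \<sigma> \<le> 2 powr \<sigma> * (japanese k powr \<sigma> + japanese (j - k) powr \<sigma>)"
proof -
  let ?m = "max (japanese k) (japanese (j - k))"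
  have "norm (freq j) \<le> norm (freq k) + norm (freq (j - k))"
    using norm_triangle_ineq[of "freq k" "freq (j - k)"] by (simp add: freq_diff)
  then have "japanese j \<le> 2 * ?m" by (simp add: japanese_def) linarith
  then have "japanese j powr \<sigma> \<le> (2 * ?m) powr \<sigma>"
    using assms japanese_nonneg by (intro powr_mono2) auto
  also have "\<dots> = 2 powr \<sigma> * ?m powr \<sigma>" by (rule powr_mult)
  also have "?m powr \<sigma> \<le> japanese k powr \<sigma> + japanese (j - k) powr \<sigma>" by (simp add: max_def)
  finally show ?thesis by simp
qed

text \<open>The weight \<open>japanese j powr \<sigma>\<close> is handed to one factor at a time
  while the other is measured by its absolute sum, so Young's inequality applies to each half. The
  factor \<open>4 powr \<sigma>\<close> is the square of \<open>2 powr \<sigma>\<close>, and the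
  \<open>2\<close> comes from squaring a sum of two terms.\<close>

lemma
  fixes u v :: "int ^ 'n::finite \<Rightarrow> 'a::{real_normed_field, banach}"
  assumes u: "abs_summable u" "weighted_l2 \<sigma> u" and v: "abs_summable v" "weighted_l2 \<sigma> v" and \<sigma>: "0 \<le> \<sigma>"
  shows weighted_l2_conv: "weighted_l2 \<sigma> (conv u v)"
    and energy_conv: "energy \<sigma> (conv u v)
      \<le> 2 * 4 powr \<sigma> * ((wiener_norm v)\<^sup>2 * energy \<sigma> u + (wiener_norm u)\<^sup>2 * energy \<sigma> v)"
proof -
  define w where "w f j = japanese j powr \<sigma> * norm (f j)" for f :: "int ^ 'n \<Rightarrow> 'a" and j
  have w2: "(w f j)\<^sup>2 = japanese j powr (2 * \<sigma>) * (norm (f j))\<^sup>2" for f j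
    by (simp add: w_def power_mult_distrib japanese_powr_squared)
  have wu: "(\<lambda>j. (w u j)\<^sup>2) summable_on UNIV" and wv: "(\<lambda>j. (w v j)\<^sup>2) summable_on UNIV"
    using u v by (simp_all add: w2 weighted_l2_def)
  let ?A = "conv (w u) (\<lambda>j. norm (v j))" and ?B = "conv (w v) (\<lambda>j. norm (u j))"
  have le: "w (conv u v) j \<le> 2 powr \<sigma> * (?A j + ?B j)" for j
  proof -
    have sA: "(\<lambda>k. w u k * norm (v (j - k))) summable_on UNIV" by (rule young_terms[OF wu v(1)]) simp
    have sB: "(\<lambda>k. w v k * norm (u (j - k))) summable_on UNIV" by (rule young_terms[OF wv u(1)]) simp
    have sB': "(\<lambda>k. w v (j - k) * norm (u k)) summable_on UNIV"
      using summable_on_reindex_bij_betw[OF bij_reflect, of "\<lambda>k. w v k * norm (u (j - k))" j] sB by simp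
    have iB: "?B j = (\<Sum>\<^sub>\<infinity>k. w v (j - k) * norm (u k))"
      by (subst conv_commute) (simp add: conv_def mult.commute)
    have "w (conv u v) j \<le> japanese j powr \<sigma> * (\<Sum>\<^sub>\<infinity>k. norm (u k * v (j - k)))"
      unfolding w_def conv_def by (intro mult_left_mono norm_infsum_bound abs_summable_conv_terms u v) auto
    also have "\<dots> = (\<Sum>\<^sub>\<infinity>k. japanese j powr \<sigma> * (norm (u k) * norm (v (j - k))))"
      by (simp add: norm_mult infsum_cmult_right')
    also have "\<dots> \<le> (\<Sum>\<^sub>\<infinity>k. 2 powr \<sigma> * (w u k * norm (v (j - k)) + w v (j - k) * norm (u k)))"
    proof (rule infsum_mono)
      show "(\<lambda>k. japanese j powr \<sigma> * (norm (u k) * norm (v (j - k)))) summable_on UNIV"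
        using abs_summable_conv_terms[OF u(1) v(1), of j] by (intro summable_on_cmult_right) (simp add: norm_mult)
      show "(\<lambda>k. 2 powr \<sigma> * (w u k * norm (v (j - k)) + w v (j - k) * norm (u k))) summable_on UNIV"
        by (intro summable_on_cmult_right summable_on_add sA sB')
      show "japanese j powr \<sigma> * (norm (u k) * norm (v (j - k)))
          \<le> 2 powr \<sigma> * (w u k * norm (v (j - k)) + w v (j - k) * norm (u k))" for k
        using mult_right_mono[OF japanese_powr_add_le[OF \<sigma>, of j k], of "norm (u k) * norm (v (j - k))"]
        by (simp add: w_def algebra_simps)
    qed
    also have "\<dots> = 2 powr \<sigma> * (?A j + ?B j)"
      unfolding iB by (simp add: infsum_cmult_right' infsum_add[OF sA sB'] conv_def)
    finally show ?thesis .
  qed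
  have sq: "(w (conv u v) j)\<^sup>2 \<le> 2 * 4 powr \<sigma> * ((?A j)\<^sup>2 + (?B j)\<^sup>2)" for j
  proof -
    have "(w (conv u v) j)\<^sup>2 \<le> (2 powr \<sigma> * (?A j + ?B j))\<^sup>2"
      by (intro power_mono le) (simp add: w_def)
    also have "\<dots> = 4 powr \<sigma> * (?A j + ?B j)\<^sup>2"
      using powr_mult[of 2 2 \<sigma>] by (simp add: power2_eq_square)
    also have "(?A j + ?B j)\<^sup>2 \<le> 2 * ((?A j)\<^sup>2 + (?B j)\<^sup>2)"
      using sum_squares_bound[of "?A j" "?B j"] by (simp add: power2_sum)
    finally show ?thesis by (simp add: mult_left_mono algebra_simps)
  qed
  note A = young_summable[OF wu v(1)] young_bound[OF wu v(1)]
  note B = young_summable[OF wv u(1)] young_bound[OF wv u(1)]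
  have s: "(\<lambda>j. 2 * 4 powr \<sigma> * ((?A j)\<^sup>2 + (?B j)\<^sup>2)) summable_on UNIV"
    by (intro summable_on_cmult_right summable_on_add A B) auto
  have *: "(\<lambda>j. (w (conv u v) j)\<^sup>2) summable_on UNIV"
    by (rule abs_summable_realD[OF abs_summable_dominated[OF s]]) (use sq in simp)
  then show "weighted_l2 \<sigma> (conv u v)" by (simp add: w2 weighted_l2_def)
  have "energy \<sigma> (conv u v) = (\<Sum>\<^sub>\<infinity>j. (w (conv u v) j)\<^sup>2)" by (simp add: w2 energy_def)
  also have "\<dots> \<le> (\<Sum>\<^sub>\<infinity>j. 2 * 4 powr \<sigma> * ((?A j)\<^sup>2 + (?B j)\<^sup>2))"
    by (rule infsum_mono[OF * s sq])
  also have "\<dots> = 2 * 4 powr \<sigma> * ((\<Sum>\<^sub>\<infinity>j. (?A j)\<^sup>2) + (\<Sum>\<^sub>\<infinity>j. (?B j)\<^sup>2))"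
    by (subst infsum_cmult_right', subst infsum_add) (use A B in auto)
  also have "\<dots> \<le> 2 * 4 powr \<sigma> * ((wiener_norm v)\<^sup>2 * energy \<sigma> u + (wiener_norm u)\<^sup>2 * energy \<sigma> v)"
    using A B by (intro mult_left_mono add_mono) (auto simp: w2 energy_def wiener_norm_def)
  finally show "energy \<sigma> (conv u v)
      \<le> 2 * 4 powr \<sigma> * ((wiener_norm v)\<^sup>2 * energy \<sigma> u + (wiener_norm u)\<^sup>2 * energy \<sigma> v)" .
qed

text \<open>Solves the recursion that \<open>energy_conv\<close> gives when one factor is split off:
  the \<open>1\<close> stands for the weight on that factor, \<open>tame_const \<sigma> q\<close>
  for the weight on the remaining power.\<close>

primrec tame_const :: "real \<Rightarrow> nat \<Rightarrow> real" where
  "tame_const \<sigma> 0 = 1"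
| "tame_const \<sigma> (Suc q) = 2 * 4 powr \<sigma> * (1 + tame_const \<sigma> q)"

lemma tame_const_pos: "0 < tame_const \<sigma> q"
  by (induction q) (auto intro!: mult_pos_pos add_pos_pos)

text \<open>Only one factor carries the weight and the other \<open>q\<close> are paid for by
  \<open>R\<close>. The bound is therefore linear in the energy, so Gronwall's exponent will not see
  how large that energy is.\<close>

lemma
  fixes u :: "int ^ 'n::finite \<Rightarrow> 'a::{real_normed_field, banach}"
  assumes u: "abs_summable u" "weighted_l2 \<sigma> u" "wiener_norm u \<le> R" and \<sigma>: "0 \<le> \<sigma>"
  shows weighted_l2_conv_power: "weighted_l2 \<sigma> (conv_power u q)"
    and energy_conv_power: "energy \<sigma> (conv_power u q) \<le> tame_const \<sigma> q * R ^ (2 * q) * energy \<sigma> u"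
proof -
  have R: "0 \<le> R" using u(3) wiener_norm_nonneg order_trans by blast
  have "weighted_l2 \<sigma> (conv_power u q) \<and> energy \<sigma> (conv_power u q) \<le> tame_const \<sigma> q * R ^ (2 * q) * energy \<sigma> u"
  proof (induction q)
    case (Suc q)
    let ?p = "conv_power u q"
    have p: "abs_summable ?p" by (rule abs_summable_conv_power[OF u(1)])
    have "wiener_norm ?p \<le> R ^ Suc q"
      by (rule order_trans[OF wiener_norm_conv_power[OF u(1)] power_mono[OF u(3) wiener_norm_nonneg]])
    then have Rp: "(wiener_norm ?p)\<^sup>2 \<le> (R ^ Suc q)\<^sup>2" by (intro power_mono wiener_norm_nonneg)
    have Ru: "(wiener_norm u)\<^sup>2 \<le> R\<^sup>2" by (intro power_mono u wiener_norm_nonneg)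
    have "energy \<sigma> (conv u ?p) \<le> 2 * 4 powr \<sigma> * ((wiener_norm ?p)\<^sup>2 * energy \<sigma> u + (wiener_norm u)\<^sup>2 * energy \<sigma> ?p)"
      by (rule energy_conv) (use u p Suc \<sigma> in auto)
    also have "\<dots> \<le> 2 * 4 powr \<sigma> * ((R ^ Suc q)\<^sup>2 * energy \<sigma> u + R\<^sup>2 * (tame_const \<sigma> q * R ^ (2 * q) * energy \<sigma> u))"
      using Suc by (intro mult_left_mono add_mono mult_mono Rp Ru energy_nonneg order_refl) auto
    also have "\<dots> = tame_const \<sigma> (Suc q) * R ^ (2 * Suc q) * energy \<sigma> u"
      by (simp add: algebra_simps power2_eq_square power_mult)
    finally show ?case using weighted_l2_conv[OF u(1,2) p _ \<sigma>] Suc by simp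
  qed (simp add: u)
  then show "weighted_l2 \<sigma> (conv_power u q)" "energy \<sigma> (conv_power u q) \<le> tame_const \<sigma> q * R ^ (2 * q) * energy \<sigma> u"
    by blast+
qed

section \<open>Duhamel's formula and Sobolev regularity in time\<close>

text \<open>Variation of constants for \<open>z'' + \<omega>\<^sup>2 z + F = 0\<close> with
  \<open>z 0 = a\<close> and \<open>z' 0 = b\<close>.\<close>

definition duhamel :: "real \<Rightarrow> complex \<Rightarrow> complex \<Rightarrow> (real \<Rightarrow> complex) \<Rightarrow> real \<Rightarrow> complex" where
  "duhamel \<omega> a b F t = cos (\<omega> * t) *\<^sub>R a + (sin (\<omega> * t) / \<omega>) *\<^sub>R b
     - integral {0..t} (\<lambda>\<tau>. (sin (\<omega> * (t - \<tau>)) / \<omega>) *\<^sub>R F \<tau>)"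

text \<open>The sine kernel vanishes at \<open>\<tau> = t\<close>, so differentiating the upper
  limit of the integral leaves no boundary term.\<close>

definition duhamel_deriv :: "real \<Rightarrow> complex \<Rightarrow> complex \<Rightarrow> (real \<Rightarrow> complex) \<Rightarrow> real \<Rightarrow> complex" where
  "duhamel_deriv \<omega> a b F t = (- \<omega> * sin (\<omega> * t)) *\<^sub>R a + cos (\<omega> * t) *\<^sub>R b
     - integral {0..t} (\<lambda>\<tau>. cos (\<omega> * (t - \<tau>)) *\<^sub>R F \<tau>)"

lemma duhamel_0: "duhamel \<omega> a b F 0 = a" "duhamel_deriv \<omega> a b F 0 = b"
  by (simp_all add: duhamel_def duhamel_deriv_def)

lemma
  assumes F: "continuous_on {0..T} F" and \<omega>: "\<omega> > 0" and t: "t \<in> {0..T}"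
  shows has_vector_derivative_duhamel:
      "(duhamel \<omega> a b F has_vector_derivative duhamel_deriv \<omega> a b F t) (at t within {0..T})"
    and has_vector_derivative_duhamel_deriv:
      "(duhamel_deriv \<omega> a b F has_vector_derivative (- (\<omega>\<^sup>2) *\<^sub>R duhamel \<omega> a b F t - F t)) (at t within {0..T})"
proof -
  \<comment> \<open>The kernel itself depends on \<open>t\<close>. The addition theorems separate
    \<open>t\<close> from \<open>\<tau>\<close> and leave integrals in which \<open>t\<close> is
    only the upper limit, so the fundamental theorem applies.\<close>
  define P where "P t = integral {0..t} (\<lambda>\<tau>. cos (\<omega> * \<tau>) *\<^sub>R F \<tau>)" for t
  define Q where "Q t = integral {0..t} (\<lambda>\<tau>. sin (\<omega> * \<tau>) *\<^sub>R F \<tau>)" for t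
  have cont: "continuous_on {0..T} (\<lambda>\<tau>. cos (\<omega> * \<tau>) *\<^sub>R F \<tau>)" "continuous_on {0..T} (\<lambda>\<tau>. sin (\<omega> * \<tau>) *\<^sub>R F \<tau>)"
    by (intro continuous_intros F)+
  have P: "(P has_vector_derivative cos (\<omega> * t) *\<^sub>R F t) (at t within {0..T})"
    and Q: "(Q has_vector_derivative sin (\<omega> * t) *\<^sub>R F t) (at t within {0..T})"
    unfolding P_def Q_def using integral_has_vector_derivative[OF cont(1) t] integral_has_vector_derivative[OF cont(2) t] by auto
  have int: "(\<lambda>\<tau>. cos (\<omega> * \<tau>) *\<^sub>R F \<tau>) integrable_on {0..s}" "(\<lambda>\<tau>. sin (\<omega> * \<tau>) *\<^sub>R F \<tau>) integrable_on {0..s}"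
    if "s \<in> {0..T}" for s
    using that by (auto intro!: integrable_continuous_real continuous_on_subset[OF cont(1)] continuous_on_subset[OF cont(2)])
  have sin_eq: "integral {0..s} (\<lambda>\<tau>. (sin (\<omega> * (s - \<tau>)) / \<omega>) *\<^sub>R F \<tau>) = (sin (\<omega> * s) / \<omega>) *\<^sub>R P s - (cos (\<omega> * s) / \<omega>) *\<^sub>R Q s"
    if s: "s \<in> {0..T}" for s
  proof -
    have "integral {0..s} (\<lambda>\<tau>. (sin (\<omega> * (s - \<tau>)) / \<omega>) *\<^sub>R F \<tau>)
      = integral {0..s} (\<lambda>\<tau>. (sin (\<omega> * s) / \<omega>) *\<^sub>R (cos (\<omega> * \<tau>) *\<^sub>R F \<tau>) - (cos (\<omega> * s) / \<omega>) *\<^sub>R (sin (\<omega> * \<tau>) *\<^sub>R F \<tau>))"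
      by (rule integral_cong) (simp add: right_diff_distrib sin_diff diff_divide_distrib scaleR_diff_left)
    also have "\<dots> = (sin (\<omega> * s) / \<omega>) *\<^sub>R P s - (cos (\<omega> * s) / \<omega>) *\<^sub>R Q s"
      unfolding P_def Q_def
      by (intro integral_unique has_integral_diff has_integral_cmul integrable_integral int s)
    finally show ?thesis .
  qed
  have cos_eq: "integral {0..s} (\<lambda>\<tau>. cos (\<omega> * (s - \<tau>)) *\<^sub>R F \<tau>) = cos (\<omega> * s) *\<^sub>R P s + sin (\<omega> * s) *\<^sub>R Q s"
    if s: "s \<in> {0..T}" for s
  proof -
    have "integral {0..s} (\<lambda>\<tau>. cos (\<omega> * (s - \<tau>)) *\<^sub>R F \<tau>)
      = integral {0..s} (\<lambda>\<tau>. cos (\<omega> * s) *\<^sub>R (cos (\<omega> * \<tau>) *\<^sub>R F \<tau>) + sin (\<omega> * s) *\<^sub>R (sin (\<omega> * \<tau>) *\<^sub>R F \<tau>))"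
      by (rule integral_cong) (simp add: right_diff_distrib cos_diff scaleR_add_left)
    also have "\<dots> = cos (\<omega> * s) *\<^sub>R P s + sin (\<omega> * s) *\<^sub>R Q s"
      unfolding P_def Q_def
      by (intro integral_unique has_integral_add has_integral_cmul integrable_integral int s)
    finally show ?thesis .
  qed
  have eq: "duhamel \<omega> a b F s = cos (\<omega> * s) *\<^sub>R a + (sin (\<omega> * s) / \<omega>) *\<^sub>R b
       - ((sin (\<omega> * s) / \<omega>) *\<^sub>R P s - (cos (\<omega> * s) / \<omega>) *\<^sub>R Q s)"
    "duhamel_deriv \<omega> a b F s = (- \<omega> * sin (\<omega> * s)) *\<^sub>R a + cos (\<omega> * s) *\<^sub>R b
       - (cos (\<omega> * s) *\<^sub>R P s + sin (\<omega> * s) *\<^sub>R Q s)" if "s \<in> {0..T}" for s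
    unfolding duhamel_def duhamel_deriv_def by (simp_all add: sin_eq[OF that] cos_eq[OF that])
  show "(duhamel \<omega> a b F has_vector_derivative duhamel_deriv \<omega> a b F t) (at t within {0..T})"
  proof (rule has_vector_derivative_transform[OF t eq(1)])
    show "((\<lambda>s. cos (\<omega> * s) *\<^sub>R a + (sin (\<omega> * s) / \<omega>) *\<^sub>R b
       - ((sin (\<omega> * s) / \<omega>) *\<^sub>R P s - (cos (\<omega> * s) / \<omega>) *\<^sub>R Q s))
      has_vector_derivative duhamel_deriv \<omega> a b F t) (at t within {0..T})"
      unfolding eq(2)[OF t] using \<omega>
      by (auto intro!: derivative_eq_intros P Q simp: complex_eq_iff field_simps)
  qed
  show "(duhamel_deriv \<omega> a b F has_vector_derivative (- (\<omega>\<^sup>2) *\<^sub>R duhamel \<omega> a b F t - F t)) (at t within {0..T})"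
  proof (rule has_vector_derivative_transform[OF t eq(2)])
    \<comment> \<open>The boundary terms of \<open>P\<close> and \<open>Q\<close> carry the weights
      cosine squared and sine squared; \<open>F t\<close> is split in the same way so that both
      sides match.\<close>
    have F: "F t = (cos (\<omega> * t))\<^sup>2 *\<^sub>R F t + (sin (\<omega> * t))\<^sup>2 *\<^sub>R F t"
      by (simp flip: scaleR_add_left)
    show "((\<lambda>s. (- \<omega> * sin (\<omega> * s)) *\<^sub>R a + cos (\<omega> * s) *\<^sub>R b
       - (cos (\<omega> * s) *\<^sub>R P s + sin (\<omega> * s) *\<^sub>R Q s))
      has_vector_derivative (- (\<omega>\<^sup>2) *\<^sub>R duhamel \<omega> a b F t - F t)) (at t within {0..T})"
      unfolding eq(1)[OF t] using \<omega>
      by (subst F) (auto intro!: derivative_eq_intros P Q simp: complex_eq_iff field_simps power2_eq_square)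
  qed
qed

text \<open>The two invariants below are the components of \<open>(z, w)\<close> in the rotating frame of the oscillator.\<close>

lemma oscillator_unique:
  fixes z w :: "real \<Rightarrow> complex"
  assumes z: "\<And>t. t \<in> {0..T} \<Longrightarrow> (z has_vector_derivative w t) (at t within {0..T})"
    and w: "\<And>t. t \<in> {0..T} \<Longrightarrow> (w has_vector_derivative - (\<omega>\<^sup>2) *\<^sub>R z t) (at t within {0..T})"
    and init: "z 0 = 0" "w 0 = 0" and \<omega>: "\<omega> > 0" and t: "t \<in> {0..T}"
  shows "z t = 0"
proof -
  define A where "A t = cos (\<omega> * t) *\<^sub>R z t - (sin (\<omega> * t) / \<omega>) *\<^sub>R w t" for t
  define B where "B t = (\<omega> * sin (\<omega> * t)) *\<^sub>R z t + cos (\<omega> * t) *\<^sub>R w t" for t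
  have deriv: "(A has_vector_derivative 0) (at s within {0..T})" "(B has_vector_derivative 0) (at s within {0..T})"
    if s: "s \<in> {0..T}" for s
    unfolding A_def B_def using \<omega>
    by (auto intro!: derivative_eq_intros z[OF s] w[OF s] simp: complex_eq_iff field_simps power2_eq_square)
  obtain c d where "\<And>s. s \<in> {0..T} \<Longrightarrow> A s = c" "\<And>s. s \<in> {0..T} \<Longrightarrow> B s = d"
    using has_vector_derivative_zero_constant[OF _ deriv(1)] has_vector_derivative_zero_constant[OF _ deriv(2)]
    by (metis convex_real_interval(5))
  moreover have "0 \<in> {0..T}" using t by simp
  ultimately have "A t = A 0" "B t = B 0" using t by simp_all
  then have "A t = 0" "B t = 0" by (simp_all add: A_def B_def init)
  moreover have "z t = cos (\<omega> * t) *\<^sub>R A t + (sin (\<omega> * t) / \<omega>) *\<^sub>R B t"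
  proof -
    have "c *\<^sub>R (c *\<^sub>R z t - (s / \<omega>) *\<^sub>R w t) + (s / \<omega>) *\<^sub>R ((\<omega> * s) *\<^sub>R z t + c *\<^sub>R w t) = (c\<^sup>2 + s\<^sup>2) *\<^sub>R z t" for c s
      using \<omega> by (simp add: complex_eq_iff field_simps power2_eq_square)
    from this[of "cos (\<omega> * t)" "sin (\<omega> * t)"] show ?thesis by (simp add: A_def B_def)
  qed
  ultimately show ?thesis by simp
qed

text \<open>The difference from Duhamel's formula solves the free oscillator with zero data.\<close>

lemma duhamel_unique:
  fixes z w :: "real \<Rightarrow> complex"
  assumes z: "\<And>t. t \<in> {0..T} \<Longrightarrow> (z has_vector_derivative w t) (at t within {0..T})"
    and w: "\<And>t. t \<in> {0..T} \<Longrightarrow> (w has_vector_derivative (- (\<omega>\<^sup>2) *\<^sub>R z t - F t)) (at t within {0..T})"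
    and init: "z 0 = a" "w 0 = b" and F: "continuous_on {0..T} F" and \<omega>: "\<omega> > 0" and t: "t \<in> {0..T}"
  shows "z t = duhamel \<omega> a b F t"
proof -
  have "z t - duhamel \<omega> a b F t = 0"
  proof (rule oscillator_unique[OF _ _ _ _ \<omega> t])
    fix t assume t: "t \<in> {0..T}"
    show "((\<lambda>t. z t - duhamel \<omega> a b F t) has_vector_derivative w t - duhamel_deriv \<omega> a b F t) (at t within {0..T})"
      by (intro derivative_intros z has_vector_derivative_duhamel F \<omega> t)
    have "((\<lambda>t. w t - duhamel_deriv \<omega> a b F t) has_vector_derivative
        (- (\<omega>\<^sup>2) *\<^sub>R z t - F t) - (- (\<omega>\<^sup>2) *\<^sub>R duhamel \<omega> a b F t - F t)) (at t within {0..T})"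
      by (rule has_vector_derivative_diff[OF w[OF t] has_vector_derivative_duhamel_deriv[OF F \<omega> t]])
    then show "((\<lambda>t. w t - duhamel_deriv \<omega> a b F t) has_vector_derivative
        - (\<omega>\<^sup>2) *\<^sub>R (z t - duhamel \<omega> a b F t)) (at t within {0..T})"
      by (simp add: algebra_simps)
  qed (simp_all add: init duhamel_0)
  then show ?thesis by simp
qed

lemma continuous_on_duhamel:
  assumes "continuous_on {0..T} F" "\<omega> > 0"
  shows "continuous_on {0..T} (duhamel \<omega> a b F)"
  using has_vector_derivative_duhamel[OF assms]
  by (meson continuous_on_eq_continuous_within has_vector_derivative_continuous)

lemma norm_integral_scaleR_le:
  fixes F :: "real \<Rightarrow> complex"
  assumes F: "continuous_on {0..t} F" and f: "continuous_on {0..t} f" and c: "\<And>x. x \<in> {0..t} \<Longrightarrow> \<bar>f x\<bar> \<le> c"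
  shows "norm (integral {0..t} (\<lambda>\<tau>. f \<tau> *\<^sub>R F \<tau>)) \<le> c * integral {0..t} (\<lambda>\<tau>. norm (F \<tau>))"
proof -
  have "norm (integral {0..t} (\<lambda>\<tau>. f \<tau> *\<^sub>R F \<tau>)) \<le> integral {0..t} (\<lambda>\<tau>. c * norm (F \<tau>))"
  proof (rule integral_norm_bound_integral)
    show "norm (f x *\<^sub>R F x) \<le> c * norm (F x)" if "x \<in> {0..t}" for x
      using c[OF that] by (simp add: mult_right_mono)
  qed (intro integrable_continuous_real continuous_intros F f)+
  then show ?thesis by simp
qed

text \<open>The velocity bound is \<open>\<omega>\<close> times the position bound, so one majorant,
  shifted by one weight, will serve both.\<close>

lemma
  assumes F: "continuous_on {0..t} F" and \<omega>: "\<omega> > 0"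
  shows norm_duhamel_le: "norm (duhamel \<omega> a b F t) \<le> norm a + norm b / \<omega> + (1 / \<omega>) * integral {0..t} (\<lambda>\<tau>. norm (F \<tau>))"
    and norm_duhamel_deriv_le: "norm (duhamel_deriv \<omega> a b F t) \<le> \<omega> * norm a + norm b + integral {0..t} (\<lambda>\<tau>. norm (F \<tau>))"
proof -
  have "norm (duhamel \<omega> a b F t) \<le> norm (cos (\<omega> * t) *\<^sub>R a) + norm ((sin (\<omega> * t) / \<omega>) *\<^sub>R b)
      + norm (integral {0..t} (\<lambda>\<tau>. (sin (\<omega> * (t - \<tau>)) / \<omega>) *\<^sub>R F \<tau>))"
    unfolding duhamel_def by (meson add_mono norm_triangle_ineq norm_triangle_ineq4 order_trans order_refl)
  also have "norm (cos (\<omega> * t) *\<^sub>R a) \<le> norm a"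
    by (simp add: mult_left_le_one_le)
  also have "norm ((sin (\<omega> * t) / \<omega>) *\<^sub>R b) \<le> norm b / \<omega>"
    using \<omega> by (simp add: divide_right_mono mult_left_le_one_le)
  also have "norm (integral {0..t} (\<lambda>\<tau>. (sin (\<omega> * (t - \<tau>)) / \<omega>) *\<^sub>R F \<tau>)) \<le> (1 / \<omega>) * integral {0..t} (\<lambda>\<tau>. norm (F \<tau>))"
    by (intro norm_integral_scaleR_le F continuous_intros) (use \<omega> in \<open>auto simp: divide_right_mono\<close>)
  finally show "norm (duhamel \<omega> a b F t) \<le> norm a + norm b / \<omega> + (1 / \<omega>) * integral {0..t} (\<lambda>\<tau>. norm (F \<tau>))"
    by simp
  have "norm (duhamel_deriv \<omega> a b F t) \<le> norm ((- \<omega> * sin (\<omega> * t)) *\<^sub>R a) + norm (cos (\<omega> * t) *\<^sub>R b)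
      + norm (integral {0..t} (\<lambda>\<tau>. cos (\<omega> * (t - \<tau>)) *\<^sub>R F \<tau>))"
    unfolding duhamel_deriv_def by (meson add_mono norm_triangle_ineq norm_triangle_ineq4 order_trans order_refl)
  also have "norm ((- \<omega> * sin (\<omega> * t)) *\<^sub>R a) \<le> \<omega> * norm a"
    using \<omega> by (simp add: abs_mult mult.assoc mult_left_le_one_le)
  also have "norm (cos (\<omega> * t) *\<^sub>R b) \<le> norm b"
    by (simp add: mult_left_le_one_le)
  also have "norm (integral {0..t} (\<lambda>\<tau>. cos (\<omega> * (t - \<tau>)) *\<^sub>R F \<tau>)) \<le> 1 * integral {0..t} (\<lambda>\<tau>. norm (F \<tau>))"
    by (intro norm_integral_scaleR_le F continuous_intros) auto
  finally show "norm (duhamel_deriv \<omega> a b F t) \<le> \<omega> * norm a + norm b + integral {0..t} (\<lambda>\<tau>. norm (F \<tau>))"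
    by simp
qed

lemma norm_duhamel_diff_le:
  assumes F: "continuous_on {0..t} F" and G: "continuous_on {0..t} G" and \<omega>: "\<omega> > 0"
  shows "norm (duhamel \<omega> a b F t - duhamel \<omega> a b G t) \<le> (1 / \<omega>) * integral {0..t} (\<lambda>\<tau>. norm (F \<tau> - G \<tau>))"
proof -
  have "duhamel \<omega> a b F t - duhamel \<omega> a b G t = duhamel \<omega> 0 0 (\<lambda>\<tau>. F \<tau> - G \<tau>) t"
    unfolding duhamel_def scaleR_diff_right
    by (subst integral_diff) (use \<omega> in \<open>auto intro!: integrable_continuous_real continuous_intros F G\<close>)
  then show ?thesis
    using norm_duhamel_le[OF continuous_on_diff[OF F G] \<omega>, of 0 0] by simp
qed

text \<open>Cauchy-Schwarz against a constant function, obtained by integrating the square of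
  \<open>g\<close> minus its mean.\<close>

lemma integral_squared_le:
  fixes g :: "real \<Rightarrow> real"
  assumes g: "continuous_on {0..t} g" and t: "0 \<le> t"
  shows "(integral {0..t} g)\<^sup>2 \<le> t * integral {0..t} (\<lambda>\<tau>. (g \<tau>)\<^sup>2)"
proof (cases "t = 0")
  case False
  let ?I = "integral {0..t} g" and ?J = "integral {0..t} (\<lambda>\<tau>. (g \<tau>)\<^sup>2)"
  define c where "c = ?I / t"
  have int: "g integrable_on {0..t}" "(\<lambda>\<tau>. (g \<tau>)\<^sup>2) integrable_on {0..t}"
    by (intro integrable_continuous_real continuous_intros g)+
  have "0 \<le> integral {0..t} (\<lambda>\<tau>. (g \<tau> - c)\<^sup>2)"
    by (intro integral_nonneg integrable_continuous_real continuous_intros g) auto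
  also have "(\<lambda>\<tau>. (g \<tau> - c)\<^sup>2) = (\<lambda>\<tau>. (g \<tau>)\<^sup>2 - (2 * c) * g \<tau> + c\<^sup>2)"
    by (auto simp: power2_diff)
  also have "integral {0..t} \<dots> = ?J - 2 * c * ?I + t * c\<^sup>2"
    using t has_integral_const_real[of "c\<^sup>2" 0 t]
    by (intro integral_unique has_integral_add has_integral_diff has_integral_mult_right integrable_integral int) simp
  also have "\<dots> = ?J - ?I\<^sup>2 / t"
    using False by (simp add: c_def field_simps power2_eq_square)
  finally show ?thesis using False t by (simp add: field_simps)
qed simp

section \<open>Limits and derivatives in Sobolev norms from those of the coefficients\<close>

text \<open>Gives coefficientwise derivatives the shape of the difference quotient in
  \<open>has_sobolev_derivative_on\<close>, so that the two notions can be translated into each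
  other.\<close>

lemma has_vector_derivative_iff_quotient:
  "(f has_vector_derivative f') (at x within S)
    \<longleftrightarrow> ((\<lambda>y. (f y - f x) /\<^sub>R (y - x) - f') \<longlongrightarrow> 0) (at x within S)"
proof -
  have eq: "norm ((f y - f x) - (y - x) *\<^sub>R f') / norm (y - x) = norm ((f y - f x) /\<^sub>R (y - x) - f')"
    if "y \<noteq> x" for y
  proof -
    have "(f y - f x) /\<^sub>R (y - x) - f' = ((f y - f x) - (y - x) *\<^sub>R f') /\<^sub>R (y - x)"
      using that by (simp add: scaleR_diff_right)
    then show ?thesis by (simp add: divide_inverse mult.commute)
  qed
  have "(f has_vector_derivative f') (at x within S)
      \<longleftrightarrow> ((\<lambda>y. norm ((f y - f x) - (y - x) *\<^sub>R f') / norm (y - x)) \<longlongrightarrow> 0) (at x within S)"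
    by (simp add: has_vector_derivative_def has_derivative_iff_norm bounded_linear_scaleR_left)
  also have "\<dots> \<longleftrightarrow> ((\<lambda>y. norm ((f y - f x) /\<^sub>R (y - x) - f')) \<longlongrightarrow> 0) (at x within S)"
    by (intro Lim_cong_within refl) (use eq in auto)
  finally show ?thesis by (simp add: tendsto_norm_zero_iff)
qed

lemma sobolev_norm_tendsto_0:
  assumes b: "weighted_l2 \<sigma> (b :: int ^ 'n::finite \<Rightarrow> real)"
    and bound: "eventually (\<lambda>t. \<forall>j. norm (f t j) \<le> b j) F" and lim: "\<And>j. ((\<lambda>t. f t j) \<longlongrightarrow> 0) F"
  shows "((\<lambda>t. sobolev_norm \<sigma> (f t)) \<longlongrightarrow> 0) F"
proof (cases "F = bot")
  case False
  have "((\<lambda>t. \<Sum>\<^sub>\<infinity>j. japanese j powr (2 * \<sigma>) * (cmod (f t j))\<^sup>2) \<longlongrightarrow> (\<Sum>\<^sub>\<infinity>j :: int ^ 'n. japanese j powr (2 * \<sigma>) * (cmod 0)\<^sup>2)) F"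
  proof (rule tannery[OF _ _ _ False])
    show "(\<lambda>j. japanese j powr (2 * \<sigma>) * (b j)\<^sup>2) summable_on UNIV"
      using b by (simp add: weighted_l2_def)
    show "\<forall>\<^sub>F t in F. \<forall>j. norm (japanese j powr (2 * \<sigma>) * (cmod (f t j))\<^sup>2) \<le> japanese j powr (2 * \<sigma>) * (b j)\<^sup>2"
      using bound by eventually_elim (auto simp: abs_mult intro!: mult_left_mono power_mono)
  qed (intro tendsto_intros lim)
  then have "((\<lambda>t. energy \<sigma> (f t)) \<longlongrightarrow> 0) F" by (simp add: energy_def)
  from tendsto_real_sqrt[OF this] show ?thesis by (simp add: sobolev_norm_eq)
qed simp

lemma norm_le_sobolev_norm:
  assumes "u \<in> sobolev \<sigma>"
  shows "norm (u j) \<le> japanese j powr (- \<sigma>) * sobolev_norm \<sigma> u"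
proof -
  have "(japanese j powr \<sigma> * norm (u j))\<^sup>2 \<le> (sobolev_norm \<sigma> u)\<^sup>2"
    using sum_le_energy[of \<sigma> u "{j}"] assms
    by (simp add: sobolev_iff sobolev_norm_squared power_mult_distrib japanese_powr_squared)
  then have "japanese j powr \<sigma> * norm (u j) \<le> sobolev_norm \<sigma> u"
    using sobolev_norm_nonneg power2_le_imp_le by blast
  then have "japanese j powr (- \<sigma>) * (japanese j powr \<sigma> * norm (u j)) \<le> japanese j powr (- \<sigma>) * sobolev_norm \<sigma> u"
    by (rule mult_left_mono) simp
  moreover have "japanese j powr (- \<sigma>) * (japanese j powr \<sigma> * norm (u j)) = norm (u j)"
    using japanese_pos[of j] by (simp add: powr_minus)
  ultimately show ?thesis by simp
qed

text \<open>\<open>sobolev_norm\<close> is \<open>0\<close> where its sum diverges, so a small norm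
  controls the coefficients only together with eventual membership in
  \<open>sobolev \<sigma>\<close>.\<close>

lemma sobolev_norm_tendsto_0_coeff:
  assumes "eventually (\<lambda>t. f t \<in> sobolev \<sigma>) F" "((\<lambda>t. sobolev_norm \<sigma> (f t)) \<longlongrightarrow> 0) F"
  shows "((\<lambda>t. f t j) \<longlongrightarrow> 0) F"
proof (rule Lim_null_comparison)
  show "\<forall>\<^sub>F t in F. norm (f t j) \<le> japanese j powr (- \<sigma>) * sobolev_norm \<sigma> (f t)"
    using assms(1) by eventually_elim (rule norm_le_sobolev_norm)
  show "((\<lambda>t. japanese j powr (- \<sigma>) * sobolev_norm \<sigma> (f t)) \<longlongrightarrow> 0) F"
    using tendsto_mult_right_zero[OF assms(2)] .
qed

lemma eventually_in_at_within: "eventually (\<lambda>x. x \<in> S) (at t within S)"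
  by (simp add: eventually_at_filter)

lemma sobolev_continuous_onI:
  assumes b: "weighted_l2 \<sigma> (b :: int ^ 'n::finite \<Rightarrow> real)"
    and bound: "\<And>t j. t \<in> I \<Longrightarrow> norm (\<psi> t j) \<le> b j" and cont: "\<And>j. continuous_on I (\<lambda>t. \<psi> t j)"
  shows "sobolev_continuous_on \<sigma> I \<psi>"
  unfolding sobolev_continuous_on_def
proof (intro conjI ballI)
  fix t assume t: "t \<in> I"
  have abs: "norm (\<psi> s j) \<le> norm (b j)" if "s \<in> I" for s j using bound[OF that, of j] by simp
  show "\<psi> t \<in> sobolev \<sigma>"
    unfolding sobolev_iff by (rule weighted_l2_mono[OF b abs[OF t]])
  show "((\<lambda>\<tau>. sobolev_norm \<sigma> (\<lambda>j. \<psi> \<tau> j - \<psi> t j)) \<longlongrightarrow> 0) (at t within I)"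
  proof (rule sobolev_norm_tendsto_0[OF weighted_l2_add[OF b b]])
    show "\<forall>\<^sub>F \<tau> in at t within I. \<forall>j. norm (\<psi> \<tau> j - \<psi> t j) \<le> b j + b j"
      using eventually_in_at_within
    proof eventually_elim
      case (elim \<tau>)
      then show ?case using bound[OF t] bound[OF elim] norm_triangle_ineq4 by (meson add_mono order_trans)
    qed
    show "((\<lambda>\<tau>. \<psi> \<tau> j - \<psi> t j) \<longlongrightarrow> 0) (at t within I)" for j
      using cont[of j] t by (simp add: continuous_on LIM_zero)
  qed
qed

text \<open>The mean value inequality bounds the difference quotients of each coefficient by the
  majorant \<open>b\<close> of the derivative. The error is then dominated by
  \<open>b j + b j\<close>, and dominated convergence upgrades coefficientwise
  differentiability.\<close>

lemma has_sobolev_derivative_onI: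
  assumes a: "weighted_l2 \<sigma> (a :: int ^ 'n::finite \<Rightarrow> real)" and b: "weighted_l2 \<sigma> (b :: int ^ 'n \<Rightarrow> real)"
    and bound: "\<And>t j. t \<in> I \<Longrightarrow> norm (\<psi> t j) \<le> a j" "\<And>t j. t \<in> I \<Longrightarrow> norm (\<psi>' t j) \<le> b j"
    and deriv: "\<And>t j. t \<in> I \<Longrightarrow> ((\<lambda>t. \<psi> t j) has_vector_derivative \<psi>' t j) (at t within I)" and I: "convex I"
  shows "has_sobolev_derivative_on \<sigma> I \<psi> \<psi>'"
  unfolding has_sobolev_derivative_on_def
proof (intro conjI ballI)
  fix t assume t: "t \<in> I"
  show "\<psi> t \<in> sobolev \<sigma>" "\<psi>' t \<in> sobolev \<sigma>"
    unfolding sobolev_iff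
    by (rule weighted_l2_mono[OF a], use bound(1)[OF t] in \<open>simp add: order.trans[OF _ abs_ge_self]\<close>)
      (rule weighted_l2_mono[OF b], use bound(2)[OF t] in \<open>simp add: order.trans[OF _ abs_ge_self]\<close>)
  show "((\<lambda>\<tau>. sobolev_norm \<sigma> (\<lambda>j. (\<psi> \<tau> j - \<psi> t j) /\<^sub>R (\<tau> - t) - \<psi>' t j)) \<longlongrightarrow> 0) (at t within I)"
  proof (rule sobolev_norm_tendsto_0[OF weighted_l2_add[OF b b]])
    show "\<forall>\<^sub>F \<tau> in at t within I. \<forall>j. norm ((\<psi> \<tau> j - \<psi> t j) /\<^sub>R (\<tau> - t) - \<psi>' t j) \<le> b j + b j"
      using eventually_in_at_within
    proof eventually_elim
      case (elim \<tau>)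
      show ?case
      proof
        fix j
        have b0: "0 \<le> b j" using bound(2)[OF t, of j] norm_ge_zero order_trans by blast
        have "norm (\<psi> \<tau> j - \<psi> t j) \<le> b j * norm (\<tau> - t)"
        proof (rule differentiable_bound[OF I _ _ elim t])
          show "((\<lambda>t. \<psi> t j) has_derivative (\<lambda>h. h *\<^sub>R \<psi>' s j)) (at s within I)" if "s \<in> I" for s
            using deriv[OF that, of j] by (simp add: has_vector_derivative_def)
          show "onorm (\<lambda>h. h *\<^sub>R \<psi>' s j) \<le> b j" if "s \<in> I" for s
            by (rule onorm_le) (use bound(2)[OF that, of j] in \<open>simp add: mult.commute[of "b j"] mult_left_mono\<close>)
        qed
        \<comment> \<open>At \<open>\<tau> = t\<close> the quotient is \<open>0\<close> by
          convention, and \<open>0 \<le> b j\<close> suffices.\<close>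
        then have "norm ((\<psi> \<tau> j - \<psi> t j) /\<^sub>R (\<tau> - t)) \<le> b j"
          using b0 by (cases "\<tau> = t") (simp_all add: divide_simps flip: divide_inverse_commute)
        then show "norm ((\<psi> \<tau> j - \<psi> t j) /\<^sub>R (\<tau> - t) - \<psi>' t j) \<le> b j + b j"
          using bound(2)[OF t, of j] norm_triangle_ineq4 by (meson add_mono order_trans)
      qed
    qed
    show "((\<lambda>\<tau>. (\<psi> \<tau> j - \<psi> t j) /\<^sub>R (\<tau> - t) - \<psi>' t j) \<longlongrightarrow> 0) (at t within I)" for j
      using deriv[OF t, of j] by (simp only: has_vector_derivative_iff_quotient)
  qed
qed

lemma has_sobolev_derivative_on_coeff:
  assumes "has_sobolev_derivative_on \<sigma> I \<psi> \<psi>'" and t: "t \<in> I"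
  shows "((\<lambda>t. \<psi> t j) has_vector_derivative \<psi>' t j) (at t within I)"
  unfolding has_vector_derivative_iff_quotient
proof (rule sobolev_norm_tendsto_0_coeff)
  show "((\<lambda>\<tau>. sobolev_norm \<sigma> (\<lambda>j. (\<psi> \<tau> j - \<psi> t j) /\<^sub>R (\<tau> - t) - \<psi>' t j)) \<longlongrightarrow> 0) (at t within I)"
    using assms by (simp add: has_sobolev_derivative_on_def)
  show "\<forall>\<^sub>F \<tau> in at t within I. (\<lambda>j. (\<psi> \<tau> j - \<psi> t j) /\<^sub>R (\<tau> - t) - \<psi>' t j) \<in> sobolev \<sigma>"
    using eventually_in_at_within
  proof eventually_elim
    case (elim \<tau>)
    then have "weighted_l2 \<sigma> (\<psi> \<tau>)" "weighted_l2 \<sigma> (\<psi> t)" "weighted_l2 \<sigma> (\<psi>' t)"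
      using assms by (simp_all add: has_sobolev_derivative_on_def sobolev_iff)
    then show ?case unfolding sobolev_iff by (intro weighted_l2_diff weighted_l2_scaleR)
  qed
qed

section \<open>Picard iteration\<close>

text \<open>\<open>R\<close> is the radius of a ball in the absolute-sum norm: by
  \<open>h_small\<close> the data use at most half of it, by \<open>T_small\<close> the nonlinear
  term at most the other half. The division by \<open>japanese j\<close> in \<open>h_def\<close>
  brings the initial velocity to the regularity of the initial position.\<close>

locale klein_gordon_iteration =
  fixes q :: nat and \<omega> :: "int ^ 'n::finite \<Rightarrow> real" and K T R :: real
    and h :: "int ^ 'n \<Rightarrow> real" and \<psi>\<^sub>0 \<phi>\<^sub>0 :: "'n fourier"
  assumes omega_pos: "\<And>j. 0 < \<omega> j" and inverse_omega_le: "\<And>j. 1 / \<omega> j \<le> K / japanese j"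
    and omega_le: "\<And>j. \<omega> j \<le> K * japanese j" and K_ge_1: "1 \<le> K" and T_pos: "0 < T" and R_pos: "0 < R"
    and h_def: "\<And>j. h j = norm (\<psi>\<^sub>0 j) + norm (\<phi>\<^sub>0 j) / japanese j"
    and h_summable: "h summable_on UNIV" and h_small: "K * infsum h UNIV \<le> R / 2"
    and T_small: "K * T * R ^ q \<le> 1 / 2"
begin

lemma h_nonneg: "0 \<le> h j"
  using japanese_nonneg[of j] by (simp add: h_def)

lemma K_pos: "0 < K" using K_ge_1 by simp

lemma inverse_omega_le_K: "1 / \<omega> j \<le> K"
proof -
  have "K / japanese j \<le> K / 1" using K_pos japanese_ge_1[of j] by (intro divide_left_mono) auto
  then show ?thesis using inverse_omega_le[of j] by simp
qed

abbreviation flow :: "(real \<Rightarrow> 'n fourier) \<Rightarrow> real \<Rightarrow> 'n fourier" where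
  "flow F t j \<equiv> duhamel (\<omega> j) (\<psi>\<^sub>0 j) (\<phi>\<^sub>0 j) (\<lambda>\<tau>. F \<tau> j) t"

abbreviation flow_deriv :: "(real \<Rightarrow> 'n fourier) \<Rightarrow> real \<Rightarrow> 'n fourier" where
  "flow_deriv F t j \<equiv> duhamel_deriv (\<omega> j) (\<psi>\<^sub>0 j) (\<phi>\<^sub>0 j) (\<lambda>\<tau>. F \<tau> j) t"

text \<open>Dominates the flow and, multiplied by \<open>japanese j\<close>, its velocity. It
  increases with \<open>t\<close>, so its value at \<open>T\<close> dominates all earlier
  times.\<close>

definition flow_bound :: "(real \<Rightarrow> 'n fourier) \<Rightarrow> real \<Rightarrow> int ^ 'n \<Rightarrow> real" where
  "flow_bound F t j = K * (h j + integral {0..t} (\<lambda>\<tau>. norm (F \<tau> j)) / japanese j)"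

lemma
  assumes F: "continuous_on {0..T} (\<lambda>\<tau>. F \<tau> j)" and t: "t \<in> {0..T}"
  shows norm_flow_le: "norm (flow F t j) \<le> flow_bound F t j"
    and norm_flow_deriv_le: "norm (flow_deriv F t j) \<le> japanese j * flow_bound F t j"
proof -
  have Ft: "continuous_on {0..t} (\<lambda>\<tau>. F \<tau> j)" by (rule continuous_on_subset[OF F]) (use t in auto)
  let ?I = "integral {0..t} (\<lambda>\<tau>. norm (F \<tau> j))"
  have I: "0 \<le> ?I" by (intro integral_nonneg integrable_continuous_real continuous_intros Ft) auto
  have "norm (flow F t j) \<le> norm (\<psi>\<^sub>0 j) + (1 / \<omega> j) * norm (\<phi>\<^sub>0 j) + (1 / \<omega> j) * ?I"
    using norm_duhamel_le[OF Ft omega_pos, of j] by simp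
  also have "\<dots> \<le> K * norm (\<psi>\<^sub>0 j) + K / japanese j * norm (\<phi>\<^sub>0 j) + K / japanese j * ?I"
    using K_ge_1 I by (intro add_mono mult_right_mono inverse_omega_le) (auto simp: mult_le_cancel_right1)
  also have "\<dots> = flow_bound F t j" by (simp add: flow_bound_def h_def algebra_simps)
  finally show "norm (flow F t j) \<le> flow_bound F t j" .
  have "norm (flow_deriv F t j) \<le> \<omega> j * norm (\<psi>\<^sub>0 j) + 1 * norm (\<phi>\<^sub>0 j) + 1 * ?I"
    using norm_duhamel_deriv_le[OF Ft omega_pos, of j] by simp
  also have "\<dots> \<le> K * japanese j * norm (\<psi>\<^sub>0 j) + K * norm (\<phi>\<^sub>0 j) + K * ?I"
    using K_ge_1 I by (intro add_mono mult_right_mono omega_le) auto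
  also have "\<dots> = japanese j * flow_bound F t j"
    using japanese_pos[of j] by (simp add: flow_bound_def h_def field_simps)
  finally show "norm (flow_deriv F t j) \<le> japanese j * flow_bound F t j" .
qed

lemma flow_bound_mono:
  assumes F: "continuous_on {0..T} (\<lambda>\<tau>. F \<tau> j)" and t: "0 \<le> t" "t \<le> s" "s \<le> T"
  shows "flow_bound F t j \<le> flow_bound F s j"
proof -
  have "integral {0..t} (\<lambda>\<tau>. norm (F \<tau> j)) \<le> integral {0..s} (\<lambda>\<tau>. norm (F \<tau> j))"
    by (rule integral_subset_le)
      (use t in \<open>auto intro!: integrable_continuous_real continuous_intros continuous_on_subset[OF F]\<close>)
  then show ?thesis
    unfolding flow_bound_def using K_pos japanese_nonneg[of j]
    by (intro mult_left_mono add_left_mono divide_right_mono) auto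
qed

text \<open>Only \<open>1 \<le> japanese j\<close> is used: in the unweighted sum norm products lose
  no derivative, and the gain of the equation is kept for the energy estimate.\<close>

lemma flow_bound_le:
  assumes F: "continuous_on {0..T} (\<lambda>\<tau>. F \<tau> j)" and t: "t \<in> {0..T}"
    and c: "\<And>\<tau>. \<tau> \<in> {0..T} \<Longrightarrow> norm (F \<tau> j) \<le> c"
  shows "flow_bound F t j \<le> K * (h j + T * c)"
proof -
  have Ft: "continuous_on {0..t} (\<lambda>\<tau>. F \<tau> j)" by (rule continuous_on_subset[OF F]) (use t in auto)
  have c0: "0 \<le> c" using order_trans[OF norm_ge_zero c[of 0]] T_pos by simp
  have I: "0 \<le> integral {0..t} (\<lambda>\<tau>. norm (F \<tau> j))"
    by (intro integral_nonneg integrable_continuous_real continuous_intros Ft) auto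
  have "integral {0..t} (\<lambda>\<tau>. norm (F \<tau> j)) \<le> integral {0..t} (\<lambda>\<tau>. c)"
    by (rule integral_le) (use c t in \<open>auto intro!: integrable_continuous_real continuous_intros Ft\<close>)
  also have "\<dots> \<le> T * c" using t c0 by (simp add: mult_right_mono)
  finally have "integral {0..t} (\<lambda>\<tau>. norm (F \<tau> j)) / japanese j \<le> T * c"
    using I japanese_ge_1[of j] divide_left_mono[of 1 "japanese j" "integral {0..t} (\<lambda>\<tau>. norm (F \<tau> j))"] by simp
  then show ?thesis
    unfolding flow_bound_def using K_pos by (intro mult_left_mono add_left_mono) auto
qed

text \<open>Starting from zero rather than from the free evolution makes the base case of
  \<open>iterate_step\<close> an instance of \<open>norm_iterate_le\<close>.\<close>

primrec iterate :: "nat \<Rightarrow> real \<Rightarrow> 'n fourier" where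
  "iterate 0 t = (\<lambda>j. 0)"
| "iterate (Suc n) t = (\<lambda>j. flow (\<lambda>\<tau>. conv_power (iterate n \<tau>) q) t j)"

text \<open>The recursion of \<open>iterate\<close> with Duhamel's formula replaced by a worst case
  over \<open>{0..T}\<close>, which removes time.\<close>

primrec majorant :: "nat \<Rightarrow> int ^ 'n \<Rightarrow> real" where
  "majorant 0 = (\<lambda>j. 0)"
| "majorant (Suc n) = (\<lambda>j. K * (h j + T * conv_power (majorant n) q j))"

lemma majorant_bounds: "(\<forall>j. 0 \<le> majorant n j) \<and> majorant n summable_on UNIV \<and> wiener_norm (majorant n) \<le> R"
proof (induction n)
  case 0
  then show ?case using R_pos by (simp add: wiener_norm_def)
next
  case (Suc n)
  let ?p = "conv_power (majorant n) q"
  have p: "?p summable_on UNIV" "0 \<le> ?p j" for j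
    using Suc by (auto intro: summable_conv_power_real conv_power_nonneg)
  have nonneg: "0 \<le> majorant (Suc n) j" for j
    using K_pos T_pos h_nonneg p by (simp add: mult_nonneg_nonneg)
  have s: "majorant (Suc n) summable_on UNIV"
    unfolding majorant.simps by (intro summable_on_cmult_right summable_on_add h_summable p)
  have "wiener_norm (majorant (Suc n)) = infsum (majorant (Suc n)) UNIV"
    unfolding wiener_norm_def using nonneg by (simp only: real_norm_def abs_of_nonneg)
  also have "\<dots> = K * infsum h UNIV + K * T * infsum ?p UNIV"
    unfolding majorant.simps infsum_cmult_right'
    by (subst infsum_add) (auto intro!: summable_on_cmult_right h_summable p simp: infsum_cmult_right' algebra_simps)
  also have "infsum ?p UNIV = wiener_norm ?p"
    unfolding wiener_norm_def using p by simp
  also have "K * infsum h UNIV + K * T * wiener_norm ?p \<le> R / 2 + K * T * R ^ Suc q"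
    using Suc K_pos T_pos
    by (intro add_mono h_small mult_left_mono order_trans[OF wiener_norm_conv_power power_mono])
      (auto intro: abs_summable_realI wiener_norm_nonneg simp del: power_Suc)
  also have "K * T * R ^ Suc q = (K * T * R ^ q) * R" by (simp add: mult_ac)
  also have "R / 2 + \<dots> \<le> R / 2 + 1 / 2 * R"
    using R_pos by (intro add_left_mono mult_right_mono T_small) simp
  finally show ?case using nonneg s by simp
qed

lemma majorant_nonneg: "0 \<le> majorant n j" and majorant_summable: "majorant n summable_on UNIV"
  and majorant_le_R: "wiener_norm (majorant n) \<le> R"
  using majorant_bounds by blast+

lemma continuous_on_conv_power:
  assumes a: "a summable_on UNIV" and bound: "\<And>t j. t \<in> {0..T} \<Longrightarrow> norm (u t j) \<le> (a j :: real)"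
    and cont: "\<And>j. continuous_on {0..T} (\<lambda>t. u t j)"
  shows "continuous_on {0..T} (\<lambda>t. conv_power (u t) p j)"
  unfolding continuous_on
proof
  fix t assume t: "t \<in> {0..T}"
  show "((\<lambda>s. conv_power (u s) p j) \<longlongrightarrow> conv_power (u t) p j) (at t within {0..T})"
  proof (rule tendsto_conv_power[OF a])
    show "at t within {0..T} \<noteq> bot"
      using t T_pos by (simp add: trivial_limit_within islimpt_Icc)
    show "\<forall>\<^sub>F s in at t within {0..T}. \<forall>j. norm (u s j) \<le> a j"
      using eventually_in_at_within by eventually_elim (use bound in auto)
    show "((\<lambda>s. u s j) \<longlongrightarrow> u t j) (at t within {0..T})" for j
      using cont[of j] t by (simp add: continuous_on)
  qed
qed

lemma iterate_bounds:
  "(\<forall>t\<in>{0..T}. \<forall>j. norm (iterate n t j) \<le> majorant n j) \<and> (\<forall>j. continuous_on {0..T} (\<lambda>t. iterate n t j))"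
proof (induction n)
  case (Suc n)
  let ?F = "\<lambda>\<tau>. conv_power (iterate n \<tau>) q"
  have F: "continuous_on {0..T} (\<lambda>\<tau>. ?F \<tau> j)" for j
    by (rule continuous_on_conv_power[OF majorant_summable]) (use Suc in auto)
  have "norm (iterate (Suc n) t j) \<le> majorant (Suc n) j" if t: "t \<in> {0..T}" for t j
  proof -
    have "norm (iterate (Suc n) t j) \<le> flow_bound ?F t j"
      using norm_flow_le[of ?F j t, OF F t] by simp
    also have "\<dots> \<le> majorant (Suc n) j"
      unfolding majorant.simps
    proof (rule flow_bound_le[OF F t])
      show "norm (?F \<tau> j) \<le> conv_power (majorant n) q j" if "\<tau> \<in> {0..T}" for \<tau>
        by (rule norm_conv_power_le[OF majorant_summable]) (use Suc that in blast)
    qed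
    finally show ?thesis .
  qed
  moreover have "continuous_on {0..T} (\<lambda>t. iterate (Suc n) t j)" for j
    unfolding iterate.simps by (rule continuous_on_duhamel[OF F omega_pos])
  ultimately show ?case by blast
qed simp

lemma norm_iterate_le: "t \<in> {0..T} \<Longrightarrow> norm (iterate n t j) \<le> majorant n j"
  and continuous_on_iterate: "continuous_on {0..T} (\<lambda>t. iterate n t j)"
  using iterate_bounds by blast+

lemma continuous_on_iterate_power: "continuous_on {0..T} (\<lambda>t. conv_power (iterate n t) q j)"
  by (rule continuous_on_conv_power[OF majorant_summable norm_iterate_le continuous_on_iterate])

text \<open>By \<open>norm_conv_power_diff_le\<close> increments of powers are majorised by
  increments of the majorant powers, and Duhamel's map preserves this. No contraction factor is
  computed: convergence of the increasing, bounded majorants makes the iterates Cauchy at each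
  frequency, uniformly in time.\<close>

lemma iterate_step:
  "t \<in> {0..T} \<Longrightarrow> norm (iterate (Suc n) t j - iterate n t j) \<le> majorant (Suc n) j - majorant n j"
proof (induction n arbitrary: t j)
  case 0
  then show ?case using norm_iterate_le[of t "Suc 0" j] by simp
next
  case (Suc n)
  let ?F = "\<lambda>n \<tau>. conv_power (iterate n \<tau>) q j" and ?A = "\<lambda>n. conv_power (majorant n) q j"
  have cont: "continuous_on {0..t} (?F n)" for n
    by (rule continuous_on_subset[OF continuous_on_iterate_power]) (use Suc in auto)
  have le: "norm (?F (Suc n) \<tau> - ?F n \<tau>) \<le> ?A (Suc n) - ?A n" if "\<tau> \<in> {0..T}" for \<tau>
    by (rule norm_conv_power_diff_le[OF majorant_summable norm_iterate_le[OF that] Suc.IH[OF that]])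
  have A: "0 \<le> ?A (Suc n) - ?A n" using order_trans[OF norm_ge_zero le[of 0]] T_pos by simp
  have eq1: "iterate (Suc (Suc n)) t j = duhamel (\<omega> j) (\<psi>\<^sub>0 j) (\<phi>\<^sub>0 j) (?F (Suc n)) t"
    by (simp only: iterate.simps(2)[of "Suc n"])
  have eq2: "iterate (Suc n) t j = duhamel (\<omega> j) (\<psi>\<^sub>0 j) (\<phi>\<^sub>0 j) (?F n) t"
    by (simp only: iterate.simps(2)[of n])
  have "norm (iterate (Suc (Suc n)) t j - iterate (Suc n) t j)
      \<le> (1 / \<omega> j) * integral {0..t} (\<lambda>\<tau>. norm (?F (Suc n) \<tau> - ?F n \<tau>))"
    unfolding eq1 eq2 by (rule norm_duhamel_diff_le[OF cont cont omega_pos])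
  also have "\<dots> \<le> K * (T * (?A (Suc n) - ?A n))"
  proof (intro mult_mono inverse_omega_le_K)
    have "integral {0..t} (\<lambda>\<tau>. norm (?F (Suc n) \<tau> - ?F n \<tau>)) \<le> integral {0..t} (\<lambda>\<tau>. ?A (Suc n) - ?A n)"
      by (rule integral_le) (use le Suc.prems in \<open>auto intro!: integrable_continuous_real continuous_intros cont simp del: iterate.simps majorant.simps\<close>)
    also have "\<dots> \<le> T * (?A (Suc n) - ?A n)"
      using Suc.prems A by (auto intro!: mult_right_mono simp del: iterate.simps majorant.simps)
    finally show "integral {0..t} (\<lambda>\<tau>. norm (?F (Suc n) \<tau> - ?F n \<tau>)) \<le> T * (?A (Suc n) - ?A n)" .
  qed (use K_pos in \<open>auto intro!: integral_nonneg integrable_continuous_real continuous_intros cont simp del: iterate.simps majorant.simps\<close>)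
  also have "\<dots> = majorant (Suc (Suc n)) j - majorant (Suc n) j"
    by (simp only: majorant.simps(2)[of "Suc n"] majorant.simps(2)[of n]) (simp add: algebra_simps)
  finally show ?case .
qed

lemma iterate_diff_le:
  assumes t: "t \<in> {0..T}"
  shows "n \<le> m \<Longrightarrow> norm (iterate m t j - iterate n t j) \<le> majorant m j - majorant n j"
proof (induction m rule: dec_induct)
  case (step m)
  have "norm (iterate (Suc m) t j - iterate n t j)
      \<le> norm (iterate (Suc m) t j - iterate m t j) + norm (iterate m t j - iterate n t j)"
    using norm_triangle_ineq[of "iterate (Suc m) t j - iterate m t j" "iterate m t j - iterate n t j"] by simp
  also have "\<dots> \<le> (majorant (Suc m) j - majorant m j) + (majorant m j - majorant n j)"
    by (intro add_mono iterate_step t step.IH)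
  finally show ?case by simp
qed simp

section \<open>Limit of the iteration\<close>

definition limit_majorant :: "int ^ 'n \<Rightarrow> real" where
  "limit_majorant j = lim (\<lambda>n. majorant n j)"

definition solution :: "real \<Rightarrow> 'n fourier" where
  "solution t j = lim (\<lambda>n. iterate n t j)"

text \<open>Monotonicity comes for free because the differences dominate a norm; the time
  \<open>0\<close> serves as witness.\<close>

lemma majorant_mono: "n \<le> m \<Longrightarrow> majorant n j \<le> majorant m j"
  using order_trans[OF norm_ge_zero iterate_diff_le[of 0 n m j]] T_pos by simp

lemma majorant_tendsto: "(\<lambda>n. majorant n j) \<longlonglongrightarrow> limit_majorant j"
proof -
  have "majorant n j \<le> R" for n
    using norm_le_wiener_norm[OF abs_summable_realI[OF majorant_summable], of n j] majorant_le_R[of n] majorant_nonneg[of n j]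
    by simp
  then have "convergent (\<lambda>n. majorant n j)"
    using majorant_nonneg majorant_mono
    by (intro Bseq_mono_convergent BseqI'[of _ R]) auto
  then show ?thesis unfolding limit_majorant_def by (simp add: convergent_LIMSEQ_iff)
qed

lemma iterate_tendsto:
  assumes t: "t \<in> {0..T}"
  shows "(\<lambda>n. iterate n t j) \<longlonglongrightarrow> solution t j"
proof -
  have "Cauchy (\<lambda>n. iterate n t j)"
  proof (rule CauchyI')
    fix e :: real assume "e > 0"
    then obtain N where N: "\<And>m n. m \<ge> N \<Longrightarrow> n \<ge> N \<Longrightarrow> norm (majorant m j - majorant n j) < e"
      using LIMSEQ_imp_Cauchy[OF majorant_tendsto[of j]] unfolding Cauchy_iff by blast
    have "dist (iterate m t j) (iterate n t j) < e" if "m \<ge> N" "n > m" for m n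
      using iterate_diff_le[OF t, of m n j] N[of n m] that by (simp add: dist_norm norm_minus_commute)
    then show "\<exists>M. \<forall>m\<ge>M. \<forall>n>m. dist (iterate m t j) (iterate n t j) < e" by blast
  qed
  then show ?thesis
    unfolding solution_def by (simp add: Cauchy_convergent_iff convergent_LIMSEQ_iff)
qed

lemma solution_diff_le:
  assumes t: "t \<in> {0..T}"
  shows "norm (solution t j - iterate n t j) \<le> limit_majorant j - majorant n j"
proof (rule tendsto_le)
  show "(\<lambda>m. majorant m j - majorant n j) \<longlonglongrightarrow> limit_majorant j - majorant n j"
    by (intro tendsto_intros majorant_tendsto)
  show "(\<lambda>m. norm (iterate m t j - iterate n t j)) \<longlonglongrightarrow> norm (solution t j - iterate n t j)"
    by (intro tendsto_intros iterate_tendsto t)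
  show "\<forall>\<^sub>F m in sequentially. norm (iterate m t j - iterate n t j) \<le> majorant m j - majorant n j"
    using eventually_ge_at_top[of n] by eventually_elim (rule iterate_diff_le[OF t])
qed simp

lemma norm_solution_le: "t \<in> {0..T} \<Longrightarrow> norm (solution t j) \<le> limit_majorant j"
  using solution_diff_le[of t j 0] by simp

lemma majorant_le_limit: "majorant n j \<le> limit_majorant j"
  using order_trans[OF norm_ge_zero solution_diff_le[of 0 j n]] T_pos by simp

lemma limit_majorant_nonneg: "0 \<le> limit_majorant j"
  using majorant_le_limit[of 0] by simp

text \<open>The bound \<open>R\<close> passes to the limit on finite sets of frequencies, as in
  Fatou's lemma.\<close>

lemma limit_majorant_summable: "limit_majorant summable_on UNIV"
  and limit_majorant_le_R: "infsum limit_majorant UNIV \<le> R"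
proof -
  have "sum limit_majorant J \<le> R" if "finite J" for J
  proof (rule tendsto_upperbound)
    show "(\<lambda>n. sum (majorant n) J) \<longlonglongrightarrow> sum limit_majorant J"
      by (intro tendsto_sum majorant_tendsto)
    have "sum (majorant n) J \<le> R" for n
    proof -
      have "sum (majorant n) J \<le> infsum (majorant n) UNIV"
        using that by (intro finite_sum_le_infsum majorant_summable) (auto simp: majorant_nonneg)
      also have "\<dots> = wiener_norm (majorant n)" by (simp add: wiener_norm_def majorant_nonneg)
      finally show ?thesis using majorant_le_R[of n] by simp
    qed
    then show "\<forall>\<^sub>F n in sequentially. sum (majorant n) J \<le> R" by simp
  qed simp
  then show "limit_majorant summable_on UNIV" "infsum limit_majorant UNIV \<le> R"
    using nonneg_summable_onI[of UNIV limit_majorant R] limit_majorant_nonneg by blast+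
qed

lemma solution_abs_summable: "t \<in> {0..T} \<Longrightarrow> abs_summable (solution t)"
  and solution_wiener_norm: "t \<in> {0..T} \<Longrightarrow> wiener_norm (solution t) \<le> R"
  using abs_summable_dominated[OF limit_majorant_summable norm_solution_le]
    wiener_norm_mono[OF limit_majorant_summable norm_solution_le] limit_majorant_le_R by force+

lemma continuous_on_solution: "continuous_on {0..T} (\<lambda>t. solution t j)"
proof (rule uniform_limit_theorem)
  show "uniform_limit {0..T} (\<lambda>n t. iterate n t j) (\<lambda>t. solution t j) sequentially"
  proof (rule uniform_limitI)
    fix e :: real assume "e > 0"
    then have "\<forall>\<^sub>F n in sequentially. dist (majorant n j) (limit_majorant j) < e"
      using majorant_tendsto by (intro tendstoD)
    then show "\<forall>\<^sub>F n in sequentially. \<forall>t\<in>{0..T}. dist (iterate n t j) (solution t j) < e"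
    proof eventually_elim
      case (elim n)
      then show ?case
        using solution_diff_le[of _ j n] by (fastforce simp: dist_norm norm_minus_commute)
    qed
  qed
qed (use continuous_on_iterate in auto)

lemma continuous_on_solution_power: "continuous_on {0..T} (\<lambda>t. conv_power (solution t) q j)"
  by (rule continuous_on_conv_power[OF limit_majorant_summable norm_solution_le continuous_on_solution])

text \<open>The limit passes under the time integral because, at a fixed frequency, one constant
  built from the power of \<open>limit_majorant\<close> dominates all integrands.\<close>

lemma solution_fixed_point:
  assumes t: "t \<in> {0..T}"
  shows "solution t j = flow (\<lambda>\<tau>. conv_power (solution \<tau>) q) t j"
proof (rule LIMSEQ_unique)
  show "(\<lambda>n. iterate (Suc n) t j) \<longlonglongrightarrow> solution t j"
    by (rule LIMSEQ_Suc[OF iterate_tendsto[OF t]])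
  let ?f = "\<lambda>n \<tau>. (sin (\<omega> j * (t - \<tau>)) / \<omega> j) *\<^sub>R conv_power (iterate n \<tau>) q j"
  have "(\<lambda>n. integral {0..t} (?f n)) \<longlonglongrightarrow>
      integral {0..t} (\<lambda>\<tau>. (sin (\<omega> j * (t - \<tau>)) / \<omega> j) *\<^sub>R conv_power (solution \<tau>) q j)"
  proof (rule dominated_convergence)
    show "?f n integrable_on {0..t}" for n
      using omega_pos[of j] t
      by (intro integrable_continuous_real continuous_intros continuous_on_subset[OF continuous_on_iterate_power]) auto
    show "(\<lambda>\<tau>. K * conv_power limit_majorant q j) integrable_on {0..t}"
      by (intro integrable_continuous_real continuous_intros)
    fix \<tau> assume "\<tau> \<in> {0..t}"
    with t have \<tau>: "\<tau> \<in> {0..T}" by simp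
    show "norm (?f n \<tau>) \<le> K * conv_power limit_majorant q j" for n
      unfolding norm_scaleR
    proof (intro mult_mono norm_conv_power_le limit_majorant_summable)
      have "\<bar>sin (\<omega> j * (t - \<tau>))\<bar> / \<omega> j \<le> 1 / \<omega> j"
        using omega_pos[of j] by (intro divide_right_mono) auto
      then show "\<bar>sin (\<omega> j * (t - \<tau>)) / \<omega> j\<bar> \<le> K"
        using inverse_omega_le_K[of j] omega_pos[of j] by simp
    qed (use K_pos norm_iterate_le[OF \<tau>] majorant_le_limit order_trans in \<open>auto, blast\<close>)
    show "(\<lambda>n. ?f n \<tau>) \<longlonglongrightarrow> (sin (\<omega> j * (t - \<tau>)) / \<omega> j) *\<^sub>R conv_power (solution \<tau>) q j"
      by (intro tendsto_intros tendsto_conv_power[OF limit_majorant_summable] iterate_tendsto \<tau> always_eventually allI)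
        (use norm_iterate_le[OF \<tau>] majorant_le_limit order_trans in \<open>auto, blast\<close>)
  qed
  then show "(\<lambda>n. iterate (Suc n) t j) \<longlonglongrightarrow> flow (\<lambda>\<tau>. conv_power (solution \<tau>) q) t j"
    unfolding iterate.simps duhamel_def by (intro tendsto_intros)
qed

section \<open>Propagation of high regularity\<close>

text \<open>Here the gained derivative is spent: the square of \<open>1 / japanese j\<close> lowers
  the weight of order \<open>\<sigma> + 1\<close> to order \<open>\<sigma>\<close> on the source.
  Finite sets of frequencies make the exchange of sum and time integral elementary, and integrating
  the exponential yields the factor \<open>1 / \<mu>\<close>.\<close>

lemma
  assumes h: "weighted_l2 (\<sigma> + 1) h" and F: "\<And>j. continuous_on {0..T} (\<lambda>\<tau>. F \<tau> j)" and t: "t \<in> {0..T}"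
    and bound: "\<And>\<tau>. \<tau> \<in> {0..T} \<Longrightarrow> weighted_l2 \<sigma> (F \<tau>) \<and> energy \<sigma> (F \<tau>) \<le> Y * exp (\<mu> * \<tau>)" and \<mu>: "0 < \<mu>"
  shows weighted_l2_flow_bound: "weighted_l2 (\<sigma> + 1) (flow_bound F t)"
    and energy_flow_bound: "energy (\<sigma> + 1) (flow_bound F t)
      \<le> 2 * K\<^sup>2 * energy (\<sigma> + 1) h + 2 * K\<^sup>2 * T * Y * exp (\<mu> * t) / \<mu>"
proof -
  have Ft: "continuous_on {0..t} (\<lambda>\<tau>. F \<tau> j)" for j by (rule continuous_on_subset[OF F]) (use t in auto)
  have Y: "0 \<le> Y" using order_trans[OF energy_nonneg conjunct2[OF bound[of 0]]] T_pos by simp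
  let ?w = "\<lambda>j :: int ^ 'n. japanese j powr (2 * \<sigma>)" and ?I = "\<lambda>j. integral {0..t} (\<lambda>\<tau>. norm (F \<tau> j))"
  have w: "japanese j powr (2 * (\<sigma> + 1)) = ?w j * (japanese j)\<^sup>2" for j :: "int ^ 'n"
    using japanese_pos[of j] powr_add[of "japanese j" "2 * \<sigma>" 2] by (simp add: algebra_simps)
  have "(\<Sum>j\<in>J. japanese j powr (2 * (\<sigma> + 1)) * (norm (flow_bound F t j))\<^sup>2)
      \<le> 2 * K\<^sup>2 * energy (\<sigma> + 1) h + 2 * K\<^sup>2 * T * Y * exp (\<mu> * t) / \<mu>" if J: "finite J" for J
  proof -
    have I: "(\<Sum>j\<in>J. ?w j * (?I j)\<^sup>2) \<le> T * Y * exp (\<mu> * t) / \<mu>"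
    proof -
      have "(\<Sum>j\<in>J. ?w j * (?I j)\<^sup>2) \<le> (\<Sum>j\<in>J. ?w j * (t * integral {0..t} (\<lambda>\<tau>. (norm (F \<tau> j))\<^sup>2)))"
        using t by (intro sum_mono mult_left_mono integral_squared_le continuous_intros Ft) auto
      also have "\<dots> = t * integral {0..t} (\<lambda>\<tau>. \<Sum>j\<in>J. ?w j * (norm (F \<tau> j))\<^sup>2)"
        by (subst integral_sum[OF J])
          (auto intro!: integrable_continuous_real continuous_intros Ft simp: sum_distrib_left mult_ac)
      also have "integral {0..t} (\<lambda>\<tau>. \<Sum>j\<in>J. ?w j * (norm (F \<tau> j))\<^sup>2) \<le> integral {0..t} (\<lambda>\<tau>. Y * exp (\<mu> * \<tau>))"
      proof (rule integral_le)
        fix \<tau> assume "\<tau> \<in> {0..t}"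
        with t have "\<tau> \<in> {0..T}" by simp
        from bound[OF this] show "(\<Sum>j\<in>J. ?w j * (norm (F \<tau> j))\<^sup>2) \<le> Y * exp (\<mu> * \<tau>)"
          using sum_le_energy[OF _ J, of \<sigma> "F \<tau>"] by linarith
      qed (intro integrable_continuous_real continuous_intros Ft)+
      also have "integral {0..t} (\<lambda>\<tau>. Y * exp (\<mu> * \<tau>)) = Y * exp (\<mu> * t) / \<mu> - Y * exp (\<mu> * 0) / \<mu>"
      proof (rule integral_unique[OF fundamental_theorem_of_calculus])
        show "((\<lambda>\<tau>. Y * exp (\<mu> * \<tau>) / \<mu>) has_vector_derivative Y * exp (\<mu> * x)) (at x within {0..t})" for x
          unfolding has_real_derivative_iff_has_vector_derivative[symmetric] using \<mu>
          by (auto intro!: derivative_eq_intros)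
      qed (use t in auto)
      also have "t * \<dots> \<le> T * (Y * exp (\<mu> * t) / \<mu>)"
        using t Y \<mu> by (intro mult_mono) (auto intro!: divide_right_mono simp: mult_le_cancel_left1)
      finally show ?thesis using t by (simp add: mult_left_mono mult.assoc)
    qed
    have "(\<Sum>j\<in>J. japanese j powr (2 * (\<sigma> + 1)) * (norm (flow_bound F t j))\<^sup>2)
      \<le> (\<Sum>j\<in>J. 2 * K\<^sup>2 * (japanese j powr (2 * (\<sigma> + 1)) * (norm (h j))\<^sup>2) + 2 * K\<^sup>2 * (?w j * (?I j)\<^sup>2))"
    proof (rule sum_mono)
      fix j
      have "(norm (h j + ?I j / japanese j))\<^sup>2 \<le> 2 * (norm (h j))\<^sup>2 + 2 * (norm (?I j / japanese j))\<^sup>2"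
        by (rule norm_add_squared_le)
      then have "japanese j powr (2 * (\<sigma> + 1)) * K\<^sup>2 * (norm (h j + ?I j / japanese j))\<^sup>2
        \<le> japanese j powr (2 * (\<sigma> + 1)) * K\<^sup>2 * (2 * (norm (h j))\<^sup>2 + 2 * (norm (?I j / japanese j))\<^sup>2)"
        by (intro mult_left_mono) auto
      moreover have "(norm (flow_bound F t j))\<^sup>2 = K\<^sup>2 * (norm (h j + ?I j / japanese j))\<^sup>2"
        by (simp add: flow_bound_def power_mult_distrib)
      moreover have "japanese j powr (2 * (\<sigma> + 1)) * (norm (?I j / japanese j))\<^sup>2 = ?w j * (?I j)\<^sup>2"
        unfolding w using japanese_pos[of j] by (simp add: power_divide)
      ultimately show "japanese j powr (2 * (\<sigma> + 1)) * (norm (flow_bound F t j))\<^sup>2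
        \<le> 2 * K\<^sup>2 * (japanese j powr (2 * (\<sigma> + 1)) * (norm (h j))\<^sup>2) + 2 * K\<^sup>2 * (?w j * (?I j)\<^sup>2)"
        by (simp add: algebra_simps)
    qed
    also have "\<dots> = 2 * K\<^sup>2 * (\<Sum>j\<in>J. japanese j powr (2 * (\<sigma> + 1)) * (norm (h j))\<^sup>2) + 2 * K\<^sup>2 * (\<Sum>j\<in>J. ?w j * (?I j)\<^sup>2)"
      by (simp add: sum.distrib sum_distrib_left)
    also have "\<dots> \<le> 2 * K\<^sup>2 * energy (\<sigma> + 1) h + 2 * K\<^sup>2 * (T * Y * exp (\<mu> * t) / \<mu>)"
      by (intro add_mono mult_left_mono sum_le_energy h J I) auto
    finally show ?thesis by (simp add: mult.assoc)
  qed
  from weighted_l2I[OF this] show "weighted_l2 (\<sigma> + 1) (flow_bound F t)"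
    "energy (\<sigma> + 1) (flow_bound F t)
      \<le> 2 * K\<^sup>2 * energy (\<sigma> + 1) h + 2 * K\<^sup>2 * T * Y * exp (\<mu> * t) / \<mu>" by blast+
qed

text \<open>Gronwall's argument in the form of an exponentially growing bound that each iteration preserves.\<close>

lemma
  assumes h: "weighted_l2 (\<sigma> + 1) h" and \<sigma>: "0 \<le> \<sigma>" and u: "\<And>j. continuous_on {0..T} (\<lambda>\<tau>. conv_power (u \<tau>) q j)"
    and abs: "\<And>\<tau>. \<tau> \<in> {0..T} \<Longrightarrow> abs_summable (u \<tau>) \<and> wiener_norm (u \<tau>) \<le> R"
    and \<mu>_def: "\<mu> = 4 * K\<^sup>2 * T * tame_const \<sigma> q * R ^ (2 * q)"
    and bound: "\<And>\<tau>. \<tau> \<in> {0..T} \<Longrightarrow>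
      weighted_l2 (\<sigma> + 1) (u \<tau>) \<and> energy (\<sigma> + 1) (u \<tau>) \<le> 4 * K\<^sup>2 * energy (\<sigma> + 1) h * exp (\<mu> * \<tau>)"
    and t: "t \<in> {0..T}"
  shows weighted_l2_flow_bound_step: "weighted_l2 (\<sigma> + 1) (flow_bound (\<lambda>\<tau>. conv_power (u \<tau>) q) t)"
    and energy_flow_bound_step: "energy (\<sigma> + 1) (flow_bound (\<lambda>\<tau>. conv_power (u \<tau>) q) t)
      \<le> 4 * K\<^sup>2 * energy (\<sigma> + 1) h * exp (\<mu> * t)"
proof -
  let ?E = "energy (\<sigma> + 1) h" and ?G = "tame_const \<sigma> q * R ^ (2 * q)"
  have G: "0 < ?G" using tame_const_pos R_pos by simp
  have \<mu>: "0 < \<mu>" unfolding \<mu>_def using K_pos T_pos tame_const_pos[of \<sigma> q] R_pos by simp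
  have 1: "weighted_l2 \<sigma> (conv_power (u \<tau>) q) \<and>
    energy \<sigma> (conv_power (u \<tau>) q) \<le> (?G * (4 * K\<^sup>2 * ?E)) * exp (\<mu> * \<tau>)" if \<tau>: "\<tau> \<in> {0..T}" for \<tau>
  proof -
    have l2: "weighted_l2 \<sigma> (u \<tau>)" "energy \<sigma> (u \<tau>) \<le> energy (\<sigma> + 1) (u \<tau>)"
      using bound[OF \<tau>] weighted_l2_antimono[of "\<sigma> + 1" "u \<tau>" \<sigma>] energy_antimono[of "\<sigma> + 1" "u \<tau>" \<sigma>] by auto
    have "energy \<sigma> (conv_power (u \<tau>) q) \<le> ?G * energy \<sigma> (u \<tau>)"
      using energy_conv_power[OF _ l2(1) _ \<sigma>] abs[OF \<tau>] by simp
    also have "\<dots> \<le> ?G * (4 * K\<^sup>2 * ?E * exp (\<mu> * \<tau>))"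
      using bound[OF \<tau>] l2 G by (intro mult_left_mono) auto
    finally show ?thesis
      using weighted_l2_conv_power[OF conjunct1[OF abs[OF \<tau>]] l2(1) conjunct2[OF abs[OF \<tau>]] \<sigma>] by (simp add: mult.assoc)
  qed
  show "weighted_l2 (\<sigma> + 1) (flow_bound (\<lambda>\<tau>. conv_power (u \<tau>) q) t)"
    by (rule weighted_l2_flow_bound[OF h u t 1 \<mu>])
  have "energy (\<sigma> + 1) (flow_bound (\<lambda>\<tau>. conv_power (u \<tau>) q) t)
      \<le> 2 * K\<^sup>2 * ?E + 2 * K\<^sup>2 * T * (?G * (4 * K\<^sup>2 * ?E)) * exp (\<mu> * t) / \<mu>"
    by (rule energy_flow_bound[OF h u t 1 \<mu>])
  \<comment> \<open>\<open>\<mu>\<close> is chosen for this line: the \<open>1 / \<mu>\<close> from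
    the time integral cancels the tame constant, so the source contributes no more than half of the
    bound \<open>4 * K\<^sup>2 * ?E * exp (\<mu> * t)\<close> and the data the other half.\<close>
  also have "2 * K\<^sup>2 * T * (?G * (4 * K\<^sup>2 * ?E)) * exp (\<mu> * t) / \<mu> = 2 * K\<^sup>2 * ?E * exp (\<mu> * t)"
  proof -
    have eq: "2 * K\<^sup>2 * T * (?G * (4 * K\<^sup>2 * ?E)) * exp (\<mu> * t) = \<mu> * (2 * K\<^sup>2 * ?E * exp (\<mu> * t))"
      unfolding \<mu>_def by (simp add: mult_ac)
    show ?thesis unfolding eq using \<mu> by simp
  qed
  finally have "energy (\<sigma> + 1) (flow_bound (\<lambda>\<tau>. conv_power (u \<tau>) q) t)
      \<le> 2 * K\<^sup>2 * ?E + 2 * K\<^sup>2 * ?E * exp (\<mu> * t)" .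
  moreover have "2 * K\<^sup>2 * ?E \<le> 2 * K\<^sup>2 * ?E * exp (\<mu> * t)"
    using t \<mu> energy_nonneg[of "\<sigma> + 1" h] by (intro mult_le_cancel_left1[THEN iffD2]) (auto simp: mult_less_0_iff)
  ultimately show "energy (\<sigma> + 1) (flow_bound (\<lambda>\<tau>. conv_power (u \<tau>) q) t)
      \<le> 4 * K\<^sup>2 * ?E * exp (\<mu> * t)" by simp
qed

text \<open>An energy bound at each time is not yet a majorant. The bound is proved for the iterates
  and inherited by the limit on finite sets of frequencies; one further application of Duhamel's
  formula, evaluated at the final time \<open>T\<close>, then gives a single family dominating
  position and velocity on the whole interval.\<close>

lemma solution_bound:
  assumes h: "weighted_l2 (\<sigma> + 1) h" and \<sigma>: "0 \<le> \<sigma>"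
  obtains b where "weighted_l2 (\<sigma> + 1) b" "energy (\<sigma> + 1) b \<le> 4 * K\<^sup>2 * exp (tame_const \<sigma> q) * energy (\<sigma> + 1) h"
    "\<And>t j. t \<in> {0..T} \<Longrightarrow> norm (solution t j) \<le> b j"
    "\<And>t j. t \<in> {0..T} \<Longrightarrow> norm (flow_deriv (\<lambda>\<tau>. conv_power (solution \<tau>) q) t j) \<le> japanese j * b j"
proof -
  define \<mu> where "\<mu> = 4 * K\<^sup>2 * T * tame_const \<sigma> q * R ^ (2 * q)"
  let ?E = "energy (\<sigma> + 1) h"
  have iter: "weighted_l2 (\<sigma> + 1) (iterate n t) \<and> energy (\<sigma> + 1) (iterate n t) \<le> 4 * K\<^sup>2 * ?E * exp (\<mu> * t)"
    if "t \<in> {0..T}" for n t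
    using that
  proof (induction n arbitrary: t)
    case 0
    then show ?case using energy_nonneg[of "\<sigma> + 1" h] by (simp add: weighted_l2_def energy_def)
  next
    case (Suc n)
    let ?b = "flow_bound (\<lambda>\<tau>. conv_power (iterate n \<tau>) q) t"
    have abs: "abs_summable (iterate n \<tau>) \<and> wiener_norm (iterate n \<tau>) \<le> R" if "\<tau> \<in> {0..T}" for \<tau>
    proof
      show "abs_summable (iterate n \<tau>)"
        by (rule abs_summable_dominated[OF majorant_summable norm_iterate_le[OF that]])
      have "wiener_norm (iterate n \<tau>) \<le> infsum (majorant n) UNIV"
        by (rule wiener_norm_mono[OF majorant_summable norm_iterate_le[OF that]])
      also have "\<dots> = wiener_norm (majorant n)" by (simp add: wiener_norm_def majorant_nonneg)
      finally show "wiener_norm (iterate n \<tau>) \<le> R" using majorant_le_R[of n] by simp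
    qed
    note step = h \<sigma> continuous_on_iterate_power abs \<mu>_def Suc.IH Suc.prems
    have le: "norm (iterate (Suc n) t j) \<le> norm (?b j)" for j
      using norm_flow_le[of "\<lambda>\<tau>. conv_power (iterate n \<tau>) q" j t, OF continuous_on_iterate_power Suc.prems] by simp
    have b: "weighted_l2 (\<sigma> + 1) ?b" "energy (\<sigma> + 1) ?b \<le> 4 * K\<^sup>2 * ?E * exp (\<mu> * t)"
      by (rule weighted_l2_flow_bound_step[OF step], assumption+, rule energy_flow_bound_step[OF step])
    show ?case using weighted_l2_mono[OF b(1) le] energy_mono[OF b(1) le] b(2) by linarith
  qed
  have sol: "weighted_l2 (\<sigma> + 1) (solution t) \<and> energy (\<sigma> + 1) (solution t) \<le> 4 * K\<^sup>2 * ?E * exp (\<mu> * t)"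
    if t: "t \<in> {0..T}" for t
  proof -
    have "(\<Sum>j\<in>J. japanese j powr (2 * (\<sigma> + 1)) * (norm (solution t j))\<^sup>2) \<le> 4 * K\<^sup>2 * ?E * exp (\<mu> * t)" if J: "finite J" for J
    proof (rule tendsto_upperbound)
      show "(\<lambda>n. \<Sum>j\<in>J. japanese j powr (2 * (\<sigma> + 1)) * (norm (iterate n t j))\<^sup>2)
          \<longlonglongrightarrow> (\<Sum>j\<in>J. japanese j powr (2 * (\<sigma> + 1)) * (norm (solution t j))\<^sup>2)"
        by (intro tendsto_intros iterate_tendsto t)
      show "\<forall>\<^sub>F n in sequentially. (\<Sum>j\<in>J. japanese j powr (2 * (\<sigma> + 1)) * (norm (iterate n t j))\<^sup>2) \<le> 4 * K\<^sup>2 * ?E * exp (\<mu> * t)"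
        using iter[OF t] sum_le_energy[OF _ J] order_trans by (blast intro: always_eventually)
    qed simp
    from weighted_l2I[OF this] show ?thesis by blast
  qed
  have T: "T \<in> {0..T}" using T_pos by simp
  let ?F = "\<lambda>\<tau>. conv_power (solution \<tau>) q"
  let ?b = "flow_bound ?F T"
  have abs: "abs_summable (solution \<tau>) \<and> wiener_norm (solution \<tau>) \<le> R" if "\<tau> \<in> {0..T}" for \<tau>
    using solution_abs_summable solution_wiener_norm that by blast
  note step = h \<sigma> continuous_on_solution_power abs \<mu>_def sol T
  show ?thesis
  proof (rule that)
    show "weighted_l2 (\<sigma> + 1) ?b" by (rule weighted_l2_flow_bound_step[OF step])
    have "energy (\<sigma> + 1) ?b \<le> 4 * K\<^sup>2 * ?E * exp (\<mu> * T)" by (rule energy_flow_bound_step[OF step])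
    also have "\<dots> \<le> 4 * K\<^sup>2 * ?E * exp (tame_const \<sigma> q)"
    proof -
      \<comment> \<open>Gronwall's exponent: \<open>T_small\<close> bounds the squared bracket by
        \<open>1\<close>, so only \<open>\<sigma>\<close> and \<open>q\<close> remain.\<close>
      have "\<mu> * T = tame_const \<sigma> q * (2 * (K * T * R ^ q))\<^sup>2"
        by (simp add: \<mu>_def power_even_eq power2_eq_square)
      also have "\<dots> \<le> tame_const \<sigma> q * 1"
        using T_small K_pos T_pos R_pos tame_const_pos[of \<sigma> q] by (intro mult_left_mono power_le_one) auto
      finally show ?thesis using energy_nonneg[of "\<sigma> + 1" h] by (intro mult_left_mono) auto
    qed
    finally show "energy (\<sigma> + 1) ?b \<le> 4 * K\<^sup>2 * exp (tame_const \<sigma> q) * ?E" by (simp add: mult_ac)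
    fix t j assume t: "t \<in> {0..T}"
    have le: "flow_bound ?F t j \<le> ?b j"
      using t by (intro flow_bound_mono continuous_on_solution_power) auto
    show "norm (solution t j) \<le> ?b j"
      using norm_flow_le[of ?F j t, OF continuous_on_solution_power t] le by (simp add: solution_fixed_point[OF t])
    have "norm (flow_deriv ?F t j) \<le> japanese j * flow_bound ?F t j"
      by (rule norm_flow_deriv_le[of ?F j t, OF continuous_on_solution_power t])
    also have "\<dots> \<le> japanese j * ?b j" by (intro mult_left_mono le japanese_nonneg)
    finally show "norm (flow_deriv ?F t j) \<le> japanese j * ?b j" .
  qed
qed

end

section \<open>Mild formulation and uniqueness\<close>

lemma weighted_l2_japanese_mult:
  assumes "weighted_l2 (\<sigma> + 1) b"
  shows "weighted_l2 \<sigma> (\<lambda>j. japanese j * b j)" "energy \<sigma> (\<lambda>j. japanese j * b j) \<le> energy (\<sigma> + 1) b"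
proof -
  have "japanese j powr (2 * \<sigma>) * (norm (japanese j * b j))\<^sup>2 \<le> japanese j powr (2 * (\<sigma> + 1)) * (norm (b j))\<^sup>2" for j
    using japanese_pos[of j] powr_add[of "japanese j" "2 * \<sigma>" 2] by (simp add: power_mult_distrib algebra_simps)
  from weighted_l2_comparison[OF assms this] energy_comparison[OF assms this]
  show "weighted_l2 \<sigma> (\<lambda>j. japanese j * b j)" "energy \<sigma> (\<lambda>j. japanese j * b j) \<le> energy (\<sigma> + 1) b" .
qed

context klein_gordon_iteration
begin

text \<open>Position, velocity and acceleration are dominated by \<open>b\<close>, by
  \<open>b\<close> with one extra weight, and by \<open>b\<close> with two extra weights plus its
  convolution power. These families have exactly the orders that \<open>KG_solution\<close> asks
  for, so coefficientwise statements suffice.\<close>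

lemma solution_KG:
  assumes \<omega>: "\<And>j. (\<omega> j)\<^sup>2 = (norm (freq j))\<^sup>2 + m"
    and s: "s + 1 / 2 > real CARD('n) / 2" "s \<ge> 1 / 2"
    and b: "weighted_l2 (s + 1 / 2) b" "\<And>t j. t \<in> {0..T} \<Longrightarrow> norm (solution t j) \<le> b j"
      "\<And>t j. t \<in> {0..T} \<Longrightarrow> norm (flow_deriv (\<lambda>\<tau>. conv_power (solution \<tau>) q) t j) \<le> japanese j * b j"
  shows "KG_solution q m s T \<psi>\<^sub>0 \<phi>\<^sub>0 solution (flow_deriv (\<lambda>\<tau>. conv_power (solution \<tau>) q))"
proof -
  let ?F = "\<lambda>\<tau>. conv_power (solution \<tau>) q"
  note F = continuous_on_solution_power
  have deriv: "((\<lambda>t. solution t j) has_vector_derivative flow_deriv ?F t j) (at t within {0..T})" if t: "t \<in> {0..T}" for t j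
    by (rule has_vector_derivative_transform[OF t _ has_vector_derivative_duhamel[OF F omega_pos t]])
      (rule solution_fixed_point)
  have eq: "laplacian (solution t) j - of_real m * solution t j - torus_power (solution t) (q + 1) j
      = - ((\<omega> j)\<^sup>2) *\<^sub>R solution t j - ?F t j" if t: "t \<in> {0..T}" for t j
    unfolding torus_power_eq_conv_power[OF solution_abs_summable[OF t]] laplacian_def \<omega>
    by (simp add: scaleR_conv_of_real algebra_simps)
  have deriv2: "((\<lambda>t. flow_deriv ?F t j) has_vector_derivative
      laplacian (solution t) j - of_real m * solution t j - torus_power (solution t) (q + 1) j) (at t within {0..T})"
    if t: "t \<in> {0..T}" for t j
    using has_vector_derivative_duhamel_deriv[OF F[of j] omega_pos[of j] t, of "\<psi>\<^sub>0 j" "\<phi>\<^sub>0 j"]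
    unfolding eq[OF t] solution_fixed_point[OF t, of j, symmetric] .
  have shift: "s - 1 / 2 + 1 = s + 1 / 2" "s - 3 / 2 + 1 = s - 1 / 2" by simp_all
  have b1: "weighted_l2 (s - 1 / 2) (\<lambda>j. japanese j * b j)"
    using weighted_l2_japanese_mult(1)[of "s - 1 / 2" b] b(1) shift by metis
  have b2: "weighted_l2 (s - 3 / 2) (\<lambda>j. japanese j * (japanese j * b j))"
    using weighted_l2_japanese_mult(1)[of "s - 3 / 2" "\<lambda>j. japanese j * b j"] b1 shift by metis
  have b_summable: "abs_summable b" by (rule abs_summable_weighted_l2[OF b(1) s(1)])
  \<comment> \<open>The tame estimate asks for a nonnegative exponent and \<open>s - 3 / 2\<close>
    may be negative; the power is therefore estimated at \<open>s - 1 / 2\<close> and then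
    weakened.\<close>
  have power: "weighted_l2 (s - 3 / 2) (conv_power b q)"
  proof (rule weighted_l2_antimono)
    show "weighted_l2 (s - 1 / 2) (conv_power b q)"
      by (rule weighted_l2_conv_power[OF b_summable weighted_l2_antimono[OF b(1)] order_refl]) (use s in auto)
  qed simp
  have b3: "weighted_l2 (s - 3 / 2) (\<lambda>j. K\<^sup>2 *\<^sub>R (japanese j * (japanese j * b j)) + conv_power b q j)"
    by (intro weighted_l2_add weighted_l2_scaleR b2 power)
  have bound3: "norm (laplacian (solution t) j - of_real m * solution t j - torus_power (solution t) (q + 1) j)
      \<le> K\<^sup>2 *\<^sub>R (japanese j * (japanese j * b j)) + conv_power b q j" if t: "t \<in> {0..T}" for t j
  proof -
    have "norm (- ((\<omega> j)\<^sup>2) *\<^sub>R solution t j - ?F t j) \<le> (\<omega> j)\<^sup>2 * norm (solution t j) + norm (?F t j)"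
      using norm_triangle_ineq4[of "- ((\<omega> j)\<^sup>2) *\<^sub>R solution t j" "?F t j"] by simp
    also have "\<dots> \<le> (K * japanese j)\<^sup>2 * b j + conv_power b q j"
      using omega_le[of j] omega_pos[of j]
      by (intro add_mono mult_mono power_mono b norm_conv_power_le abs_summable_realD[OF b_summable] t) auto
    finally show ?thesis unfolding eq[OF t] by (simp add: power2_eq_square mult_ac)
  qed
  show ?thesis
    unfolding KG_solution_def
  proof (intro conjI)
    show "sobolev_continuous_on (s + 1 / 2) {0..T} solution"
      by (rule sobolev_continuous_onI[OF b(1,2) continuous_on_solution])
    show "has_sobolev_derivative_on (s - 1 / 2) {0..T} solution (flow_deriv ?F)"
      by (rule has_sobolev_derivative_onI[OF weighted_l2_antimono[OF b(1)] b1 b(2,3) deriv]) auto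
    show "sobolev_continuous_on (s - 1 / 2) {0..T} (flow_deriv ?F)"
    proof (rule sobolev_continuous_onI[OF b1 b(3)])
      show "continuous_on {0..T} (\<lambda>t. flow_deriv ?F t j)" for j
        using deriv2 by (meson continuous_on_eq_continuous_within has_vector_derivative_continuous)
    qed
    show "has_sobolev_derivative_on (s - 3 / 2) {0..T} (flow_deriv ?F)
        (\<lambda>t j. laplacian (solution t) j - of_real m * solution t j - torus_power (solution t) (q + 1) j)"
      by (rule has_sobolev_derivative_onI[OF weighted_l2_antimono[OF b1] b3 b(3) bound3 deriv2]) auto
    show "solution 0 = \<psi>\<^sub>0"
      using solution_fixed_point[of 0] T_pos by (simp add: fun_eq_iff duhamel_0)
    show "flow_deriv ?F 0 = \<phi>\<^sub>0" by (simp add: duhamel_0)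
  qed
qed

end

text \<open>Nothing makes \<open>T\<close> small compared with \<open>R\<close>, so the difference
  is compared with \<open>exp (\<mu> * t)\<close>. For this \<open>\<mu>\<close> each passage
  through Duhamel's formula halves the constant in front, which forces the difference to
  vanish.\<close>

lemma duhamel_system_unique:
  fixes u v :: "real \<Rightarrow> 'n::finite fourier"
  assumes u: "\<And>t. t \<in> {0..T} \<Longrightarrow> abs_summable (u t)" "\<And>t. t \<in> {0..T} \<Longrightarrow> wiener_norm (u t) \<le> R"
      "\<And>j. continuous_on {0..T} (\<lambda>t. conv_power (u t) q j)"
      "\<And>t j. t \<in> {0..T} \<Longrightarrow> u t j = duhamel (\<omega> j) (a j) (b j) (\<lambda>\<tau>. conv_power (u \<tau>) q j) t"
    and v: "\<And>t. t \<in> {0..T} \<Longrightarrow> abs_summable (v t)" "\<And>t. t \<in> {0..T} \<Longrightarrow> wiener_norm (v t) \<le> R"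
      "\<And>j. continuous_on {0..T} (\<lambda>t. conv_power (v t) q j)"
      "\<And>t j. t \<in> {0..T} \<Longrightarrow> v t j = duhamel (\<omega> j) (a j) (b j) (\<lambda>\<tau>. conv_power (v \<tau>) q j) t"
    and \<omega>: "\<And>j. 0 < \<omega> j" "\<And>j. 1 / \<omega> j \<le> K" and t: "t \<in> {0..T}"
  shows "u t = v t"
proof -
  let ?D = "\<lambda>t. wiener_norm (\<lambda>j. u t j - v t j)" and ?L = "real (Suc q) * R ^ q"
  have R: "0 \<le> R" using order_trans[OF wiener_norm_nonneg u(2)[OF t]] .
  have K: "0 < K" using \<omega>[of 0] by (meson divide_pos_pos less_le_trans zero_less_one)
  \<comment> \<open>The summand \<open>1\<close> keeps \<open>\<mu>\<close> positive when
    \<open>?L\<close> vanishes.\<close>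
  define \<mu> where "\<mu> = 2 * K * ?L + 1"
  have \<mu>: "0 < \<mu>" "K * ?L / \<mu> \<le> 1 / 2"
    using K R by (simp_all add: \<mu>_def divide_le_eq add_nonneg_pos)
  have D: "?D t \<le> 2 * R * (1 / 2) ^ n * exp (\<mu> * t)" if "t \<in> {0..T}" for n t
    using that
  proof (induction n arbitrary: t)
    case 0
    have "?D t \<le> infsum (\<lambda>j. norm (u t j) + norm (v t j)) UNIV"
      by (rule wiener_norm_mono[OF summable_on_add[OF u(1) v(1)]]) (use 0 in \<open>auto intro: norm_triangle_ineq4\<close>)
    also have "\<dots> = wiener_norm (u t) + wiener_norm (v t)"
      unfolding wiener_norm_def by (rule infsum_add[OF u(1) v(1)]) (use 0 in auto)
    also have "\<dots> \<le> 2 * R * 1" using u(2)[OF 0] v(2)[OF 0] by simp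
    also have "\<dots> \<le> 2 * R * exp (\<mu> * t)" using 0 \<mu> R by (intro mult_left_mono) auto
    finally show ?case by simp
  next
    case (Suc n)
    let ?F = "\<lambda>j \<tau>. conv_power (u \<tau>) q j - conv_power (v \<tau>) q j" and ?c = "2 * R * (1 / 2) ^ n"
    have cont: "continuous_on {0..t} (\<lambda>t. conv_power (u t) q j)" "continuous_on {0..t} (\<lambda>t. conv_power (v t) q j)" for j
      using Suc.prems by (auto intro: continuous_on_subset[OF u(3)] continuous_on_subset[OF v(3)])
    have "(\<Sum>j\<in>J. norm (u t j - v t j)) \<le> 2 * R * (1 / 2) ^ Suc n * exp (\<mu> * t)" if J: "finite J" for J
    proof -
      have "(\<Sum>j\<in>J. norm (u t j - v t j)) \<le> (\<Sum>j\<in>J. K * integral {0..t} (\<lambda>\<tau>. norm (?F j \<tau>)))"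
      proof (rule sum_mono)
        fix j
        have "norm (u t j - v t j) \<le> (1 / \<omega> j) * integral {0..t} (\<lambda>\<tau>. norm (?F j \<tau>))"
          unfolding u(4)[OF Suc.prems] v(4)[OF Suc.prems] by (rule norm_duhamel_diff_le[OF cont \<omega>(1)])
        also have "\<dots> \<le> K * integral {0..t} (\<lambda>\<tau>. norm (?F j \<tau>))"
          by (intro mult_right_mono \<omega> integral_nonneg integrable_continuous_real continuous_intros cont) auto
        finally show "norm (u t j - v t j) \<le> K * integral {0..t} (\<lambda>\<tau>. norm (?F j \<tau>))" .
      qed
      also have "\<dots> = K * integral {0..t} (\<lambda>\<tau>. \<Sum>j\<in>J. norm (?F j \<tau>))"
        by (subst integral_sum[OF J]) (auto intro!: integrable_continuous_real continuous_intros cont simp: sum_distrib_left)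
      also have "integral {0..t} (\<lambda>\<tau>. \<Sum>j\<in>J. norm (?F j \<tau>)) \<le> integral {0..t} (\<lambda>\<tau>. ?L * ?c * exp (\<mu> * \<tau>))"
      proof (rule integral_le)
        fix \<tau> assume "\<tau> \<in> {0..t}"
        then have \<tau>: "\<tau> \<in> {0..T}" using Suc.prems by simp
        have s: "abs_summable (\<lambda>j. ?F j \<tau>)"
          by (intro abs_summable_diff abs_summable_conv_power u(1) v(1) \<tau>)
        have "(\<Sum>j\<in>J. norm (?F j \<tau>)) \<le> wiener_norm (\<lambda>j. ?F j \<tau>)"
          unfolding wiener_norm_def by (rule finite_sum_le_infsum[OF s J]) auto
        also have "\<dots> \<le> ?L * ?D \<tau>"
          by (rule wiener_norm_conv_power_diff) (use u(1,2) v(1,2) \<tau> in auto)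
        also have "\<dots> \<le> ?L * (?c * exp (\<mu> * \<tau>))"
          using R by (intro mult_left_mono Suc.IH \<tau>) auto
        finally show "(\<Sum>j\<in>J. norm (?F j \<tau>)) \<le> ?L * ?c * exp (\<mu> * \<tau>)" by (simp add: mult.assoc)
      qed (intro integrable_continuous_real continuous_intros cont)+
      also have "\<dots> = ?L * ?c * exp (\<mu> * t) / \<mu> - ?L * ?c * exp (\<mu> * 0) / \<mu>"
      proof (rule integral_unique[OF fundamental_theorem_of_calculus])
        show "((\<lambda>\<tau>. ?L * ?c * exp (\<mu> * \<tau>) / \<mu>) has_vector_derivative ?L * ?c * exp (\<mu> * x)) (at x within {0..t})" for x
          unfolding has_real_derivative_iff_has_vector_derivative[symmetric] using \<mu>
          by (auto intro!: derivative_eq_intros)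
      qed (use Suc.prems in auto)
      also have "\<dots> \<le> ?L * ?c * exp (\<mu> * t) / \<mu>" using R \<mu> by simp
      also have "K * \<dots> = (K * ?L / \<mu>) * (?c * exp (\<mu> * t))" by simp
      also have "\<dots> \<le> 1 / 2 * (?c * exp (\<mu> * t))" using R \<mu> by (intro mult_right_mono) auto
      finally show ?thesis using K by (simp add: mult_left_mono)
    qed
    then show ?case unfolding wiener_norm_def by (intro nonneg_summable_onI(2)) auto
  qed
  have "?D t \<le> 0"
  proof (rule tendsto_lowerbound)
    show "(\<lambda>n. 2 * R * (1 / 2) ^ n * exp (\<mu> * t)) \<longlonglongrightarrow> 0"
      by (intro tendsto_mult_left_zero tendsto_mult_right_zero LIMSEQ_power_zero) auto
  qed (use D[OF t] in auto)
  have "norm (u t j - v t j) \<le> ?D t" for j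
    by (rule norm_le_wiener_norm[OF abs_summable_diff[OF u(1)[OF t] v(1)[OF t]]])
  with \<open>?D t \<le> 0\<close> have "norm (u t j - v t j) \<le> 0" for j using order_trans by blast
  then show ?thesis by auto
qed

text \<open>An arbitrary solution comes without a size bound. Continuity into the Sobolev space,
  hence in the absolute-sum norm, supplies one on the compact interval, and uniqueness for each
  forced oscillator turns the equation into Duhamel's formula.\<close>

lemma KG_solution_mild:
  fixes \<psi>\<^sub>0 \<phi>\<^sub>0 :: "'n::finite fourier"
  assumes KG: "KG_solution q m s T \<psi>\<^sub>0 \<phi>\<^sub>0 \<eta> \<eta>\<^sub>t" and s: "s + 1 / 2 > real CARD('n) / 2"
    and \<omega>: "\<And>j. 0 < \<omega> j" "\<And>j :: int ^ 'n. (\<omega> j)\<^sup>2 = (norm (freq j))\<^sup>2 + m"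
  obtains R where "\<And>t. t \<in> {0..T} \<Longrightarrow> abs_summable (\<eta> t)" "\<And>t. t \<in> {0..T} \<Longrightarrow> wiener_norm (\<eta> t) \<le> R"
      "\<And>j. continuous_on {0..T} (\<lambda>t. conv_power (\<eta> t) q j)"
      "\<And>t j. t \<in> {0..T} \<Longrightarrow> \<eta> t j = duhamel (\<omega> j) (\<psi>\<^sub>0 j) (\<phi>\<^sub>0 j) (\<lambda>\<tau>. conv_power (\<eta> \<tau>) q j) t"
proof -
  have sob: "weighted_l2 (s + 1 / 2) (\<eta> t)" if "t \<in> {0..T}" for t
    using KG that by (simp add: KG_solution_def sobolev_continuous_on_def sobolev_iff)
  then have s1: "abs_summable (\<eta> t)" if "t \<in> {0..T}" for t
    using abs_summable_weighted_l2[OF _ s] that by blast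
  have lim: "((\<lambda>\<tau>. wiener_norm (\<lambda>j. \<eta> \<tau> j - \<eta> t j)) \<longlongrightarrow> 0) (at t within {0..T})" if t: "t \<in> {0..T}" for t
  proof (rule Lim_null_comparison)
    let ?S = "sqrt (\<Sum>\<^sub>\<infinity>j :: int ^ 'n. japanese j powr (- (2 * (s + 1 / 2))))"
    show "\<forall>\<^sub>F \<tau> in at t within {0..T}. norm (wiener_norm (\<lambda>j. \<eta> \<tau> j - \<eta> t j))
        \<le> ?S * sobolev_norm (s + 1 / 2) (\<lambda>j. \<eta> \<tau> j - \<eta> t j)"
      using eventually_in_at_within
    proof eventually_elim
      case (elim \<tau>)
      show ?case
        using wiener_norm_le_energy[OF weighted_l2_diff[OF sob[OF elim] sob[OF t]] s]
        by (simp add: wiener_norm_nonneg sobolev_norm_eq)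
    qed
    show "((\<lambda>\<tau>. ?S * sobolev_norm (s + 1 / 2) (\<lambda>j. \<eta> \<tau> j - \<eta> t j)) \<longlongrightarrow> 0) (at t within {0..T})"
      using KG t by (intro tendsto_mult_right_zero) (simp add: KG_solution_def sobolev_continuous_on_def)
  qed
  have "continuous_on {0..T} (\<lambda>t. wiener_norm (\<eta> t))"
    unfolding continuous_on
  proof
    fix t assume t: "t \<in> {0..T}"
    show "((\<lambda>t. wiener_norm (\<eta> t)) \<longlongrightarrow> wiener_norm (\<eta> t)) (at t within {0..T})"
      unfolding LIM_zero_iff[of _ "wiener_norm (\<eta> t)", symmetric]
    proof (rule Lim_null_comparison[OF _ lim[OF t]])
      show "\<forall>\<^sub>F \<tau> in at t within {0..T}. norm (wiener_norm (\<eta> \<tau>) - wiener_norm (\<eta> t)) \<le> wiener_norm (\<lambda>j. \<eta> \<tau> j - \<eta> t j)"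
        using eventually_in_at_within
      proof eventually_elim
        case (elim \<tau>)
        have "wiener_norm (\<lambda>j. \<eta> t j - \<eta> \<tau> j) = wiener_norm (\<lambda>j. \<eta> \<tau> j - \<eta> t j)"
          by (simp add: wiener_norm_def norm_minus_commute)
        then show ?case
          using wiener_norm_triangle[OF s1[OF elim] s1[OF t]] wiener_norm_triangle[OF s1[OF t] s1[OF elim]] by simp
      qed
    qed
  qed
  then have "bounded ((\<lambda>t. wiener_norm (\<eta> t)) ` {0..T})"
    by (intro compact_imp_bounded compact_continuous_image) auto
  then obtain R where "\<forall>x\<in>(\<lambda>t. wiener_norm (\<eta> t)) ` {0..T}. norm x \<le> R" unfolding bounded_iff by blast
  then have R: "wiener_norm (\<eta> t) \<le> R" if "t \<in> {0..T}" for t using that by force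
  have cont: "continuous_on {0..T} (\<lambda>t. conv_power (\<eta> t) q j)" for j
    unfolding continuous_on
  proof
    fix t assume t: "t \<in> {0..T}"
    show "((\<lambda>t. conv_power (\<eta> t) q j) \<longlongrightarrow> conv_power (\<eta> t) q j) (at t within {0..T})"
      unfolding LIM_zero_iff[of _ "conv_power (\<eta> t) q j", symmetric]
    proof (rule Lim_null_comparison[OF _ tendsto_mult_right_zero[OF lim[OF t]]])
      show "\<forall>\<^sub>F \<tau> in at t within {0..T}. norm (conv_power (\<eta> \<tau>) q j - conv_power (\<eta> t) q j)
          \<le> (real (Suc q) * R ^ q) * wiener_norm (\<lambda>j. \<eta> \<tau> j - \<eta> t j)"
        using eventually_in_at_within
      proof eventually_elim
        case (elim \<tau>)
        have "norm (conv_power (\<eta> \<tau>) q j - conv_power (\<eta> t) q j)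
            \<le> wiener_norm (\<lambda>j. conv_power (\<eta> \<tau>) q j - conv_power (\<eta> t) q j)"
          by (intro norm_le_wiener_norm abs_summable_diff abs_summable_conv_power s1 t elim)
        also have "\<dots> \<le> (real (Suc q) * R ^ q) * wiener_norm (\<lambda>j. \<eta> \<tau> j - \<eta> t j)"
          by (intro wiener_norm_conv_power_diff s1 R t elim)
        finally show ?case .
      qed
    qed
  qed
  have "\<eta> t j = duhamel (\<omega> j) (\<psi>\<^sub>0 j) (\<phi>\<^sub>0 j) (\<lambda>\<tau>. conv_power (\<eta> \<tau>) q j) t" if t: "t \<in> {0..T}" for t j
  proof (rule duhamel_unique[OF _ _ _ _ cont \<omega>(1) t])
    fix t assume t: "t \<in> {0..T}"
    show "((\<lambda>t. \<eta> t j) has_vector_derivative \<eta>\<^sub>t t j) (at t within {0..T})"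
      using KG t by (auto simp: KG_solution_def intro: has_sobolev_derivative_on_coeff)
    have "((\<lambda>t. \<eta>\<^sub>t t j) has_vector_derivative
        laplacian (\<eta> t) j - of_real m * \<eta> t j - torus_power (\<eta> t) (q + 1) j) (at t within {0..T})"
      using KG t has_sobolev_derivative_on_coeff[of "s - 3 / 2" "{0..T}" "\<eta>\<^sub>t"
        "\<lambda>t j. laplacian (\<eta> t) j - of_real m * \<eta> t j - torus_power (\<eta> t) (q + 1) j"]
      unfolding KG_solution_def by blast
    moreover have "laplacian (\<eta> t) j - of_real m * \<eta> t j - torus_power (\<eta> t) (q + 1) j
        = - ((\<omega> j)\<^sup>2) *\<^sub>R \<eta> t j - conv_power (\<eta> t) q j"
      unfolding torus_power_eq_conv_power[OF s1[OF t]] laplacian_def \<omega>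
      by (simp add: scaleR_conv_of_real algebra_simps)
    ultimately show "((\<lambda>t. \<eta>\<^sub>t t j) has_vector_derivative - ((\<omega> j)\<^sup>2) *\<^sub>R \<eta> t j - conv_power (\<eta> t) q j) (at t within {0..T})"
      by simp
  qed (use KG in \<open>simp_all add: KG_solution_def\<close>)
  then show ?thesis using that s1 R cont by blast
qed

lemma KG_solution_unique:
  fixes \<psi>\<^sub>0 \<phi>\<^sub>0 :: "'n::finite fourier"
  assumes "KG_solution q m s T \<psi>\<^sub>0 \<phi>\<^sub>0 \<eta> \<eta>\<^sub>t" "KG_solution q m s T \<psi>\<^sub>0 \<phi>\<^sub>0 \<zeta> \<zeta>\<^sub>t"
    and s: "s + 1 / 2 > real CARD('n) / 2"
    and \<omega>: "\<And>j. 0 < \<omega> j" "\<And>j :: int ^ 'n. (\<omega> j)\<^sup>2 = (norm (freq j))\<^sup>2 + m" and K: "\<And>j. 1 / \<omega> j \<le> K"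
    and t: "t \<in> {0..T}"
  shows "\<eta> t = \<zeta> t"
proof -
  obtain R where \<eta>: "\<And>t. t \<in> {0..T} \<Longrightarrow> abs_summable (\<eta> t)" "\<And>t. t \<in> {0..T} \<Longrightarrow> wiener_norm (\<eta> t) \<le> R"
      "\<And>j. continuous_on {0..T} (\<lambda>t. conv_power (\<eta> t) q j)"
      "\<And>t j. t \<in> {0..T} \<Longrightarrow> \<eta> t j = duhamel (\<omega> j) (\<psi>\<^sub>0 j) (\<phi>\<^sub>0 j) (\<lambda>\<tau>. conv_power (\<eta> \<tau>) q j) t"
    using KG_solution_mild[OF assms(1) s \<omega>] by blast
  obtain R' where \<zeta>: "\<And>t. t \<in> {0..T} \<Longrightarrow> abs_summable (\<zeta> t)" "\<And>t. t \<in> {0..T} \<Longrightarrow> wiener_norm (\<zeta> t) \<le> R'"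
      "\<And>j. continuous_on {0..T} (\<lambda>t. conv_power (\<zeta> t) q j)"
      "\<And>t j. t \<in> {0..T} \<Longrightarrow> \<zeta> t j = duhamel (\<omega> j) (\<psi>\<^sub>0 j) (\<phi>\<^sub>0 j) (\<lambda>\<tau>. conv_power (\<zeta> \<tau>) q j) t"
    using KG_solution_mild[OF assms(2) s \<omega>] by blast
  have max: "wiener_norm (\<eta> t) \<le> max R R'" "wiener_norm (\<zeta> t) \<le> max R R'" if "t \<in> {0..T}" for t
    using \<eta>(2)[OF that] \<zeta>(2)[OF that] by linarith+
  show ?thesis
    by (rule duhamel_system_unique[OF \<eta>(1) max(1) \<eta>(3,4) \<zeta>(1) max(2) \<zeta>(3,4) \<omega>(1) K t])
qed

section \<open>Lifespan\<close>

text \<open>Frequencies are split at \<open>2\<close>, the base of \<open>(2 * M) powr s1\<close>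
  for \<open>M = 1\<close>. Below it the lowest norm is used at the price \<open>2 powr s1\<close>,
  above it the surplus \<open>s1 - s0\<close> of regularity; both cases yield the factor
  \<open>2 powr (s0 - s1)\<close>.\<close>

lemma powr_interpolation:
  fixes w :: real
  assumes w: "1 \<le> w" and s: "0 \<le> s0" "s0 \<le> s1"
  shows "w powr s0 \<le> 2 powr (s0 - s1) * (w powr s1 + 2 powr s1)"
proof (cases "w \<le> 2")
  case True
  have "w powr s0 \<le> 2 powr s0" using True w s by (intro powr_mono2) auto
  also have "\<dots> = 2 powr (s0 - s1) * 2 powr s1" by (simp flip: powr_add)
  also have "\<dots> \<le> 2 powr (s0 - s1) * (w powr s1 + 2 powr s1)" by (intro mult_left_mono) auto
  finally show ?thesis .
next
  case False
  have "w powr s0 = w powr (s0 - s1) * w powr s1" by (simp flip: powr_add)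
  also have "\<dots> \<le> 2 powr (s0 - s1) * w powr s1"
    using False s by (intro mult_right_mono powr_mono2') auto
  also have "\<dots> \<le> 2 powr (s0 - s1) * (w powr s1 + 2 powr s1)" by (intro mult_left_mono) auto
  finally show ?thesis .
qed

lemma
  fixes u v :: "'n::finite fourier"
  assumes u: "u \<in> sobolev (s + 1 / 2)" and v: "v \<in> sobolev (s - 1 / 2)"
  shows weighted_l2_data: "weighted_l2 (s + 1 / 2) (\<lambda>j. norm (u j) + norm (v j) / japanese j)"
    and energy_data: "energy (s + 1 / 2) (\<lambda>j. norm (u j) + norm (v j) / japanese j) \<le> 2 * (pair_norm s u v)\<^sup>2"
proof -
  have u': "weighted_l2 (s + 1 / 2) (\<lambda>j. norm (u j))" "energy (s + 1 / 2) (\<lambda>j. norm (u j)) = (sobolev_norm (s + 1 / 2) u)\<^sup>2"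
    using u by (simp_all add: sobolev_iff weighted_l2_def sobolev_norm_squared energy_def)
  have le: "japanese j powr (2 * (s + 1 / 2)) * (norm (norm (v j) / japanese j))\<^sup>2 \<le> japanese j powr (2 * (s - 1 / 2)) * (norm (v j))\<^sup>2" for j
  proof -
    have "japanese j powr (2 * (s + 1 / 2)) = japanese j powr (2 * (s - 1 / 2)) * (japanese j)\<^sup>2"
      using japanese_pos[of j] powr_add[of "japanese j" "2 * (s - 1 / 2)" 2] by (simp add: algebra_simps)
    then show ?thesis using japanese_pos[of j] by (simp add: power_divide)
  qed
  have v': "weighted_l2 (s + 1 / 2) (\<lambda>j. norm (v j) / japanese j)"
      "energy (s + 1 / 2) (\<lambda>j. norm (v j) / japanese j) \<le> (sobolev_norm (s - 1 / 2) v)\<^sup>2"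
    using weighted_l2_comparison[OF _ le] energy_comparison[OF _ le] v by (simp_all add: sobolev_iff sobolev_norm_squared)
  show "weighted_l2 (s + 1 / 2) (\<lambda>j. norm (u j) + norm (v j) / japanese j)"
    by (rule weighted_l2_add[OF u'(1) v'(1)])
  have "energy (s + 1 / 2) (\<lambda>j. norm (u j) + norm (v j) / japanese j)
      \<le> 2 * (sobolev_norm (s + 1 / 2) u)\<^sup>2 + 2 * (sobolev_norm (s - 1 / 2) v)\<^sup>2"
    using energy_add[OF u'(1) v'(1)] u'(2) v'(2) by linarith
  also have "\<dots> \<le> 2 * (pair_norm s u v)\<^sup>2"
    unfolding pair_norm_def power2_sum
    using mult_nonneg_nonneg[OF sobolev_norm_nonneg[of "s + 1 / 2" u] sobolev_norm_nonneg[of "s - 1 / 2" v]] by simp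
  finally show "energy (s + 1 / 2) (\<lambda>j. norm (u j) + norm (v j) / japanese j) \<le> 2 * (pair_norm s u v)\<^sup>2" .
qed

lemma pair_norm_nonneg: "0 \<le> pair_norm s u v"
  by (simp add: pair_norm_def sobolev_norm_nonneg)

text \<open>The smallness of the lowest norm is traded for the gain \<open>2 powr (s0 - s1)\<close>, which produces the long lifespan.\<close>

lemma energy_data_low:
  fixes u v :: "'n::finite fourier"
  assumes s: "0 \<le> s0" "s0 \<le> s1" and u: "u \<in> sobolev (s1 + 1 / 2)" and v: "v \<in> sobolev (s1 - 1 / 2)"
    and small: "pair_norm s1 u v + 2 powr s1 * pair_norm 0 u v \<le> \<delta>"
  defines "h \<equiv> \<lambda>j. norm (u j) + norm (v j) / japanese j"
  shows "weighted_l2 s0 h" "energy s0 h \<le> (2 * (2 powr (s0 - s1) * \<delta>))\<^sup>2"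
proof -
  have sob: "u \<in> sobolev (0 + 1 / 2)" "v \<in> sobolev (0 - 1 / 2)"
    using u v s weighted_l2_antimono[of "s1 + 1 / 2" u "0 + 1 / 2"] weighted_l2_antimono[of "s1 - 1 / 2" v "0 - 1 / 2"]
    by (simp_all add: sobolev_iff)
  \<comment> \<open>The half derivative is given up at both ends, so that the interpolation runs
    between the exponents \<open>s1\<close> and \<open>0\<close>.\<close>
  have hi: "weighted_l2 s1 h" "energy s1 h \<le> 2 * (pair_norm s1 u v)\<^sup>2"
    using weighted_l2_antimono[OF weighted_l2_data[OF u v], of s1] energy_antimono[OF weighted_l2_data[OF u v], of s1]
      energy_data[OF u v] unfolding h_def by auto
  have lo: "weighted_l2 0 h" "energy 0 h \<le> 2 * (pair_norm 0 u v)\<^sup>2"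
    using weighted_l2_antimono[OF weighted_l2_data[OF sob], of 0] energy_antimono[OF weighted_l2_data[OF sob], of 0]
      energy_data[OF sob] unfolding h_def by auto
  let ?g = "2 powr (s0 - s1)" and ?P = "pair_norm s1 u v" and ?Q = "2 powr s1 * pair_norm 0 u v"
  have "(\<Sum>j\<in>J. japanese j powr (2 * s0) * (norm (h j))\<^sup>2) \<le> (2 * (?g * \<delta>))\<^sup>2" if J: "finite J" for J
  proof -
    have "japanese j powr (2 * s0) * (norm (h j))\<^sup>2
      \<le> 2 * ?g\<^sup>2 * (japanese j powr (2 * s1) * (norm (h j))\<^sup>2 + (2 powr s1)\<^sup>2 * (japanese j powr (2 * 0) * (norm (h j))\<^sup>2))" for j
    proof -
      have "(japanese j powr s0)\<^sup>2 \<le> (?g * (japanese j powr s1 + 2 powr s1))\<^sup>2"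
        by (intro power_mono powr_interpolation s japanese_ge_1) auto
      also have "\<dots> \<le> ?g\<^sup>2 * (2 * (japanese j powr s1)\<^sup>2 + 2 * (2 powr s1)\<^sup>2)"
        unfolding power_mult_distrib using norm_add_squared_le[of "japanese j powr s1" "2 powr s1"]
        by (intro mult_left_mono) auto
      finally have "japanese j powr (2 * s0) \<le> 2 * ?g\<^sup>2 * (japanese j powr (2 * s1) + (2 powr s1)\<^sup>2)"
        by (simp add: japanese_powr_squared algebra_simps)
      from mult_right_mono[OF this, of "(norm (h j))\<^sup>2"] show ?thesis
        using japanese_pos[of j] by (simp add: algebra_simps)
    qed
    then have "(\<Sum>j\<in>J. japanese j powr (2 * s0) * (norm (h j))\<^sup>2)
      \<le> (\<Sum>j\<in>J. 2 * ?g\<^sup>2 * (japanese j powr (2 * s1) * (norm (h j))\<^sup>2 + (2 powr s1)\<^sup>2 * (japanese j powr (2 * 0) * (norm (h j))\<^sup>2)))"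
      by (rule sum_mono)
    also have "\<dots> = 2 * ?g\<^sup>2 * ((\<Sum>j\<in>J. japanese j powr (2 * s1) * (norm (h j))\<^sup>2)
        + (2 powr s1)\<^sup>2 * (\<Sum>j\<in>J. japanese j powr (2 * 0) * (norm (h j))\<^sup>2))"
      by (simp only: sum.distrib flip: sum_distrib_left)
    also have "\<dots> \<le> 2 * ?g\<^sup>2 * (2 * ?P\<^sup>2 + (2 powr s1)\<^sup>2 * (2 * (pair_norm 0 u v)\<^sup>2))"
      using order_trans[OF sum_le_energy[OF hi(1) J] hi(2)] order_trans[OF sum_le_energy[OF lo(1) J] lo(2)]
      by (intro mult_left_mono add_mono) auto
    also have "\<dots> = (2 * ?g)\<^sup>2 * (?P\<^sup>2 + ?Q\<^sup>2)" by (simp add: power_mult_distrib algebra_simps)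
    also have "?P\<^sup>2 + ?Q\<^sup>2 \<le> (?P + ?Q)\<^sup>2"
      using pair_norm_nonneg[of s1 u v] pair_norm_nonneg[of 0 u v] by (simp add: power2_sum)
    also have "\<dots> \<le> \<delta>\<^sup>2"
      using pair_norm_nonneg[of s1 u v] pair_norm_nonneg[of 0 u v] by (intro power_mono small) auto
    finally show ?thesis by (simp add: power_mult_distrib mult_left_mono mult.assoc)
  qed
  from weighted_l2I[OF this] show "weighted_l2 s0 h" "energy s0 h \<le> (2 * (?g * \<delta>))\<^sup>2" by blast+
qed

text \<open>The mass keeps the oscillators away from frequency zero. The lower bound degenerates as
  \<open>m\<close> tends to \<open>0\<close>, and through \<open>K\<close> this is how the constant
  \<open>c\<close> of the lifespan depends on \<open>m\<close>.\<close>

lemma klein_gordon_frequency_bounds: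
  fixes m :: real
  assumes m: "0 < m"
  obtains K where "1 \<le> K" "\<And>j :: int ^ 'n::finite. 1 / sqrt ((norm (freq j))\<^sup>2 + m) \<le> K / japanese j"
    "\<And>j :: int ^ 'n. sqrt ((norm (freq j))\<^sup>2 + m) \<le> K * japanese j"
proof -
  define \<omega> where "\<omega> j = sqrt ((norm (freq j))\<^sup>2 + m)" for j :: "int ^ 'n"
  define \<kappa> where "\<kappa> = sqrt (min 1 m)"
  define K where "K = 1 + sqrt (1 + m) + 1 / \<kappa>"
  have \<kappa>: "0 < \<kappa>" using m by (simp add: \<kappa>_def)
  have K1: "1 \<le> K" using \<kappa> m by (simp add: K_def)
  have \<omega>: "0 < \<omega> j" "(\<omega> j)\<^sup>2 = (norm (freq j))\<^sup>2 + m" for j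
    using m by (simp_all add: \<omega>_def add_nonneg_pos)
  have \<omega>_lower: "\<kappa> * japanese j \<le> \<omega> j" for j
  proof (rule power2_le_imp_le)
    have "min 1 m * (japanese j)\<^sup>2 \<le> (norm (freq j))\<^sup>2 + m"
    proof (cases "norm (freq j) \<le> 1")
      case True
      then have "japanese j = 1" by (simp add: japanese_def)
      moreover have "min 1 m \<le> (norm (freq j))\<^sup>2 + m" by (rule min.coboundedI2) simp
      ultimately show ?thesis by simp
    next
      case False
      then have "min 1 m * (japanese j)\<^sup>2 \<le> 1 * (norm (freq j))\<^sup>2"
        by (intro mult_mono) (auto simp: japanese_def)
      then show ?thesis using m by simp
    qed
    then show "(\<kappa> * japanese j)\<^sup>2 \<le> (\<omega> j)\<^sup>2" using m \<omega>(2) by (simp add: \<kappa>_def power_mult_distrib)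
  qed (use \<omega>(1)[of j] in simp)
  have inverse_\<omega>: "1 / \<omega> j \<le> K / japanese j" for j
  proof -
    have "1 / \<omega> j \<le> 1 / (\<kappa> * japanese j)"
      using \<omega>_lower[of j] \<kappa> japanese_pos[of j] \<omega>(1)[of j] by (intro divide_left_mono) auto
    also have "\<dots> = (1 / \<kappa>) / japanese j" by simp
    also have "\<dots> \<le> K / japanese j"
      using m japanese_pos[of j] by (intro divide_right_mono) (auto simp: K_def)
    finally show ?thesis .
  qed
  have \<omega>_upper: "\<omega> j \<le> K * japanese j" for j
  proof -
    have "norm (freq j) \<le> japanese j" by (simp add: japanese_def)
    then have "(norm (freq j))\<^sup>2 \<le> (japanese j)\<^sup>2" by (intro power_mono) auto
    moreover have "m \<le> m * (japanese j)\<^sup>2" using m japanese_ge_1[of j] by (simp add: one_le_power mult_le_cancel_left1)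
    ultimately have "(norm (freq j))\<^sup>2 + m \<le> (1 + m) * (japanese j)\<^sup>2"
      unfolding distrib_right by linarith
    then have "(\<omega> j)\<^sup>2 \<le> (sqrt (1 + m) * japanese j)\<^sup>2"
      using m \<omega>(2)[of j] by (simp add: power_mult_distrib)
    then have "\<omega> j \<le> sqrt (1 + m) * japanese j"
      by (rule power2_le_imp_le) (use m japanese_nonneg[of j] in simp)
    also have "\<dots> \<le> K * japanese j" using \<kappa> japanese_nonneg[of j] by (intro mult_right_mono) (auto simp: K_def)
    finally show ?thesis .
  qed
  show ?thesis
    using that[OF K1] inverse_\<omega> \<omega>_upper unfolding \<omega>_def by blast
qed

text \<open>\<open>c\<close> and \<open>C\<close> are fixed before \<open>\<delta>\<close>,
  \<open>s1\<close>, \<open>s\<close> and the data. One interval serves every \<open>s\<close>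
  because the absolute-sum norm alone decides its length; the high norm follows through
  \<open>solution_bound\<close>.\<close>

lemma long_time_solution:
  fixes s0 m :: real and q :: nat
  assumes s0_gt: "s0 > real CARD('n::finite) / 2" and m: "0 < m"
  obtains c C where "0 < c" "\<And>s. 0 < C s"
    "\<And>\<delta> s1 s (\<psi>\<^sub>0 :: 'n fourier) \<phi>\<^sub>0. \<lbrakk>0 < \<delta>; s0 \<le> s1; s1 + 1 \<le> s; \<psi>\<^sub>0 \<in> sobolev (s + 1 / 2); \<phi>\<^sub>0 \<in> sobolev (s - 1 / 2);
        pair_norm s1 \<psi>\<^sub>0 \<phi>\<^sub>0 + 2 powr s1 * pair_norm 0 \<psi>\<^sub>0 \<phi>\<^sub>0 \<le> \<delta>\<rbrakk> \<Longrightarrow>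
      \<exists>\<psi> \<psi>\<^sub>t. KG_solution q m s (T_good q s0 s1 \<delta> 1 c) \<psi>\<^sub>0 \<phi>\<^sub>0 \<psi> \<psi>\<^sub>t \<and>
        (\<forall>\<eta> \<eta>\<^sub>t. KG_solution q m s (T_good q s0 s1 \<delta> 1 c) \<psi>\<^sub>0 \<phi>\<^sub>0 \<eta> \<eta>\<^sub>t \<longrightarrow>
          (\<forall>t\<in>{0..T_good q s0 s1 \<delta> 1 c}. \<eta> t = \<psi> t)) \<and>
        (\<forall>t\<in>{0..T_good q s0 s1 \<delta> 1 c}. pair_norm s (\<psi> t) (\<psi>\<^sub>t t) \<le> C s * pair_norm s \<psi>\<^sub>0 \<phi>\<^sub>0)"
proof -
  define \<omega> where "\<omega> j = sqrt ((norm (freq j))\<^sup>2 + m)" for j :: "int ^ 'n"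
  obtain K where K1: "1 \<le> K" and inverse_\<omega>: "\<And>j. 1 / \<omega> j \<le> K / japanese j" and \<omega>_upper: "\<And>j. \<omega> j \<le> K * japanese j"
    using klein_gordon_frequency_bounds[OF m, where 'n = 'n] unfolding \<omega>_def by blast
  have \<omega>: "0 < \<omega> j" "(\<omega> j)\<^sup>2 = (norm (freq j))\<^sup>2 + m" for j
    using m by (simp_all add: \<omega>_def add_nonneg_pos)
  have inverse_\<omega>_K: "1 / \<omega> j \<le> K" for j
    using inverse_\<omega>[of j] divide_left_mono[of 1 "japanese j" K] K1 japanese_ge_1[of j] by simp
  \<comment> \<open>\<open>S - 1\<close> is the embedding constant at \<open>s0\<close>, and the
    added \<open>1\<close> keeps \<open>S\<close> away from zero. The data will have absolute sum at
    most \<open>S * (2 * \<epsilon>)\<close>, so the radius \<open>4 * K * S * \<epsilon>\<close>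
    gives \<open>h_small\<close>; \<open>c\<close> is then solved from
    \<open>K * T * R ^ q = 1 / 2\<close>.\<close>
  define S where "S = 1 + sqrt (\<Sum>\<^sub>\<infinity>j :: int ^ 'n. japanese j powr (- (2 * s0)))"
  define c where "c = 2 * K * (4 * K * S) ^ q"
  \<comment> \<open>The root bounds the norm of the majorant: \<open>4\<close> comes from
    \<open>solution_bound\<close>, a further \<open>2\<close> from \<open>energy_data\<close>. The
    outer \<open>2\<close> counts position and velocity.\<close>
  define C where "C s = 2 * sqrt (8 * K\<^sup>2 * exp (tame_const (s - 1 / 2) q))" for s
  have s0: "0 < s0" by (rule le_less_trans[OF _ s0_gt]) simp
  have S1: "1 \<le> S" by (simp add: S_def infsum_nonneg)
  have c: "0 < c" using K1 S1 by (simp add: c_def)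
  have C: "0 < C s" for s using K1 by (simp add: C_def)
  show ?thesis
  proof (rule that[of c C, OF c C])
    fix \<delta> s1 s :: real and \<psi>\<^sub>0 \<phi>\<^sub>0 :: "'n fourier"
    assume \<delta>: "0 < \<delta>" and s1: "s0 \<le> s1" and s: "s1 + 1 \<le> s" and \<psi>\<^sub>0: "\<psi>\<^sub>0 \<in> sobolev (s + 1 / 2)"
      and \<phi>\<^sub>0: "\<phi>\<^sub>0 \<in> sobolev (s - 1 / 2)" and small: "pair_norm s1 \<psi>\<^sub>0 \<phi>\<^sub>0 + 2 powr s1 * pair_norm 0 \<psi>\<^sub>0 \<phi>\<^sub>0 \<le> \<delta>"
    define \<epsilon> where "\<epsilon> = 2 powr (s0 - s1) * \<delta>"
    define R where "R = 4 * K * S * \<epsilon>"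
    define T where "T = T_good q s0 s1 \<delta> 1 c"
    have \<epsilon>: "0 < \<epsilon>" using \<delta> by (simp add: \<epsilon>_def)
    have R: "0 < R" using K1 S1 \<epsilon> by (simp add: R_def)
    have T_eq: "T = 1 / (c * \<epsilon> ^ q)"
    proof -
      have "(2 powr (s0 - s1)) ^ q = 1 / 2 powr (real q * (s1 - s0))"
        unfolding powr_minus_divide[symmetric] by (simp add: powr_power algebra_simps)
      then show ?thesis
        by (simp add: T_def T_good_def \<epsilon>_def power_mult_distrib)
    qed
    have T: "0 < T" using c \<epsilon> by (simp add: T_eq)
    have T_small: "K * T * R ^ q \<le> 1 / 2"
    proof -
      have "K * R ^ q = 1 / 2 * (c * \<epsilon> ^ q)" by (simp add: R_def c_def power_mult_distrib)
      then have "K * T * R ^ q = 1 / 2 * (c * \<epsilon> ^ q) * T" by (simp add: mult_ac)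
      also have "\<dots> = 1 / 2" using c \<epsilon> by (simp add: T_eq)
      finally show ?thesis by simp
    qed
    define h where "h j = norm (\<psi>\<^sub>0 j) + norm (\<phi>\<^sub>0 j) / japanese j" for j
    let ?N = "pair_norm s \<psi>\<^sub>0 \<phi>\<^sub>0"
    have s_half: "s \<ge> 1 / 2" "s + 1 / 2 > real CARD('n) / 2" using s s1 s0 s0_gt by linarith+
    have "\<psi>\<^sub>0 \<in> sobolev (s1 + 1 / 2)" "\<phi>\<^sub>0 \<in> sobolev (s1 - 1 / 2)"
      using weighted_l2_antimono[of "s + 1 / 2" \<psi>\<^sub>0 "s1 + 1 / 2"] weighted_l2_antimono[of "s - 1 / 2" \<phi>\<^sub>0 "s1 - 1 / 2"]
        \<psi>\<^sub>0 \<phi>\<^sub>0 s by (simp_all add: sobolev_iff)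
    note low = energy_data_low[OF less_imp_le[OF s0] _ this, of \<delta>, folded h_def]
    have h_low: "weighted_l2 s0 h" "energy s0 h \<le> (2 * \<epsilon>)\<^sup>2"
      using low s1 small by (simp_all add: \<epsilon>_def h_def[abs_def])
    have h_high: "weighted_l2 (s + 1 / 2) h" "energy (s + 1 / 2) h \<le> 2 * ?N\<^sup>2"
      using weighted_l2_data[OF \<psi>\<^sub>0 \<phi>\<^sub>0] energy_data[OF \<psi>\<^sub>0 \<phi>\<^sub>0] by (simp_all add: h_def[abs_def])
    have h0: "0 \<le> h j" for j using japanese_nonneg[of j] by (simp add: h_def)
    have "wiener_norm h \<le> S * (2 * \<epsilon>)"
    proof -
      have "sqrt (energy s0 h) \<le> 2 * \<epsilon>"
        by (rule real_le_lsqrt) (use h_low(2) \<epsilon> in simp_all)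
      then have "(S - 1) * sqrt (energy s0 h) \<le> S * (2 * \<epsilon>)"
        using S1 energy_nonneg[of s0 h] by (intro mult_mono) auto
      moreover have "wiener_norm h \<le> (S - 1) * sqrt (energy s0 h)"
        using wiener_norm_le_energy[OF h_low(1) s0_gt] by (simp add: S_def)
      ultimately show ?thesis by linarith
    qed
    then have h_small: "K * infsum h UNIV \<le> R / 2"
      using K1 mult_left_mono[of "wiener_norm h" "S * (2 * \<epsilon>)" K] h0 by (simp add: wiener_norm_def R_def mult_ac)
    interpret klein_gordon_iteration q \<omega> K T R h \<psi>\<^sub>0 \<phi>\<^sub>0
    proof
      show "h summable_on UNIV"
        by (rule abs_summable_realD[OF abs_summable_weighted_l2[OF h_low(1) s0_gt]])
    qed (use \<omega> inverse_\<omega> \<omega>_upper K1 T R h_small T_small in \<open>auto simp: h_def\<close>)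
    let ?\<psi>\<^sub>t = "flow_deriv (\<lambda>\<tau>. conv_power (solution \<tau>) q)"
    have shift: "s - 1 / 2 + 1 = s + 1 / 2" by simp
    obtain b where b: "weighted_l2 (s + 1 / 2) b"
        "energy (s + 1 / 2) b \<le> 4 * K\<^sup>2 * exp (tame_const (s - 1 / 2) q) * energy (s + 1 / 2) h"
        "\<And>t j. t \<in> {0..T} \<Longrightarrow> norm (solution t j) \<le> b j"
        "\<And>t j. t \<in> {0..T} \<Longrightarrow> norm (?\<psi>\<^sub>t t j) \<le> japanese j * b j"
      using solution_bound[of "s - 1 / 2", unfolded shift, OF h_high(1)] s_half by auto
    have KG: "KG_solution q m s T \<psi>\<^sub>0 \<phi>\<^sub>0 solution ?\<psi>\<^sub>t"
      by (rule solution_KG[OF \<omega>(2) s_half(2,1) b(1,3,4)])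
    have bound: "pair_norm s (solution t) (?\<psi>\<^sub>t t) \<le> C s * ?N" if t: "t \<in> {0..T}" for t
    proof -
      have b0: "0 \<le> b j" for j using order_trans[OF norm_ge_zero b(3)[OF t]] .
      have "energy (s + 1 / 2) b \<le> 4 * K\<^sup>2 * exp (tame_const (s - 1 / 2) q) * (2 * ?N\<^sup>2)"
        using h_high(2) by (intro order_trans[OF b(2)] mult_left_mono) auto
      then have "sqrt (energy (s + 1 / 2) b) \<le> sqrt (8 * K\<^sup>2 * exp (tame_const (s - 1 / 2) q) * ?N\<^sup>2)"
        by (intro real_sqrt_le_mono) simp
      also have "\<dots> = C s / 2 * ?N"
        by (simp add: C_def real_sqrt_mult pair_norm_nonneg)
      finally have *: "sqrt (energy (s + 1 / 2) b) \<le> C s / 2 * ?N" .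
      have "energy (s + 1 / 2) (solution t) \<le> energy (s + 1 / 2) b"
        by (rule energy_mono[OF b(1)]) (use b(3)[OF t] b0 in simp)
      moreover have "energy (s - 1 / 2) (?\<psi>\<^sub>t t) \<le> energy (s + 1 / 2) b"
      proof -
        note wb = weighted_l2_japanese_mult[of "s - 1 / 2" b, unfolded shift, OF b(1)]
        have "energy (s - 1 / 2) (?\<psi>\<^sub>t t) \<le> energy (s - 1 / 2) (\<lambda>j. japanese j * b j)"
          by (rule energy_mono[OF wb(1)], rule order_trans[OF b(4)[OF t]]) simp
        then show ?thesis using wb(2) by linarith
      qed
      ultimately have "sqrt (energy (s + 1 / 2) (solution t)) + sqrt (energy (s - 1 / 2) (?\<psi>\<^sub>t t))
          \<le> C s / 2 * ?N + C s / 2 * ?N"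
        by (intro add_mono order_trans[OF _ *] real_sqrt_le_mono)
      then show ?thesis
        unfolding pair_norm_def[of s "solution t"] sobolev_norm_eq by simp
    qed
    have "\<exists>\<psi> \<psi>\<^sub>t. KG_solution q m s T \<psi>\<^sub>0 \<phi>\<^sub>0 \<psi> \<psi>\<^sub>t \<and>
        (\<forall>\<eta> \<eta>\<^sub>t. KG_solution q m s T \<psi>\<^sub>0 \<phi>\<^sub>0 \<eta> \<eta>\<^sub>t \<longrightarrow> (\<forall>t\<in>{0..T}. \<eta> t = \<psi> t)) \<and>
        (\<forall>t\<in>{0..T}. pair_norm s (\<psi> t) (\<psi>\<^sub>t t) \<le> C s * ?N)"
      using KG bound KG_solution_unique[OF _ KG s_half(2) \<omega> inverse_\<omega>_K] by blast
    then show "\<exists>\<psi> \<psi>\<^sub>t. KG_solution q m s (T_good q s0 s1 \<delta> 1 c) \<psi>\<^sub>0 \<phi>\<^sub>0 \<psi> \<psi>\<^sub>t \<and>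
        (\<forall>\<eta> \<eta>\<^sub>t. KG_solution q m s (T_good q s0 s1 \<delta> 1 c) \<psi>\<^sub>0 \<phi>\<^sub>0 \<eta> \<eta>\<^sub>t \<longrightarrow>
          (\<forall>t\<in>{0..T_good q s0 s1 \<delta> 1 c}. \<eta> t = \<psi> t)) \<and>
        (\<forall>t\<in>{0..T_good q s0 s1 \<delta> 1 c}. pair_norm s (\<psi> t) (\<psi>\<^sub>t t) \<le> C s * pair_norm s \<psi>\<^sub>0 \<phi>\<^sub>0)"
      unfolding T_def .
  qed
qed

theorem theorem1p3:
  fixes q :: nat and s0 :: real
  assumes "q \<ge> 1" and "s0 > real CARD('n::finite) / 2"
  shows
    "\<exists>M>0. \<forall>m>0. \<exists>c>0. \<exists>\<delta>0>0. \<exists>C :: real \<Rightarrow> real. (\<forall>s. C s > 0) \<and>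
      (\<forall>(\<delta>::real) (s1::real). 0 < \<delta> \<and> \<delta> < \<delta>0 \<and> s1 \<ge> s0 \<longrightarrow>
        (\<exists>T>0. T \<ge> T_good q s0 s1 \<delta> M c \<and>
          (\<forall>s \<ge> s1 + 1. \<forall>(\<psi>\<^sub>0 :: 'n fourier) \<in> sobolev (s + 1/2). \<forall>\<phi>\<^sub>0 \<in> sobolev (s - 1/2).
            pair_norm s1 \<psi>\<^sub>0 \<phi>\<^sub>0 + (2 * M) powr s1 * pair_norm 0 \<psi>\<^sub>0 \<phi>\<^sub>0 \<le> \<delta> \<longrightarrow>
            (\<exists>\<psi> \<psi>\<^sub>t. KG_solution q m s T \<psi>\<^sub>0 \<phi>\<^sub>0 \<psi> \<psi>\<^sub>t \<and>
              (\<forall>\<eta> \<eta>\<^sub>t. KG_solution q m s T \<psi>\<^sub>0 \<phi>\<^sub>0 \<eta> \<eta>\<^sub>t \<longrightarrow> (\<forall>t\<in>{0..T}. \<eta> t = \<psi> t)) \<and>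
              (\<forall>t\<in>{0..T}. pair_norm s (\<psi> t) (\<psi>\<^sub>t t) \<le> C s * pair_norm s \<psi>\<^sub>0 \<phi>\<^sub>0 *
                (1 + (M powr (real q * (s - s1)) * (t / T_good q s0 s1 \<delta> M c)) powr (s - s1))) \<and>
              (\<forall>T'. 0 \<le> T' \<and> T' \<le> T_good q s0 s1 \<delta> M c \<longrightarrow>
                bdd_above ((\<lambda>t. pair_norm s (\<psi> t) (\<psi>\<^sub>t t)) ` {0..T'}) \<and>
                (SUP t\<in>{0..T'}. pair_norm s (\<psi> t) (\<psi>\<^sub>t t)) \<le>
                  C s * pair_norm s \<psi>\<^sub>0 \<phi>\<^sub>0 * (1 + M powr (real q * (s - s1)\<^sup>2)))))))"
  \<comment> \<open>With \<open>M = 1\<close> all powers of \<open>M\<close> in the conclusion equal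
    \<open>1\<close>, and both growth factors are at least \<open>1\<close>, so the uniform bound of
    \<open>long_time_solution\<close> implies the two estimates.\<close>
  apply (rule exI[of _ 1], intro conjI zero_less_one allI impI)
  subgoal premises m for m
  proof -
    obtain c C where c: "0 < c" and C: "\<And>s. 0 < C s" and sol:
      "\<And>\<delta> s1 s (\<psi>\<^sub>0 :: 'n fourier) \<phi>\<^sub>0. \<lbrakk>0 < \<delta>; s0 \<le> s1; s1 + 1 \<le> s; \<psi>\<^sub>0 \<in> sobolev (s + 1 / 2); \<phi>\<^sub>0 \<in> sobolev (s - 1 / 2);
          pair_norm s1 \<psi>\<^sub>0 \<phi>\<^sub>0 + 2 powr s1 * pair_norm 0 \<psi>\<^sub>0 \<phi>\<^sub>0 \<le> \<delta>\<rbrakk> \<Longrightarrow>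
        \<exists>\<psi> \<psi>\<^sub>t. KG_solution q m s (T_good q s0 s1 \<delta> 1 c) \<psi>\<^sub>0 \<phi>\<^sub>0 \<psi> \<psi>\<^sub>t \<and>
          (\<forall>\<eta> \<eta>\<^sub>t. KG_solution q m s (T_good q s0 s1 \<delta> 1 c) \<psi>\<^sub>0 \<phi>\<^sub>0 \<eta> \<eta>\<^sub>t \<longrightarrow>
            (\<forall>t\<in>{0..T_good q s0 s1 \<delta> 1 c}. \<eta> t = \<psi> t)) \<and>
          (\<forall>t\<in>{0..T_good q s0 s1 \<delta> 1 c}. pair_norm s (\<psi> t) (\<psi>\<^sub>t t) \<le> C s * pair_norm s \<psi>\<^sub>0 \<phi>\<^sub>0)"
      using long_time_solution[where q = q, OF assms(2) m] by blast
    show ?thesis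
      apply (rule exI[of _ c], rule conjI[OF c], rule exI[of _ 1], rule conjI[OF zero_less_one], rule exI[of _ C])
      apply (intro conjI allI impI C)
      subgoal premises \<delta> for \<delta> s1
      \<comment> \<open>\<open>T\<close> has to be named before \<open>s\<close> and the data; its
        value involves neither.\<close>
      proof (rule exI[of _ "T_good q s0 s1 \<delta> 1 c"], intro conjI allI impI ballI order_refl)
        show "0 < T_good q s0 s1 \<delta> 1 c" using \<delta> c by (simp add: T_good_def)
      next
        fix s and \<psi>\<^sub>0 \<phi>\<^sub>0 :: "'n fourier"
        let ?T = "T_good q s0 s1 \<delta> 1 c" and ?N = "C s * pair_norm s \<psi>\<^sub>0 \<phi>\<^sub>0"
        assume "s \<ge> s1 + 1" "\<psi>\<^sub>0 \<in> sobolev (s + 1 / 2)" "\<phi>\<^sub>0 \<in> sobolev (s - 1 / 2)"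
          "pair_norm s1 \<psi>\<^sub>0 \<phi>\<^sub>0 + (2 * 1) powr s1 * pair_norm 0 \<psi>\<^sub>0 \<phi>\<^sub>0 \<le> \<delta>"
        with sol[of \<delta> s1 s \<psi>\<^sub>0 \<phi>\<^sub>0] \<delta> obtain \<psi> \<psi>\<^sub>t where KG: "KG_solution q m s ?T \<psi>\<^sub>0 \<phi>\<^sub>0 \<psi> \<psi>\<^sub>t"
          and unique: "\<forall>\<eta> \<eta>\<^sub>t. KG_solution q m s ?T \<psi>\<^sub>0 \<phi>\<^sub>0 \<eta> \<eta>\<^sub>t \<longrightarrow> (\<forall>t\<in>{0..?T}. \<eta> t = \<psi> t)"
          and bound: "\<forall>t\<in>{0..?T}. pair_norm s (\<psi> t) (\<psi>\<^sub>t t) \<le> ?N"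
          by auto
        have N: "0 \<le> ?N" using C[of s] pair_norm_nonneg[of s \<psi>\<^sub>0 \<phi>\<^sub>0] by simp
        have "pair_norm s (\<psi> t) (\<psi>\<^sub>t t) \<le> ?N * (1 + (1 powr (real q * (s - s1)) * (t / ?T)) powr (s - s1))"
          if "t \<in> {0..?T}" for t
          using N by (intro order_trans[OF bspec[OF bound that]]) (simp only: mult_le_cancel_left1, simp)
        moreover have "bdd_above ((\<lambda>t. pair_norm s (\<psi> t) (\<psi>\<^sub>t t)) ` {0..T'}) \<and>
            (SUP t\<in>{0..T'}. pair_norm s (\<psi> t) (\<psi>\<^sub>t t)) \<le> ?N * (1 + 1 powr (real q * (s - s1)\<^sup>2))"
          if "0 \<le> T' \<and> T' \<le> ?T" for T'
        proof
          have le: "pair_norm s (\<psi> t) (\<psi>\<^sub>t t) \<le> ?N" if "t \<in> {0..T'}" for t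
            using bound that \<open>0 \<le> T' \<and> T' \<le> ?T\<close> by simp
          then show "bdd_above ((\<lambda>t. pair_norm s (\<psi> t) (\<psi>\<^sub>t t)) ` {0..T'})" by (rule bdd_aboveI2)
          have "(SUP t\<in>{0..T'}. pair_norm s (\<psi> t) (\<psi>\<^sub>t t)) \<le> ?N"
            using that le by (intro cSUP_least) auto
          then show "(SUP t\<in>{0..T'}. pair_norm s (\<psi> t) (\<psi>\<^sub>t t)) \<le> ?N * (1 + 1 powr (real q * (s - s1)\<^sup>2))"
            using N by simp
        qed
        ultimately show "\<exists>\<psi> \<psi>\<^sub>t. KG_solution q m s ?T \<psi>\<^sub>0 \<phi>\<^sub>0 \<psi> \<psi>\<^sub>t \<and>
              (\<forall>\<eta> \<eta>\<^sub>t. KG_solution q m s ?T \<psi>\<^sub>0 \<phi>\<^sub>0 \<eta> \<eta>\<^sub>t \<longrightarrow> (\<forall>t\<in>{0..?T}. \<eta> t = \<psi> t)) \<and>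
              (\<forall>t\<in>{0..?T}. pair_norm s (\<psi> t) (\<psi>\<^sub>t t) \<le> ?N *
                (1 + (1 powr (real q * (s - s1)) * (t / ?T)) powr (s - s1))) \<and>
              (\<forall>T'. 0 \<le> T' \<and> T' \<le> ?T \<longrightarrow>
                bdd_above ((\<lambda>t. pair_norm s (\<psi> t) (\<psi>\<^sub>t t)) ` {0..T'}) \<and>
                (SUP t\<in>{0..T'}. pair_norm s (\<psi> t) (\<psi>\<^sub>t t)) \<le> ?N * (1 + 1 powr (real q * (s - s1)\<^sup>2)))"
          using KG unique by blast
      qed
      done
  qed
  done

end
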